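(* Any nilpotent orbit of $\mathfrak{sp}(p,q)$ is stable under negation (that is, if $\mathcal O$ is the adjoint orbit of a nilpotent element, then $-\mathcal O=\mathcal O$). In particular, no nonzero nilpotent orbit of $\mathfrak{sp}(p,q)$ admits Gibbs states.
   Context: $\mathrm{Sp}(p,q)$ is the (connected) group of $\mathbb H$-linear automorphisms of $\mathbb H^{p+q}$ preserving a Hermitian product of signature $(p,q)$, and $\mathfrak{sp}(p,q)$ is its Lie algebra. Adjoint orbits are taken under this connected group; a nilpotent orbit is the adjoint orbit of a nilpotent element. Gibbs states: for a real semisimple Lie algebra $\mathfrak g$ with Killing form $\kappa$, an adjoint orbit $\mathcal O$ carries the symplectic form $\omega_{\mathcal O}|_y([X,y],[Y,y])=\kappa(y,[X,Y])$ and the Liouville form $\lambda_{\mathcal O}=\omega_{\mathcal O}^{\dim\mathcal O/2}$. For $\beta\in\mathfrak g^*$ put $Z(\beta)=\int_{\mathcal O}e^{-\langle\beta,y\rangle}|\lambda_{\mathcal O}|(y)\in(0,+\infty]$. When $Z(\beta)<\infty$, the probability distribution $Z(\beta)^{-1}e^{-\langle\beta,y\rangle}|\lambda_{\mathcal O}|(y)$ is called a Gibbs state; $\mathcal O$ admits Gibbs states if $Z(\beta)<\infty$ for some $\beta$. *)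

theory Defs
  imports "HOL-Analysis.Analysis"
begin

section \<open>Quaternions\<close>

datatype quat = Quat (Qre: real) (Qi: real) (Qj: real) (Qk: real)

lemma quat_eq_iff: "x = y \<longleftrightarrow> Qre x = Qre y \<and> Qi x = Qi y \<and> Qj x = Qj y \<and> Qk x = Qk y"
  by (cases x; cases y) simp

instantiation quat :: ring_1
begin

definition "0 = Quat 0 0 0 0"
definition "1 = Quat 1 0 0 0"
definition "x + y = Quat (Qre x + Qre y) (Qi x + Qi y) (Qj x + Qj y) (Qk x + Qk y)"
definition "- x = Quat (- Qre x) (- Qi x) (- Qj x) (- Qk x)"
definition "x - y = Quat (Qre x - Qre y) (Qi x - Qi y) (Qj x - Qj y) (Qk x - Qk y)"
definition "x * y = Quat
  (Qre x * Qre y - Qi x * Qi y - Qj x * Qj y - Qk x * Qk y)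
  (Qre x * Qi y + Qi x * Qre y + Qj x * Qk y - Qk x * Qj y)
  (Qre x * Qj y - Qi x * Qk y + Qj x * Qre y + Qk x * Qi y)
  (Qre x * Qk y + Qi x * Qj y - Qj x * Qi y + Qk x * Qre y)"

instance
  by intro_classes
    (simp_all add: zero_quat_def one_quat_def plus_quat_def uminus_quat_def minus_quat_def
      times_quat_def algebra_simps)

end

lemma quat_sel [simp]:
  "Qre 0 = 0" "Qi 0 = 0" "Qj 0 = 0" "Qk 0 = 0"
  "Qre 1 = 1" "Qi 1 = 0" "Qj 1 = 0" "Qk 1 = 0"
  "Qre (x + y) = Qre x + Qre y" "Qi (x + y) = Qi x + Qi y"
  "Qj (x + y) = Qj x + Qj y" "Qk (x + y) = Qk x + Qk y"
  "Qre (x - y) = Qre x - Qre y" "Qi (x - y) = Qi x - Qi y"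
  "Qj (x - y) = Qj x - Qj y" "Qk (x - y) = Qk x - Qk y"
  "Qre (- x) = - Qre x" "Qi (- x) = - Qi x" "Qj (- x) = - Qj x" "Qk (- x) = - Qk x"
  "Qre (x * y) = Qre x * Qre y - Qi x * Qi y - Qj x * Qj y - Qk x * Qk y"
  "Qi (x * y) = Qre x * Qi y + Qi x * Qre y + Qj x * Qk y - Qk x * Qj y"
  "Qj (x * y) = Qre x * Qj y - Qi x * Qk y + Qj x * Qre y + Qk x * Qi y"
  "Qk (x * y) = Qre x * Qk y + Qi x * Qj y - Qj x * Qi y + Qk x * Qre y"
  by (simp_all add: zero_quat_def one_quat_def plus_quat_def uminus_quat_def minus_quat_def
      times_quat_def)

instantiation quat :: real_algebra_1
begin

definition "r *\<^sub>R x = Quat (r * Qre x) (r * Qi x) (r * Qj x) (r * Qk x)"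

instance
  by intro_classes (simp_all add: scaleR_quat_def quat_eq_iff algebra_simps)

end

lemma quat_sel_scaleR [simp]:
  "Qre (r *\<^sub>R x) = r * Qre x" "Qi (r *\<^sub>R x) = r * Qi x"
  "Qj (r *\<^sub>R x) = r * Qj x" "Qk (r *\<^sub>R x) = r * Qk x"
  by (simp_all add: scaleR_quat_def)

instantiation quat :: real_inner
begin

definition inner_quat_def:
  "inner x y = Qre x * Qre y + Qi x * Qi y + Qj x * Qj y + Qk x * Qk y"
definition norm_quat_def: "norm (x :: quat) = sqrt (inner x x)"
definition sgn_quat_def: "sgn (x :: quat) = x /\<^sub>R norm x"
definition dist_quat_def: "dist (x :: quat) y = norm (x - y)"
definition uniformity_quat_def [code del]:
  "(uniformity :: (quat \<times> quat) filter) = (INF e\<in>{0 <..}. principal {(x, y). dist x y < e})"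
definition open_quat_def [code del]:
  "open (U :: quat set) \<longleftrightarrow> (\<forall>x\<in>U. eventually (\<lambda>(x', y). x' = x \<longrightarrow> y \<in> U) uniformity)"

instance
proof
  fix x y z :: quat and r :: real
  show "inner x y = inner y x"
    by (simp add: inner_quat_def mult.commute)
  show "inner (x + y) z = inner x z + inner y z"
    by (simp add: inner_quat_def algebra_simps)
  show "inner (r *\<^sub>R x) y = r * inner x y"
    by (simp add: inner_quat_def algebra_simps)
  show "0 \<le> inner x x"
    by (simp add: inner_quat_def)
  show "inner x x = 0 \<longleftrightarrow> x = 0"
  proof
    assume "inner x x = 0"
    then have "(Qre x * Qre x + Qi x * Qi x) + (Qj x * Qj x + Qk x * Qk x) = 0"
      by (simp add: inner_quat_def)
    then have "Qre x * Qre x + Qi x * Qi x = 0" "Qj x * Qj x + Qk x * Qk x = 0"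
      by (smt (verit) zero_le_square)+
    then show "x = 0"
      by (simp add: quat_eq_iff sum_squares_eq_zero_iff)
  qed (simp add: inner_quat_def)
qed (simp_all add: norm_quat_def sgn_quat_def dist_quat_def uniformity_quat_def open_quat_def)

end

instantiation quat :: euclidean_space
begin

definition Basis_quat_def:
  "Basis = {Quat 1 0 0 0, Quat 0 1 0 0, Quat 0 0 1 0, Quat 0 0 0 1}"

instance
proof
  show "(Basis :: quat set) \<noteq> {}" "finite (Basis :: quat set)"
    by (simp_all add: Basis_quat_def)
next
  fix u v :: quat
  assume "u \<in> Basis" "v \<in> Basis"
  then show "inner u v = (if u = v then 1 else 0)"
    unfolding Basis_quat_def by (elim insertE emptyE) (simp_all add: inner_quat_def)
next
  fix x :: quat
  show "(\<forall>u\<in>Basis. inner x u = 0) \<longleftrightarrow> x = 0"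
    unfolding Basis_quat_def by (cases x) (simp add: inner_quat_def zero_quat_def)
qed

end

definition qcnj :: "quat \<Rightarrow> quat" where
  "qcnj x = Quat (Qre x) (- Qi x) (- Qj x) (- Qk x)"


section \<open>The group \<open>Sp(p,q)\<close> and its Lie algebra\<close>

text \<open>
  \<open>quat ^ 'n\<close> is regarded as a right vector space over the quaternions, so that its linear
  endomorphisms are exactly the maps \<open>x \<mapsto> A *v x\<close> for quaternionic matrices \<open>A\<close>.
\<close>

definition rscale :: "quat ^ 'n \<Rightarrow> quat \<Rightarrow> quat ^ 'n" where
  "rscale x a = (\<chi> i. x $ i * a)"

definition hermitian_product :: "(quat ^ 'n \<Rightarrow> quat ^ 'n \<Rightarrow> quat) \<Rightarrow> bool" where
  "hermitian_product h \<longleftrightarrow>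
     (\<forall>x y z. h x (y + z) = h x y + h x z) \<and>
     (\<forall>x y a. h x (rscale y a) = h x y * a) \<and>
     (\<forall>x y. h y x = qcnj (h x y))"

text \<open>
  Signature \<open>(p,q)\<close>: there is an orthogonal family of \<open>n\<close> vectors, \<open>p\<close> of square \<open>1\<close> and \<open>q\<close> of
  square \<open>-1\<close>, where \<open>n\<close> is the dimension. Such a family is automatically a basis, \<open>h\<close> is
  nondegenerate and \<open>p + q = n\<close>.
\<close>

definition has_signature :: "(quat ^ 'n \<Rightarrow> quat ^ 'n \<Rightarrow> quat) \<Rightarrow> nat \<Rightarrow> nat \<Rightarrow> bool" where
  "has_signature h p q \<longleftrightarrow>
     (\<exists>e :: 'n \<Rightarrow> quat ^ 'n.
        (\<forall>i j. i \<noteq> j \<longrightarrow> h (e i) (e j) = 0) \<and>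
        (\<forall>i. h (e i) (e i) = 1 \<or> h (e i) (e i) = - 1) \<and>
        card {i. h (e i) (e i) = 1} = p \<and>
        card {i. h (e i) (e i) = - 1} = q)"

definition Sp_group :: "(quat ^ 'n \<Rightarrow> quat ^ 'n \<Rightarrow> quat) \<Rightarrow> (quat ^ 'n ^ 'n) set" where
  "Sp_group h = {g. invertible g \<and> (\<forall>x y. h (g *v x) (g *v y) = h x y)}"

definition sp_alg :: "(quat ^ 'n \<Rightarrow> quat ^ 'n \<Rightarrow> quat) \<Rightarrow> (quat ^ 'n ^ 'n) set" where
  "sp_alg h = {X. \<forall>x y. h (X *v x) y + h x (X *v y) = 0}"

definition adjoint_orbit ::
    "(quat ^ 'n \<Rightarrow> quat ^ 'n \<Rightarrow> quat) \<Rightarrow> quat ^ 'n ^ 'n \<Rightarrow> (quat ^ 'n ^ 'n) set" where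
  "adjoint_orbit h X = {g ** X ** matrix_inv g | g. g \<in> Sp_group h}"

definition lie :: "quat ^ 'n ^ 'n \<Rightarrow> quat ^ 'n ^ 'n \<Rightarrow> quat ^ 'n ^ 'n" where
  "lie X Y = X ** Y - Y ** X"

text \<open>Nilpotency is that of \<open>ad X\<close> on the semisimple Lie algebra.\<close>

definition nilpotent_elt :: "(quat ^ 'n ^ 'n) set \<Rightarrow> quat ^ 'n ^ 'n \<Rightarrow> bool" where
  "nilpotent_elt L X \<longleftrightarrow> X \<in> L \<and> (\<exists>k. \<forall>Y\<in>L. (lie X ^^ k) Y = 0)"

definition nilpotent_orbit ::
    "(quat ^ 'n \<Rightarrow> quat ^ 'n \<Rightarrow> quat) \<Rightarrow> (quat ^ 'n ^ 'n) set \<Rightarrow> bool" where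
  "nilpotent_orbit h \<O> \<longleftrightarrow> (\<exists>X. nilpotent_elt (sp_alg h) X \<and> \<O> = adjoint_orbit h X)"


section \<open>Killing form and symplectic form of an orbit\<close>

definition trace_on :: "'a::real_vector set \<Rightarrow> ('a \<Rightarrow> 'a) \<Rightarrow> real" where
  "trace_on V f =
     (let B = (SOME B. independent B \<and> span B = V) in \<Sum>b\<in>B. representation B (f b) b)"

definition killing :: "(quat ^ 'n ^ 'n) set \<Rightarrow> quat ^ 'n ^ 'n \<Rightarrow> quat ^ 'n ^ 'n \<Rightarrow> real" where
  "killing L X Y = trace_on L (\<lambda>Z. lie X (lie Y Z))"

definition orbit_tangent :: "(quat ^ 'n ^ 'n) set \<Rightarrow> quat ^ 'n ^ 'n \<Rightarrow> (quat ^ 'n ^ 'n) set" where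
  "orbit_tangent L y = {lie X y | X. X \<in> L}"

text \<open>
  The value at \<open>y\<close> of the symplectic form on tangent vectors \<open>a = [X,y]\<close> and \<open>b = [Y,y]\<close>; by
  invariance of the Killing form it does not depend on the choice of \<open>X\<close> and \<open>Y\<close>.
\<close>

definition orbit_omega ::
    "(quat ^ 'n ^ 'n) set \<Rightarrow> quat ^ 'n ^ 'n \<Rightarrow> quat ^ 'n ^ 'n \<Rightarrow> quat ^ 'n ^ 'n \<Rightarrow> real" where
  "orbit_omega L y a b =
     (THE c. \<exists>X\<in>L. \<exists>Y\<in>L. a = lie X y \<and> b = lie Y y \<and> c = killing L y (lie X Y))"

text \<open>
  The exterior power \<open>\<omega> \<and> \<dots> \<and> \<omega>\<close> (\<open>m\<close> factors) evaluated on \<open>2m\<close> vectors, with the determinant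
  (shuffle) convention for the wedge product.
\<close>

definition wedge_power :: "('a \<Rightarrow> 'a \<Rightarrow> real) \<Rightarrow> nat \<Rightarrow> 'a list \<Rightarrow> real" where
  "wedge_power \<omega> m vs =
     (\<Sum>\<sigma> | \<sigma> permutes {..<2 * m}.
        of_int (sign \<sigma>) * (\<Prod>i<m. \<omega> (vs ! \<sigma> (2 * i)) (vs ! \<sigma> (2 * i + 1)))) / 2 ^ m"

definition liouville_form ::
    "(quat ^ 'n ^ 'n) set \<Rightarrow> quat ^ 'n ^ 'n \<Rightarrow> (quat ^ 'n ^ 'n) list \<Rightarrow> real" where
  "liouville_form L y = wedge_power (orbit_omega L y) (dim (orbit_tangent L y) div 2)"


section \<open>Liouville measure and Gibbs states\<close>

text \<open>
  Since the dimension \<open>d\<close> of an orbit is not a type, \<open>\<real>\<^sup>d\<close> is realised as the coordinate subspace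
  of the ambient matrix space spanned by a list \<open>bs\<close> of \<open>d\<close> distinct basis vectors. The following
  is Lebesgue measure on that subspace, defined as \<^const>\<open>lborel\<close> is on the whole space.
\<close>

definition lborel_coord :: "'a::euclidean_space list \<Rightarrow> 'a measure" where
  "lborel_coord bs =
     distr (\<Pi>\<^sub>M b\<in>set bs. (lborel :: real measure)) borel (\<lambda>x. \<Sum>b\<in>set bs. x b *\<^sub>R b)"

text \<open>
  A local parametrisation of an orbit is an injective \<open>C\<^sup>1\<close> map \<open>\<phi>\<close> from an open subset \<open>U\<close> of
  \<open>\<real>\<^sup>d\<close> into the orbit whose derivative is everywhere an isomorphism onto the tangent space of
  the orbit. Orbits being weakly embedded submanifolds, such a \<open>\<phi>\<close> is automatically a
  diffeomorphism onto an open subset of the orbit.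
\<close>

definition orbit_param ::
    "(quat ^ 'n ^ 'n) set \<Rightarrow> (quat ^ 'n ^ 'n) set \<Rightarrow> (quat ^ 'n ^ 'n) list \<Rightarrow>
     (quat ^ 'n ^ 'n) set \<Rightarrow> (quat ^ 'n ^ 'n \<Rightarrow> quat ^ 'n ^ 'n) \<Rightarrow>
     (quat ^ 'n ^ 'n \<Rightarrow> quat ^ 'n ^ 'n \<Rightarrow> quat ^ 'n ^ 'n) \<Rightarrow> bool" where
  "orbit_param L \<O> bs U \<phi> \<phi>' \<longleftrightarrow>
     distinct bs \<and> set bs \<subseteq> Basis \<and>
     openin (top_of_set (span (set bs))) U \<and>
     inj_on \<phi> U \<and> \<phi> ` U \<subseteq> \<O> \<and>
     (\<forall>u\<in>U. (\<phi> has_derivative \<phi>' u) (at u within span (set bs)) \<and>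
             bij_betw (\<phi>' u) (span (set bs)) (orbit_tangent L (\<phi> u))) \<and>
     (\<forall>b\<in>set bs. continuous_on U (\<lambda>u. \<phi>' u b))"

text \<open>
  The measure on the image of a parametrisation given by the density
  \<open>\<bar>\<phi>\<^sup>*\<lambda>\<bar> = \<bar>\<lambda>(\<partial>\<phi>/\<partial>b\<^sub>1, \<dots>, \<partial>\<phi>/\<partial>b\<^sub>d)\<bar> du\<close>, regarded as a measure on the ambient space.
\<close>

definition patch_measure ::
    "(quat ^ 'n ^ 'n) set \<Rightarrow> (quat ^ 'n ^ 'n) list \<Rightarrow> (quat ^ 'n ^ 'n) set \<Rightarrow>
     (quat ^ 'n ^ 'n \<Rightarrow> quat ^ 'n ^ 'n) \<Rightarrow>
     (quat ^ 'n ^ 'n \<Rightarrow> quat ^ 'n ^ 'n \<Rightarrow> quat ^ 'n ^ 'n) \<Rightarrow> (quat ^ 'n ^ 'n) measure" where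
  "patch_measure L bs U \<phi> \<phi>' =
     distr
       (density (restrict_space (lborel_coord bs) U)
          (\<lambda>u. ennreal \<bar>liouville_form L (\<phi> u) (map (\<phi>' u) bs)\<bar>))
       borel \<phi>"

text \<open>
  The measure \<open>\<bar>\<lambda>\<bar>\<close> of the orbit: its restrictions to the images of parametrisations are the patch
  measures, and as countably many patches cover the orbit it is their supremum in the lattice of
  measures. It lives on the ambient space and is concentrated on the orbit.
\<close>

definition liouville_measure ::
    "(quat ^ 'n ^ 'n) set \<Rightarrow> (quat ^ 'n ^ 'n) set \<Rightarrow> (quat ^ 'n ^ 'n) measure" where
  "liouville_measure L \<O> =
     (SUP (bs, U, \<phi>, \<phi>') \<in> {(bs, U, \<phi>, \<phi>'). orbit_param L \<O> bs U \<phi> \<phi>'}.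
        patch_measure L bs U \<phi> \<phi>')"

definition partition_function ::
    "(quat ^ 'n ^ 'n) set \<Rightarrow> (quat ^ 'n ^ 'n) set \<Rightarrow> (quat ^ 'n ^ 'n \<Rightarrow> real) \<Rightarrow> ennreal" where
  "partition_function L \<O> \<beta> = (\<integral>\<^sup>+ y. ennreal (exp (- \<beta> y)) \<partial>liouville_measure L \<O>)"

text \<open>
  Elements of the dual of \<open>L\<close> are represented by linear functionals on the ambient matrix space;
  every functional on the subspace \<open>L\<close> extends, and only the values on the orbit matter.
\<close>

definition admits_gibbs_states ::
    "(quat ^ 'n ^ 'n) set \<Rightarrow> (quat ^ 'n ^ 'n) set \<Rightarrow> bool" where
  "admits_gibbs_states L \<O> \<longleftrightarrow> (\<exists>\<beta>. linear \<beta> \<and> partition_function L \<O> \<beta> < \<infinity>)"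

end

(*
A nilpotent X in sp(p,q) is a nilpotent quaternionic matrix, and the space splits orthogonally into
cyclic pieces v, Xv, ..., X^d v with h(X^l v, X^m v) = 0 unless l + m = d. The number q = h(v, X^d v)
is real for even d and purely imaginary for odd d. For real c different from 0 the right-linear map
X^l v |-> X^l v (c^l a) multiplies by c under conjugation of X, and it is an isometry as soon as
c^d conj(a) q a = q. Such a quaternion a exists even for odd d and c < 0: a unit imaginary quaternion
orthogonal to q conjugates q to -q. Hence a nilpotent orbit is stable under all nonzero real scalars.

If Z(beta) is finite, invariance of the Liouville measure under negation makes the integral of
exp(-beta) + exp(beta) finite, so the orbit has finite volume. But scaling by 1/2 multiplies volumes by
2^(-dim/2), which forces the volume to be 0, whereas every chart of the orbit has positive volume.
*)

theory Submission
  imports Defs "HOL-Computational_Algebra.Fundamental_Theorem_Algebra"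
begin

section \<open>Quaternionic vectors and matrices\<close>

text \<open>Nilpotency is given for \<open>ad X\<close> on \<open>sp_alg h\<close>, whereas cyclic
  pieces require a nilpotent matrix. Rank-one elements close the gap: if \<open>X u = u c\<close>
  with \<open>c\<close> a nonzero complex number, then \<open>ad X\<close> multiplies the
  coefficient \<open>a\<close> of \<open>x \<mapsto> u a h(u,x)\<close> by \<open>2 c\<close> for
  all \<open>a\<close> in the span of \<open>j\<close> and \<open>k\<close>, so it is not nilpotent.
  Positivity of volume rests on the Killing form being nondegenerate, which is seen by pairing an
  element with its conjugate transpose in a basis adapted to \<open>h\<close>. Then \<omega> has a
  symplectic basis at the base point, and a chart built from the Cayley transform has positive
  density near it. The measure is a supremum over all charts, and scaling maps charts to charts, so
  its effect is computed on single patches. At the point \<open>c y\<close> the vector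
  \<open>c [A,y]\<close> is \<open>[A, c y]\<close>, with the same \<open>A\<close>; hence \<omega>
  scales by \<open>c\<close> and its top power by \<open>c^(dim/2)\<close>. The obstacle there is
  that the density of an arbitrary chart is not known to be measurable, so the integral identities
  are proved for arbitrary functions.\<close>

instantiation quat :: division_ring
begin

definition "inverse x = qcnj x /\<^sub>R inner x x" for x :: quat
definition "x div y = x * inverse y" for x y :: quat

instance
proof
  fix x :: quat
  assume "x \<noteq> 0"
  then have "inner x x \<noteq> 0"
    by simp
  then show "inverse x * x = 1" "x * inverse x = 1"
    by (simp_all add: inverse_quat_def qcnj_def quat_eq_iff inner_quat_def field_simps)
qed (simp_all add: inverse_quat_def divide_quat_def qcnj_def quat_eq_iff)

end

lemma qcnj_sel [simp]:
  "Qre (qcnj x) = Qre x" "Qi (qcnj x) = - Qi x" "Qj (qcnj x) = - Qj x" "Qk (qcnj x) = - Qk x"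
  by (simp_all add: qcnj_def)

lemma qcnj_simps [simp]:
  "qcnj (x + y) = qcnj x + qcnj y" "qcnj (x - y) = qcnj x - qcnj y" "qcnj (- x) = - qcnj x"
  "qcnj 0 = 0" "qcnj 1 = 1" "qcnj (r *\<^sub>R x) = r *\<^sub>R qcnj x" "qcnj (qcnj x) = x"
  by (simp_all add: quat_eq_iff)

lemma qcnj_mult: "qcnj (x * y) = qcnj y * qcnj x"
  by (simp add: quat_eq_iff)

lemma qcnj_inverse: "qcnj (inverse x) = inverse (qcnj x)"
  by (simp add: inverse_quat_def inner_quat_def)

lemma inner_quat_mult_left: "inner (a * x) y = inner x (qcnj a * y)" for a x y :: quat
  by (simp add: inner_quat_def algebra_simps)

lemma inner_quat_mult_right: "inner (x * a) y = inner x (y * qcnj a)" for a x y :: quat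
  by (simp add: inner_quat_def algebra_simps)

lemma rscale_component [simp]: "rscale x a $ i = x $ i * a"
  by (simp add: rscale_def)

lemma rscale_simps [simp]:
  "rscale x 0 = 0" "rscale 0 a = 0" "rscale x 1 = x"
  "rscale (rscale x a) b = rscale x (a * b)" "rscale (- x) a = - rscale x a"
  "rscale x (- a) = - rscale x a"
  by (simp_all add: vec_eq_iff mult.assoc)

lemma rscale_distribs:
  "rscale (x + y) a = rscale x a + rscale y a" "rscale (x - y) a = rscale x a - rscale y a"
  "rscale x (a + b) = rscale x a + rscale x b" "rscale x (a - b) = rscale x a - rscale x b"
  by (simp_all add: vec_eq_iff algebra_simps)

lemma rscale_scaleR: "rscale (r *\<^sub>R x) a = r *\<^sub>R rscale x a" "rscale x (r *\<^sub>R a) = r *\<^sub>R rscale x a"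
  by (simp_all add: vec_eq_iff)

lemma rscale_of_real: "rscale x (of_real r) = r *\<^sub>R x"
  by (simp add: vec_eq_iff of_real_def)

lemma rscale_eq_0_iff: "rscale x a = 0 \<longleftrightarrow> x = 0 \<or> a = 0"
  by (auto simp: vec_eq_iff)

lemma rscale_sum: "rscale (sum f S) a = (\<Sum>i\<in>S. rscale (f i) a)"
  by (induction S rule: infinite_finite_induct) (auto simp: rscale_distribs)

lemma mat_vec_rscale: "A *v rscale x a = rscale (A *v x) a"
  by (simp add: matrix_vector_mult_def vec_eq_iff sum_distrib_right mult.assoc)

lemma scaleR_mat_vec: "(r *\<^sub>R A) *v x = r *\<^sub>R (A *v (x :: quat ^ 'n))"
  by (simp add: matrix_vector_mult_def vec_eq_iff scaleR_sum_right)

lemma linear_mat_vec: "linear (\<lambda>x. A *v (x :: quat ^ 'n))"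
  by (rule matrix_vector_mul_linear)

lemma vec_eq_sum_rscale_axis: "x = (\<Sum>i\<in>UNIV. rscale (axis i 1) (x $ i))" for x :: "quat ^ 'n"
proof -
  have "(\<Sum>i\<in>UNIV. (axis i 1 :: quat ^ 'n) $ j * x $ i) = x $ j" for j
    by (subst sum.remove[of _ j]) (auto simp: axis_def intro!: sum.neutral)
  then show ?thesis
    by (simp add: vec_eq_iff)
qed

text \<open>Matrices act from the left and scalars from the right, so the two actions commute. This
  is the passage from maps constructed by hand to elements of the matrix group and algebra.\<close>

lemma mat_vec_of_rscale_linear:
  fixes f :: "quat ^ 'n \<Rightarrow> quat ^ 'm"
  assumes add: "\<And>x y. f (x + y) = f x + f y" and sc: "\<And>x a. f (rscale x a) = rscale (f x) a"
  shows "(\<chi> i j. f (axis j 1) $ i) *v x = f x"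
proof -
  have "f 0 = 0"
    using sc[of 0 0] by simp
  then have "f (sum g S) = (\<Sum>i\<in>S. f (g i))" for g :: "'n \<Rightarrow> quat ^ 'n" and S
    by (induction S rule: infinite_finite_induct) (auto simp: add)
  then have "f x = (\<Sum>i\<in>UNIV. rscale (f (axis i 1)) (x $ i))"
    by (subst vec_eq_sum_rscale_axis) (simp add: sc)
  then show ?thesis
    by (simp add: vec_eq_iff matrix_vector_mult_def)
qed

lemma matrix_inv_inverse:
  assumes "invertible A"
  shows "A ** matrix_inv A = mat 1" "matrix_inv A ** A = mat 1"
proof -
  have "A ** matrix_inv A = mat 1 \<and> matrix_inv A ** A = mat 1"
    using assms unfolding invertible_def matrix_inv_def by (rule someI_ex)
  then show "A ** matrix_inv A = mat 1" "matrix_inv A ** A = mat 1"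
    by auto
qed

lemma matrix_inv_eqI:
  assumes "A ** B = mat 1" "B ** A = mat 1"
  shows "matrix_inv A = B"
proof -
  have "invertible A"
    using assms by (auto simp: invertible_def)
  then show ?thesis
    by (metis assms(1) matrix_inv_inverse(2) matrix_mul_assoc matrix_mul_lid matrix_mul_rid)
qed

text \<open>The entries do not commute, so a count of real dimensions replaces the determinant: an
  injective \<open>A\<close> is onto, and its set-theoretic inverse is again right-linear, hence a
  matrix.\<close>

lemma invertible_quat_matrixI:
  fixes A :: "quat ^ 'n ^ 'n"
  assumes inj: "\<And>x. A *v x = 0 \<Longrightarrow> x = 0"
  shows "invertible A"
proof -
  have "inj (\<lambda>x. A *v x)"
    using inj linear_injective_0[OF linear_mat_vec] by blast
  then have "surj (\<lambda>x. A *v x)"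
    using linear_inj_imp_surj[OF linear_mat_vec] by blast
  then obtain g where g: "\<And>x. A *v g x = x"
    by (metis surjD)
  have ginj: "A *v x = A *v y \<Longrightarrow> x = y" for x y
    using inj[of "x - y"] by (simp add: matrix_vector_mult_diff_distrib)
  define B where "B = (\<chi> i j. g (axis j 1) $ i)"
  have B: "B *v x = g x" for x
    unfolding B_def
    by (rule mat_vec_of_rscale_linear; rule ginj) (simp_all add: g mat_vec_rscale matrix_vector_right_distrib)
  have 1: "A ** B = mat 1"
    by (simp add: matrix_eq B g flip: matrix_vector_mul_assoc)
  have "B ** A = mat 1"
    unfolding matrix_eq
  proof
    fix x
    show "B ** A *v x = mat 1 *v x"
      by (rule ginj) (simp add: B g flip: matrix_vector_mul_assoc)
  qed
  with 1 show ?thesis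
    by (auto simp: invertible_def)
qed

section \<open>Hermitian forms and nilpotent elements\<close>

text \<open>The family \<open>e\<close> witnessing the signature is kept as a parameter. It turns
  out to be a basis (\<open>vec_expansion\<close>), and its Gram matrix is diagonal with entries 1
  and -1.\<close>

locale quat_form =
  fixes h :: "quat ^ 'n \<Rightarrow> quat ^ 'n \<Rightarrow> quat" and e :: "'n \<Rightarrow> quat ^ 'n"
  assumes herm: "hermitian_product h"
    and orth: "i \<noteq> j \<Longrightarrow> h (e i) (e j) = 0"
    and unit: "h (e i) (e i) = 1 \<or> h (e i) (e i) = - 1"
begin

lemma h_cnj: "qcnj (h x y) = h y x"
  using herm unfolding hermitian_product_def by metis

lemma h_add: "h x (y + z) = h x y + h x z" "h (x + y) z = h x z + h y z"
proof -
  show *: "h x (y + z) = h x y + h x z" for x y z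
    using herm unfolding hermitian_product_def by metis
  show "h (x + y) z = h x z + h y z"
    using *[of z x y] h_cnj by (metis qcnj_simps(1))
qed

lemma h_rscale: "h x (rscale y a) = h x y * a" "h (rscale x a) y = qcnj a * h x y"
proof -
  show *: "h x (rscale y a) = h x y * a" for x y
    using herm unfolding hermitian_product_def by metis
  show "h (rscale x a) y = qcnj a * h x y"
    using *[of y x] h_cnj by (metis qcnj_mult)
qed

lemma h_scaleR: "h x (r *\<^sub>R y) = r *\<^sub>R h x y" "h (r *\<^sub>R x) y = r *\<^sub>R h x y"
proof -
  show *: "h x (r *\<^sub>R y) = r *\<^sub>R h x y" for x y
    using h_rscale(1)[of x y "of_real r"] by (simp add: rscale_of_real) (simp add: of_real_def)
  show "h (r *\<^sub>R x) y = r *\<^sub>R h x y"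
    using *[of y x] h_cnj by (metis qcnj_simps(6))
qed

lemma h_0 [simp]: "h x 0 = 0" "h 0 x = 0"
  using h_add(1)[of x 0 0] h_add(2)[of 0 0 x] by simp_all

lemma h_minus [simp]: "h x (- y) = - h x y" "h (- x) y = - h x y"
  using h_add(1)[of x y "- y"] h_add(2)[of x "- x" y] by (simp_all add: eq_neg_iff_add_eq_0 add.commute)

lemma h_diff: "h x (y - z) = h x y - h x z" "h (x - y) z = h x z - h y z"
  using h_add[of x y "- z"] h_add(2)[of x "- y" z] by simp_all

lemma h_sum: "h x (sum f S) = (\<Sum>i\<in>S. h x (f i))" "h (sum f S) x = (\<Sum>i\<in>S. h (f i) x)"
  by (induction S rule: infinite_finite_induct; simp add: h_add)+

lemma h_sym_0: "h x y = 0 \<Longrightarrow> h y x = 0"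
  by (metis h_cnj qcnj_simps(4))

definition Pm :: "quat ^ 'n ^ 'n" where "Pm = (\<chi> i j. e j $ i)"

lemma Pm_mult: "Pm *v x = (\<Sum>j\<in>UNIV. rscale (e j) (x $ j))"
  by (simp add: Pm_def matrix_vector_mult_def vec_eq_iff)

lemma h_e_Pm: "h (e i) (Pm *v x) = h (e i) (e i) * x $ i"
proof -
  have "h (e i) (Pm *v x) = (\<Sum>j\<in>UNIV. h (e i) (e j) * x $ j)"
    by (simp add: Pm_mult h_sum h_rscale)
  also have "\<dots> = h (e i) (e i) * x $ i"
    by (subst sum.remove[of _ i]) (auto intro!: sum.neutral simp: orth)
  finally show ?thesis .
qed

lemma unit_nonzero: "h (e i) (e i) \<noteq> 0" "h (e i) (e i) * h (e i) (e i) = 1"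
  using unit[of i] by auto

text \<open>Pairing with \<open>e i\<close> recovers the coordinate \<open>x $ i\<close> up to sign,
  so the columns are independent.\<close>

lemma invertible_Pm: "invertible Pm"
proof (rule invertible_quat_matrixI)
  fix x assume "Pm *v x = 0"
  then have "h (e i) (e i) * x $ i = 0" for i
    by (metis h_e_Pm h_0(1))
  then show "x = 0"
    using unit_nonzero by (simp add: vec_eq_iff)
qed

lemma e_nonzero: "e i \<noteq> 0"
  using unit_nonzero[of i] by auto

lemma vec_expansion: "v = (\<Sum>i\<in>UNIV. rscale (e i) (h (e i) (e i) * h (e i) v))"
proof -
  obtain x where x: "v = Pm *v x"
    by (metis invertible_Pm matrix_inv_inverse(1) matrix_vector_mul_assoc matrix_vector_mul_lid)
  show ?thesis
    unfolding x by (subst Pm_mult) (simp add: h_e_Pm unit_nonzero flip: mult.assoc)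
qed

lemma nondegenerate:
  assumes "\<And>x. h x v = 0"
  shows "v = 0"
  using vec_expansion[of v] by (simp add: assms)

lemma nondegenerate_left:
  assumes "\<And>x. h v x = 0"
  shows "v = 0"
  using assms nondegenerate h_sym_0 by blast

section \<open>Skew operators and generators of cyclic pieces\<close>

lemma sp_algD: "X \<in> sp_alg h \<Longrightarrow> h (X *v x) y = - h x (X *v y)"
  by (simp add: sp_alg_def eq_neg_iff_add_eq_0)

lemma sp_alg_pow: "X \<in> sp_alg h \<Longrightarrow> h (((*v) X ^^ k) x) y = (- 1) ^ k * h x (((*v) X ^^ k) y)"
  by (induction k arbitrary: x y) (auto simp: sp_algD funpow_swap1)

lemma pow_rscale: "((*v) (X :: quat ^ 'n ^ 'n) ^^ k) (rscale x a) = rscale (((*v) X ^^ k) x) a"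
  by (induction k) (auto simp: mat_vec_rscale)

lemma pow_add: "((*v) (X :: quat ^ 'n ^ 'n) ^^ k) (x + y) = ((*v) X ^^ k) x + ((*v) X ^^ k) (y :: quat ^ 'n)"
  by (induction k) (auto simp: matrix_vector_right_distrib)

lemma pow_0: "((*v) (X :: quat ^ 'n ^ 'n) ^^ k) 0 = (0 :: quat ^ 'n)"
  by (induction k) auto

lemma minus_one_power_mult: "(- 1) ^ k * a = a * (- 1) ^ k" for a :: quat
  by (induction k) auto

text \<open>Polarisation. If \<open>h v (X^d v)\<close> vanished for every \<open>v \<in> W\<close>,
  its expansion at \<open>v + w a\<close> would give \<open>q a + (-1)^d qcnj (q a) = 0\<close> for
  every quaternion \<open>a\<close>. As \<open>q\<close> is invertible, \<open>q a\<close> is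
  arbitrary; the value 1 excludes even \<open>d\<close>, the unit \<open>i\<close> excludes odd
  \<open>d\<close>.\<close>

lemma exists_non_isotropic:
  assumes X: "X \<in> sp_alg h" and W: "\<And>x y. x \<in> W \<Longrightarrow> y \<in> W \<Longrightarrow> x + y \<in> W"
      "\<And>x a. x \<in> W \<Longrightarrow> rscale x a \<in> W"
    and vw: "v \<in> W" "w \<in> W" "h v (((*v) X ^^ d) w) \<noteq> 0"
  shows "\<exists>v\<in>W. h v (((*v) X ^^ d) v) \<noteq> 0"
proof (rule ccontr)
  assume "\<not> ?thesis"
  then have iso: "h v (((*v) X ^^ d) v) = 0" if "v \<in> W" for v
    using that by blast
  define q where "q = h v (((*v) X ^^ d) w)"
  have q: "q * a + (- 1) ^ d * qcnj (q * a) = 0" for a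
  proof -
    have "h w (((*v) X ^^ d) v) = (- 1) ^ d * qcnj q"
    proof -
      have "qcnj q = h (((*v) X ^^ d) w) v"
        by (simp add: q_def h_cnj)
      also have "\<dots> = (- 1) ^ d * h w (((*v) X ^^ d) v)"
        by (rule sp_alg_pow[OF X])
      finally show ?thesis
        by (cases "even d") simp_all
    qed
    moreover have "h (v + rscale w a) (((*v) X ^^ d) (v + rscale w a)) = 0"
      by (intro iso W vw)
    ultimately have "q * a + qcnj a * ((- 1) ^ d * qcnj q) = 0"
      using iso[OF vw(1)] iso[OF vw(2)]
      by (simp add: pow_add pow_rscale h_add h_rscale add.commute flip: q_def)
    then show ?thesis
      by (metis minus_one_power_mult mult.assoc qcnj_mult)
  qed
  have "b + (- 1) ^ d * qcnj b = 0" for b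
    using q[of "inverse q * b"] vw(3) by (simp add: q_def flip: mult.assoc)
  from this[of 1] this[of "Quat 0 1 0 0"] show False
    by (cases "even d") (auto simp: quat_eq_iff simp del: one_add_one)
qed

text \<open>Descending induction on \<open>k\<close>: adding \<open>X^(d-k) v c\<close> to
  \<open>v\<close> removes the product with \<open>X^k v\<close> and leaves the products with
  \<open>X^m v\<close>, \<open>m > k\<close>, alone, because every correction to them contains a
  power of \<open>X\<close> above \<open>d\<close>.\<close>

lemma normalise_generator:
  assumes X: "X \<in> sp_alg h" and W: "\<And>x y. x \<in> W \<Longrightarrow> y \<in> W \<Longrightarrow> x + y \<in> W"
      "\<And>x a. x \<in> W \<Longrightarrow> rscale x a \<in> W" "\<And>x. x \<in> W \<Longrightarrow> X *v x \<in> W"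
    and nil: "\<And>x. x \<in> W \<Longrightarrow> ((*v) X ^^ Suc d) x = 0"
    and v0: "v0 \<in> W" "h v0 (((*v) X ^^ d) v0) \<noteq> 0" and k: "k \<le> d"
  shows "\<exists>v\<in>W. h v (((*v) X ^^ d) v) \<noteq> 0 \<and> (\<forall>m. k \<le> m \<longrightarrow> m < d \<longrightarrow> h v (((*v) X ^^ m) v) = 0)"
  using k
proof (induction k rule: inc_induct)
  case base
  then show ?case using v0 by auto
next
  case (step k)
  let ?X = "\<lambda>k. ((*v) X ^^ k)"
  obtain v where v: "v \<in> W" "h v (?X d v) \<noteq> 0"
    and vm: "\<And>m. Suc k \<le> m \<Longrightarrow> m < d \<Longrightarrow> h v (?X m v) = 0"
    using step.IH by blast
  \<comment> \<open>The correction at \<open>X^k\<close> consists of \<open>q c\<close> and an equal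
    conjugate term, whence the factor 1/2.\<close>
  define q b c where "q = h v (?X d v)" and "b = h v (?X k v)"
    and "c = (- 1 / 2) *\<^sub>R (inverse q * b)"
  define v' where "v' = v + rscale (?X (d - k) v) c"
  have XW: "?X m x \<in> W" if "x \<in> W" for x m
    using that by (induction m) (auto intro: W)
  have nil': "?X m x = 0" if "x \<in> W" "d < m" for x m
  proof -
    have "?X m x = ?X (m - Suc d) (?X (Suc d) x)"
      using that(2) by (metis Suc_leI comp_apply funpow_add le_add_diff_inverse2)
    then show ?thesis
      using nil[OF that(1)] by (simp add: pow_0 del: funpow.simps)
  qed
  have cnj: "qcnj (h v (?X m v)) = (- 1) ^ m * h v (?X m v)" for m
    by (simp add: h_cnj sp_alg_pow[OF X])
  have comp: "?X i (?X j x) = ?X (i + j) x" for i j x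
    by (simp add: funpow_add)
  \<comment> \<open>The last term, quadratic in \<open>c\<close>, carries
    \<open>X^(m + 2(d-k))\<close> and vanishes when \<open>k \<le> m\<close> and
    \<open>k < d\<close>.\<close>
  have hv': "h v' (?X m v') = h v (?X m v) + h v (?X (m + (d - k)) v) * c
      + qcnj c * ((- 1) ^ (d - k) * h v (?X (m + (d - k)) v))
      + qcnj c * ((- 1) ^ (d - k) * h v (?X (m + (d - k) + (d - k)) v)) * c" for m
    unfolding v'_def
    by (simp add: pow_add pow_rscale h_add h_rscale sp_alg_pow[OF X] comp distrib_left distrib_right mult.assoc add.assoc)
      (simp add: add.commute add.left_commute)
  have "v' \<in> W"
    unfolding v'_def by (intro W XW v)
  moreover have zero: "h v' (?X m v') = h v (?X m v)" if "k < m" for m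
    using that step.hyps nil'[OF v(1)] by (simp add: hv')
  moreover have "h v' (?X k v') = 0"
  proof -
    have 1: "q * c = (- 1 / 2) *\<^sub>R b"
      using v(2) by (simp add: c_def q_def flip: mult.assoc)
    \<comment> \<open>From \<open>qcnj b = (-1)^k b\<close> and \<open>qcnj q = (-1)^d q\<close>;
      the three signs multiply to \<open>(-1)^(2d) = 1\<close>.\<close>
    have 2: "qcnj c * ((- 1) ^ (d - k) * q) = (- 1 / 2) *\<^sub>R b"
    proof -
      have "qcnj c * ((- 1) ^ (d - k) * q) = (- 1 / 2) *\<^sub>R (qcnj b * inverse (qcnj q) * ((- 1) ^ (d - k) * q))"
        by (simp add: c_def qcnj_mult qcnj_inverse)
      also have "qcnj b = (- 1) ^ k * b"
        by (simp add: b_def cnj)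
      also have "inverse (qcnj q) = inverse q * (- 1) ^ d"
        using v(2) by (auto simp: q_def cnj nonzero_inverse_mult_distrib simp flip: power_inverse)
      also have "(- 1) ^ k * b * (inverse q * (- 1) ^ d) * ((- 1) ^ (d - k) * q) =
          (- 1) ^ k * ((- 1) ^ d * (- 1) ^ (d - k)) * (b * (inverse q * q))"
        by (metis (no_types, lifting) minus_one_power_mult mult.assoc)
      also have "(- 1) ^ k * ((- 1) ^ d * (- 1) ^ (d - k)) = (1 :: quat)"
        using step.hyps by (simp flip: power_add)
      finally show ?thesis
        using v(2) by (simp add: q_def)
    qed
    show ?thesis
      unfolding hv' using step.hyps nil'[OF v(1)] 1 2
      by (simp flip: b_def q_def) (simp add: quat_eq_iff)
  qed
  moreover have "h v' (?X d v') \<noteq> 0"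
    using v(2) zero[OF step.hyps(2)] by simp
  ultimately have "h v' (?X m v') = 0" if "k \<le> m" "m < d" for m
    using step.hyps v(2) vm[of m] that by (cases "k = m"; auto simp: Suc_le_eq)
  then show ?case
    using \<open>v' \<in> W\<close> \<open>h v' (?X d v') \<noteq> 0\<close> by blast
qed

end

lemma exists_conj_factor:
  fixes q :: quat and t :: real
  assumes q: "qcnj q = (- 1) ^ d * q" and t: "even d \<Longrightarrow> 0 < t" "t \<noteq> 0"
  shows "\<exists>a. t *\<^sub>R (qcnj a * q * a) = q"
proof (cases "0 < t")
  case True
  then have "t *\<^sub>R (qcnj (of_real (1 / sqrt t)) * q * of_real (1 / sqrt t)) = q"
    by (simp add: of_real_def)
  then show ?thesis by blast
next
  case False
  with t have "odd d" "t < 0" by auto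
  then have re: "Qre q = 0"
    using q by (simp add: quat_eq_iff)
  have "\<exists>b. qcnj b * q * b = - q"
  \<comment> \<open>An imaginary quaternion orthogonal to \<open>q\<close>: the unit
    \<open>i\<close> if \<open>q\<close> is a real multiple of \<open>k\<close>, and otherwise the
    \<open>i\<close>,\<open>j\<close> part of \<open>q\<close> turned by a right angle, of squared
    length \<open>s\<close>.\<close>
  proof (cases "Qi q = 0 \<and> Qj q = 0")
    case True
    then have "qcnj (Quat 0 1 0 0) * q * Quat 0 1 0 0 = - q"
      using re by (simp add: quat_eq_iff)
    then show ?thesis by blast
  next
    case False
    define s where "s = Qi q ^ 2 + Qj q ^ 2"
    define b where "b = Quat 0 (- Qj q) (Qi q) 0"
    have "s > 0" using False by (auto simp: s_def sum_power2_gt_zero_iff)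
    have "qcnj b * q * b = (- s) *\<^sub>R q"
      using re by (simp add: quat_eq_iff b_def s_def algebra_simps power2_eq_square power3_eq_cube)
    then have "qcnj ((1 / sqrt s) *\<^sub>R b) * q * ((1 / sqrt s) *\<^sub>R b) = - q"
      using \<open>s > 0\<close> by simp
    then show ?thesis by blast
  qed
  then obtain b where b: "qcnj b * q * b = - q" by blast
  have "t *\<^sub>R (qcnj ((1 / sqrt (- t)) *\<^sub>R b) * q * ((1 / sqrt (- t)) *\<^sub>R b)) = q"
    using \<open>t < 0\<close> by (simp add: b)
  then show ?thesis by blast
qed


section \<open>Orthogonal splitting into cyclic pieces and similitudes\<close>

context quat_form
begin

text \<open>Induction on the real dimension of a nondegenerate \<open>X\<close>-stable quaternionic
  subspace: one cyclic piece is split off, and the hypothesis is applied to its orthogonal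
  complement in \<open>W\<close>. The map is right-linear on the whole space but otherwise
  constrained only on \<open>W\<close>, so that the map found for the complement can be composed
  with a projection.\<close>

lemma exists_similitude_on:
  assumes X: "X \<in> sp_alg h" and nil: "\<And>x. ((*v) X ^^ N) x = 0" and c: "c \<noteq> 0"
    and W: "subspace W" "\<And>x a. x \<in> W \<Longrightarrow> rscale x a \<in> W" "\<And>x. x \<in> W \<Longrightarrow> X *v x \<in> W"
      "\<And>w. w \<in> W \<Longrightarrow> (\<And>v. v \<in> W \<Longrightarrow> h v w = 0) \<Longrightarrow> w = 0"
  shows "\<exists>f. (\<forall>x y. f (x + y) = f x + f y) \<and> (\<forall>x a. f (rscale x a) = rscale (f x) a) \<and>
      (\<forall>x\<in>W. f x \<in> W) \<and> (\<forall>x\<in>W. \<forall>y\<in>W. h (f x) (f y) = h x y) \<and>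
      (\<forall>x\<in>W. f (X *v x) = c *\<^sub>R (X *v f x))"
  using W
proof (induction "dim W" arbitrary: W rule: less_induct)
  case less
  note W = less.prems
  let ?X = "\<lambda>k. ((*v) X ^^ k)"
  show ?case
  proof (cases "W = {0}")
    case True
    then show ?thesis by (intro exI[of _ id]) auto
  next
    case False
    then obtain w0 where w0: "w0 \<in> W" "w0 \<noteq> 0"
      using subspace_0[OF W(1)] by blast
    \<comment> \<open>\<open>d\<close> is the largest exponent for which \<open>X^d\<close> is not
      zero on \<open>W\<close>.\<close>
    have "\<exists>d. (\<exists>w\<in>W. ?X d w \<noteq> 0) \<and> (\<forall>k. (\<exists>w\<in>W. ?X k w \<noteq> 0) \<longrightarrow> k \<le> d)"
    proof (rule Nat.ex_has_greatest_nat)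
      show "\<exists>w\<in>W. ?X 0 w \<noteq> 0" using w0 by auto
      show "\<forall>k. (\<exists>w\<in>W. ?X k w \<noteq> 0) \<longrightarrow> k \<le> N"
      proof (intro allI impI, rule ccontr)
        fix k assume k: "\<exists>w\<in>W. ?X k w \<noteq> 0" "\<not> k \<le> N"
        then have "?X k w = ?X (k - N) (?X N w)" for w
          by (metis comp_apply funpow_add le_add_diff_inverse2 nle_le)
        with k(1) show False by (simp add: nil pow_0)
      qed
    qed
    then obtain d w where w: "w \<in> W" "?X d w \<noteq> 0"
      and nild: "\<And>k x. x \<in> W \<Longrightarrow> d < k \<Longrightarrow> ?X k x = 0"
      by (metis not_le)
    have XW: "?X m x \<in> W" if "x \<in> W" for x m
      using that by (induction m) (auto intro: W)
    have Wadd: "x + y \<in> W" if "x \<in> W" "y \<in> W" for x y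
      using that W(1) by (rule_tac subspace_add)
    obtain v1 where "v1 \<in> W" "h v1 (?X d w) \<noteq> 0"
      using W(4)[OF XW[OF w(1)]] w(2) by blast
    then obtain v0 where "v0 \<in> W" "h v0 (?X d v0) \<noteq> 0"
      using exists_non_isotropic[OF X Wadd W(2)] w(1) by blast
    have "\<exists>v\<in>W. h v (?X d v) \<noteq> 0 \<and> (\<forall>m. 0 \<le> m \<longrightarrow> m < d \<longrightarrow> h v (?X m v) = 0)"
      by (rule normalise_generator[OF X Wadd W(2,3) nild]; fact?) auto
    then obtain v where v: "v \<in> W" "h v (?X d v) \<noteq> 0" and vm: "\<And>m. m < d \<Longrightarrow> h v (?X m v) = 0"
      by auto
    define q where "q = h v (?X d v)"
    define u where "u l = ?X l v" for l
    have q: "q \<noteq> 0" "qcnj q = (- 1) ^ d * q"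
      using v(2) by (simp_all add: q_def h_cnj sp_alg_pow[OF X])
    have uW: "u l \<in> W" for l
      unfolding u_def by (rule XW[OF v(1)])
    have Xu: "X *v u l = u (Suc l)" for l
      by (simp add: u_def)
    have u0: "u l = 0" if "d < l" for l
      unfolding u_def using nild[OF v(1) that] .
    \<comment> \<open>The Gram matrix of the chain \<open>u 0, ..., u d\<close> is antidiagonal, so
      up to order and factors the chain is its own dual basis.\<close>
    have huu: "h (u l) (u m) = (if l + m = d then (- 1) ^ l * q else 0)" for l m
    proof -
      have "h (u l) (u m) = (- 1) ^ l * h v (?X (l + m) v)"
        by (simp add: u_def sp_alg_pow[OF X] funpow_add)
      then show ?thesis
        using vm nild[OF v(1), of "l + m"] by (cases "l + m" d rule: linorder_cases) (auto simp: q_def)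
    qed
    \<comment> \<open>Coordinate along \<open>u l\<close>: the dual vector is
      \<open>u (d - l)\<close>, and the pairing is divided by
      \<open>h (u (d - l)) (u l) = (-1)^(d-l) q\<close>.\<close>
    define coef where "coef l x = inverse ((- 1) ^ (d - l) * q) * h (u (d - l)) x" for l x
    have sgnq: "(- 1) ^ k * q \<noteq> 0" for k
      using q(1) by simp
    have coef_add: "coef l (x + y) = coef l x + coef l y" for l x y
      by (simp add: coef_def h_add distrib_left)
    have coef_sc: "coef l (rscale x a) = coef l x * a" for l x a
      by (simp add: coef_def h_rscale mult.assoc)
    have coef_X: "coef (Suc l) (X *v x) = coef l x" if "l < d" for l x
    proof -
      have "h (u (d - Suc l)) (X *v x) = - h (u (d - l)) x"
        using sp_algD[OF X, of "u (d - Suc l)" x] Suc_diff_Suc[OF that] Xu by (metis minus_minus)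
      moreover have "(- 1) ^ (d - l) * q = - ((- 1) ^ (d - Suc l) * q)"
        using Suc_diff_Suc[OF that] by (metis mult_minus_left power_Suc mult_1_left)
      ultimately show ?thesis
        by (simp add: coef_def)
    qed
    have coef_X0: "coef 0 (X *v x) = 0" for x
      using sp_algD[OF X, of "u d" x] by (simp add: coef_def Xu u0)
    define F where "F b a x = (\<Sum>l\<le>d. rscale (u l) (b ^ l *\<^sub>R (a * coef l x)))" for b :: real and a x
    have F_add: "F b a (x + y) = F b a x + F b a y" for b a x y
      by (simp add: F_def coef_add distrib_left scaleR_add_right rscale_distribs sum.distrib)
    have F_sc: "F b a (rscale x z) = rscale (F b a x) z" for b a x z
      by (simp add: F_def coef_sc rscale_sum flip: mult.assoc)
    have F_W: "F b a x \<in> W" for b a x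
      unfolding F_def by (intro subspace_sum W uW)
    have F_X: "F b a (X *v x) = b *\<^sub>R (X *v F b a x)" for b a x
    proof -
      have "F b a (X *v x) = (\<Sum>l<d. rscale (u (Suc l)) (b ^ Suc l *\<^sub>R (a * coef (Suc l) (X *v x))))"
        unfolding F_def by (subst sum.atMost_shift) (simp add: coef_X0)
      also have "\<dots> = (\<Sum>l<d. rscale (u (Suc l)) (b ^ Suc l *\<^sub>R (a * coef l x)))"
        by (rule sum.cong) (auto simp: coef_X)
      also have "\<dots> = (\<Sum>l\<le>d. rscale (u (Suc l)) (b ^ Suc l *\<^sub>R (a * coef l x)))"
        by (simp add: u0 flip: lessThan_Suc_atMost)
      also have "\<dots> = b *\<^sub>R (X *v F b a x)"
        by (simp add: F_def linear_sum[OF linear_mat_vec] linear_scale[OF linear_mat_vec] mat_vec_rscale Xu rscale_scaleR scaleR_sum_right)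
      finally show ?thesis .
    qed
    have h_uF: "h (u l) (F b a x) = (- 1) ^ l * (q * (b ^ (d - l) *\<^sub>R (a * coef (d - l) x)))"
      if "l \<le> d" for l b a x
    proof -
      have "h (u l) (F b a x) = (\<Sum>m\<le>d. if m = d - l then (- 1) ^ l * (q * (b ^ m *\<^sub>R (a * coef m x))) else 0)"
        unfolding F_def h_sum by (rule sum.cong) (use that in \<open>auto simp: h_rscale huu mult.assoc\<close>)
      then show ?thesis by simp
    qed
    \<comment> \<open>The parameters enter only through \<open>b^d (qcnj a q a)\<close>. Whenever
      this is \<open>q\<close>, the products agree with those of the projection
      \<open>F 1 1\<close>.\<close>
    have h_FF: "h (F b a x) (F b a y) = (\<Sum>l\<le>d. qcnj (coef l x) * ((- 1) ^ l * (q * coef (d - l) y)))"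
      if "b ^ d *\<^sub>R (qcnj a * q * a) = q" for b a x y
    proof -
      have "h (F b a x) (F b a y) = (\<Sum>l\<le>d. qcnj (b ^ l *\<^sub>R (a * coef l x)) * h (u l) (F b a y))"
        by (subst (1) F_def) (simp add: h_sum h_rscale)
      also have "\<dots> = (\<Sum>l\<le>d. qcnj (coef l x) * ((- 1) ^ l * (q * coef (d - l) y)))"
      proof (rule sum.cong)
        fix l assume "l \<in> {..d}"
        then have l: "l \<le> d" by simp
        have "qcnj (b ^ l *\<^sub>R (a * coef l x)) * h (u l) (F b a y) =
            (b ^ l * b ^ (d - l)) *\<^sub>R (qcnj (coef l x) * (qcnj a * (- 1) ^ l) * (q * (a * coef (d - l) y)))"
          by (simp add: h_uF[OF l] qcnj_mult mult.assoc)
        also have "qcnj a * (- 1) ^ l = (- 1) ^ l * qcnj a"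
          by (simp add: minus_one_power_mult)
        also have "b ^ l * b ^ (d - l) = b ^ d"
          using l by (simp flip: power_add)
        also have "b ^ d *\<^sub>R (qcnj (coef l x) * ((- 1) ^ l * qcnj a) * (q * (a * coef (d - l) y))) =
            qcnj (coef l x) * ((- 1) ^ l * ((b ^ d *\<^sub>R (qcnj a * q * a)) * coef (d - l) y))"
          by (simp add: mult.assoc)
        finally show "qcnj (b ^ l *\<^sub>R (a * coef l x)) * h (u l) (F b a y) =
            qcnj (coef l x) * ((- 1) ^ l * (q * coef (d - l) y))"
          using that by simp
      qed simp
      finally show ?thesis .
    qed
    define \<pi> where "\<pi> = F 1 1"
    define W' where "W' = {x \<in> W. \<forall>l\<le>d. h (u l) x = 0}"
    have W'D: "x \<in> W" "\<And>l. h (u l) x = 0" if "x \<in> W'" for x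
      using that by (auto simp: W'_def) (metis h_0(2) not_le u0)
    have uW': "h (F b a x) y = 0" "h y (F b a x) = 0" if "y \<in> W'" for b a x y
      using W'D[OF that] by (auto simp: F_def h_sum h_rscale h_sym_0)
    have res: "x - \<pi> x \<in> W'" if "x \<in> W" for x
    proof -
      have "h (u l) (x - \<pi> x) = 0" if "l \<le> d" for l
      proof -
        have "h (u l) (\<pi> x) = (- 1) ^ l * q * coef (d - l) x"
          unfolding \<pi>_def by (subst h_uF[OF that]) (simp add: mult.assoc)
        also have "\<dots> = h (u l) x"
          using that sgnq[of l] by (simp add: coef_def del: inverse_mult_distrib flip: mult.assoc)
        finally show ?thesis by (simp add: h_diff)
      qed
      then show ?thesis
        using that by (simp add: W'_def subspace_diff W(1) \<pi>_def F_W)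
    qed
    have W'sub: "subspace W'"
      using W(1) by (auto simp: subspace_def W'_def h_add h_scaleR)
    \<comment> \<open>The generator \<open>v\<close> pairs with \<open>u d\<close> to
      \<open>(-1)^d q\<close>, so it lies outside the complement and the dimension drops.\<close>
    have "W' \<subset> W"
    proof -
      have "h (u d) v \<noteq> 0"
        using huu[of d 0] sgnq by (simp add: u_def)
      then show ?thesis using v(1) by (auto simp: W'_def)
    qed
    then have dim: "dim W' < dim W"
      using dim_psubset[of W' W] span_eq_iff W(1) W'sub by metis
    have "\<exists>f. (\<forall>x y. f (x + y) = f x + f y) \<and> (\<forall>x a. f (rscale x a) = rscale (f x) a) \<and>
      (\<forall>x\<in>W'. f x \<in> W') \<and> (\<forall>x\<in>W'. \<forall>y\<in>W'. h (f x) (f y) = h x y) \<and>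
      (\<forall>x\<in>W'. f (X *v x) = c *\<^sub>R (X *v f x))"
    proof (rule less.hyps[OF dim W'sub])
      show "rscale x a \<in> W'" if "x \<in> W'" for x a
        using that W(2) by (auto simp: W'_def h_rscale)
      show "X *v x \<in> W'" if "x \<in> W'" for x
      proof -
        have "h (u l) (X *v x) = 0" for l
          using sp_algD[OF X, of "u l" x] W'D[OF that] by (simp add: Xu)
        then show ?thesis
          using that W(3) by (simp add: W'_def)
      qed
      \<comment> \<open>Nondegeneracy passes to the complement: any \<open>y\<close> in
        \<open>W\<close> is \<open>\<pi> y\<close> plus an element of \<open>W'\<close>, and
        \<open>w\<close> is orthogonal to both.\<close>
      show "w = 0" if "w \<in> W'" "\<And>v. v \<in> W' \<Longrightarrow> h v w = 0" for w
      proof (rule W(4))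
        show "w \<in> W" using that(1) by (rule W'D)
        show "h y w = 0" if "y \<in> W" for y
        proof -
          have "h y w = h (\<pi> y) w + h (y - \<pi> y) w"
            by (simp add: h_diff)
          then show ?thesis
            using uW'(1)[OF \<open>w \<in> W'\<close>] \<open>\<And>v. v \<in> W' \<Longrightarrow> h v w = 0\<close>[OF res[OF that]] by (simp add: \<pi>_def)
        qed
      qed
    qed
    then obtain f' where f': "\<And>x y. f' (x + y) = f' x + f' y" "\<And>x a. f' (rscale x a) = rscale (f' x) a"
      "\<And>x. x \<in> W' \<Longrightarrow> f' x \<in> W'" "\<And>x y. x \<in> W' \<Longrightarrow> y \<in> W' \<Longrightarrow> h (f' x) (f' y) = h x y"
      "\<And>x. x \<in> W' \<Longrightarrow> f' (X *v x) = c *\<^sub>R (X *v f' x)"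
      by blast
    have "even d \<Longrightarrow> 0 < c ^ d" "c ^ d \<noteq> 0"
      using c by (auto simp: zero_less_power_eq)
    then obtain a where a: "c ^ d *\<^sub>R (qcnj a * q * a) = q"
      using exists_conj_factor[OF q(2)] by blast
    have \<pi>_add: "\<pi> (x + y) = \<pi> x + \<pi> y" for x y
      by (simp add: \<pi>_def F_add)
    define f where "f x = F c a x + f' (x - \<pi> x)" for x
    have "f (x + y) = f x + f y" for x y
    proof -
      have "x + y - \<pi> (x + y) = (x - \<pi> x) + (y - \<pi> y)"
        by (simp add: \<pi>_add)
      then show ?thesis
        by (simp only: f_def F_add f'(1)) (simp add: algebra_simps)
    qed
    moreover have "f (rscale x z) = rscale (f x) z" for x z
    proof -
      have "rscale x z - \<pi> (rscale x z) = rscale (x - \<pi> x) z"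
        by (simp add: \<pi>_def F_sc rscale_distribs)
      then show ?thesis
        by (simp only: f_def F_sc f'(2) rscale_distribs(1))
    qed
    moreover have "f x \<in> W" if "x \<in> W" for x
      unfolding f_def using f'(3)[OF res[OF that]] by (intro Wadd F_W) (rule W'D)
    moreover have "h (f x) (f y) = h x y" if x: "x \<in> W" and y: "y \<in> W" for x y
    proof -
      have "h (f x) (f y) = h (F c a x) (F c a y) + h (x - \<pi> x) (y - \<pi> y)"
        using f'(3)[OF res[OF x]] f'(3)[OF res[OF y]] f'(4)[OF res[OF x] res[OF y]]
        by (simp add: f_def h_add uW')
      also have "h (F c a x) (F c a y) = h (\<pi> x) (\<pi> y)"
        unfolding \<pi>_def by (simp only: h_FF[OF a]) (rule h_FF[symmetric], simp)
      also have "h (\<pi> x) (\<pi> y) + h (x - \<pi> x) (y - \<pi> y) =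
          h (\<pi> x + (x - \<pi> x)) (\<pi> y + (y - \<pi> y))"
        using uW'(1)[OF res[OF y]] uW'(2)[OF res[OF x]]
        unfolding h_add by (simp add: \<pi>_def)
      finally show ?thesis by simp
    qed
    moreover have "f (X *v x) = c *\<^sub>R (X *v f x)" if "x \<in> W" for x
    proof -
      have "X *v x - \<pi> (X *v x) = X *v (x - \<pi> x)"
        unfolding \<pi>_def F_X by (simp add: matrix_vector_mult_diff_distrib)
      then show ?thesis
        by (simp add: f_def F_X f'(5)[OF res[OF that]] matrix_vector_right_distrib scaleR_add_right)
    qed
    ultimately show ?thesis by blast
  qed
qed


text \<open>A vector killed by an isometry is orthogonal to everything, hence 0 by nondegeneracy;
  this yields the invertibility.\<close>

lemma Sp_groupI:
  assumes "\<And>x y. h (g *v x) (g *v y) = h x y"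
  shows "g \<in> Sp_group h"
proof -
  have "invertible g"
    by (rule invertible_quat_matrixI) (metis assms h_0(1) nondegenerate)
  then show ?thesis
    using assms by (simp add: Sp_group_def)
qed

lemma exists_similitude:
  assumes X: "X \<in> sp_alg h" and nil: "\<And>x. ((*v) X ^^ N) x = 0" and c: "c \<noteq> 0"
  shows "\<exists>g\<in>Sp_group h. g ** X = c *\<^sub>R (X ** g)"
proof -
  have "w = 0" if "\<And>v. v \<in> UNIV \<Longrightarrow> h v w = 0" for w
    using that nondegenerate by blast
  then obtain f where f: "\<And>x y. f (x + y) = f x + f y" "\<And>x a. f (rscale x a) = rscale (f x) a"
    "\<And>x y. h (f x) (f y) = h x y" "\<And>x. f (X *v x) = c *\<^sub>R (X *v f x)"
    using exists_similitude_on[OF X nil c subspace_UNIV] by auto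
  define g where "g = (\<chi> i j. f (axis j 1) $ i)"
  have g: "g *v x = f x" for x
    unfolding g_def by (rule mat_vec_of_rscale_linear[OF f(1,2)])
  have "g \<in> Sp_group h"
    by (rule Sp_groupI) (simp add: g f)
  moreover have "g ** X = c *\<^sub>R (X ** g)"
    unfolding matrix_eq
    by (simp add: g f scaleR_mat_vec flip: matrix_vector_mul_assoc)
  ultimately show ?thesis by blast
qed


section \<open>Rank-one elements and right eigenvalues\<close>

definition rank1 :: "quat ^ 'n \<Rightarrow> quat \<Rightarrow> quat ^ 'n ^ 'n" where
  "rank1 u a = (\<chi> i j. rscale u (a * h u (axis j 1)) $ i)"

lemma rank1_vec: "rank1 u a *v x = rscale u (a * h u x)"
  unfolding rank1_def
  by (rule mat_vec_of_rscale_linear) (simp_all add: h_add h_rscale distrib_left rscale_distribs mult.assoc)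

text \<open>These operators \<open>x \<mapsto> u a h(u,x)\<close> are the test elements for two
  purposes: excluding nonzero eigenvalues of ad-nilpotent elements, and showing that the centre is
  trivial.\<close>

lemma rank1_in_sp_alg:
  assumes "qcnj a = - a"
  shows "rank1 u a \<in> sp_alg h"
proof -
  have "qcnj (a * h u x) * h u y + h x u * (a * h u y) = 0" for x y
    using assms by (simp add: qcnj_mult h_cnj mult.assoc)
  then show ?thesis
    by (simp add: sp_alg_def rank1_vec h_rscale)
qed

lemma rank1_eq_0:
  assumes "rank1 u a = 0" "u \<noteq> 0"
  shows "a = 0"
proof -
  obtain y where "h u y \<noteq> 0"
    using assms(2) nondegenerate_left by blast
  moreover have "rscale u (a * h u y) = 0"
    by (simp add: assms(1) flip: rank1_vec)
  ultimately show ?thesis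
    using assms(2) by (simp add: rscale_eq_0_iff)
qed

text \<open>For an eigenvector \<open>u\<close> one has \<open>h u (X x) = - qcnj c h u x\<close>,
  so \<open>ad X\<close> preserves these operators and acts on the coefficient alone.\<close>

lemma lie_rank1:
  assumes X: "X \<in> sp_alg h" and u: "X *v u = rscale u c"
  shows "lie X (rank1 u a) = rank1 u (c * a + a * qcnj c)"
proof -
  have "h u (X *v x) = - (qcnj c * h u x)" for x
    using sp_algD[OF X, of u x] by (simp add: u h_rscale)
  then show ?thesis
    unfolding matrix_eq lie_def
    by (simp add: matrix_vector_mult_diff_rdistrib rank1_vec mat_vec_rscale u distrib_right
        mult.assoc rscale_distribs flip: matrix_vector_mul_assoc)
qed

text \<open>On the span of \<open>j\<close> and \<open>k\<close>, left multiplication by a complex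
  \<open>c\<close> equals right multiplication by \<open>qcnj c\<close>. There \<open>ad X\<close>
  multiplies the coefficient by \<open>2 c\<close> and never kills it if
  \<open>c \<noteq> 0\<close>. Starting from \<open>j\<close> matters: the coefficient
  \<open>i\<close> is annihilated when \<open>c\<close> is purely imaginary.\<close>

lemma ad_nilpotent_eigenvalue:
  assumes X: "nilpotent_elt (sp_alg h) X" and u: "X *v u = rscale u c" "u \<noteq> 0"
    and c: "Qj c = 0" "Qk c = 0"
  shows "c = 0"
proof (rule ccontr)
  assume "c \<noteq> 0"
  have Xsp: "X \<in> sp_alg h"
    using X by (simp add: nilpotent_elt_def)
  have "\<exists>a. a \<noteq> 0 \<and> Qre a = 0 \<and> Qi a = 0 \<and> (lie X ^^ k) (rank1 u (Quat 0 0 1 0)) = rank1 u a" for k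
  proof (induction k)
    case 0
    show ?case by (intro exI[of _ "Quat 0 0 1 0"]) (simp add: quat_eq_iff)
  next
    case (Suc k)
    then obtain a where a: "a \<noteq> 0" "Qre a = 0" "Qi a = 0"
      "(lie X ^^ k) (rank1 u (Quat 0 0 1 0)) = rank1 u a"
      by blast
    have "c * a + a * qcnj c = 2 *\<^sub>R (c * a)"
      using a c by (simp add: quat_eq_iff)
    then show ?case
      using a c \<open>c \<noteq> 0\<close>
      by (intro exI[of _ "c * a + a * qcnj c"]) (auto simp: lie_rank1[OF Xsp u(1)])
  qed
  moreover obtain k where "\<forall>Y\<in>sp_alg h. (lie X ^^ k) Y = 0"
    using X by (auto simp: nilpotent_elt_def)
  moreover have "rank1 u (Quat 0 0 1 0) \<in> sp_alg h"
    by (rule rank1_in_sp_alg) (simp add: quat_eq_iff)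
  ultimately show False
    using rank1_eq_0[OF _ u(2)] by metis
qed

end

section \<open>Complex polynomials in a quaternionic matrix\<close>

definition quat_of_complex :: "complex \<Rightarrow> quat" where
  "quat_of_complex z = Quat (Re z) (Im z) 0 0"

lemma quat_of_complex_simps [simp]:
  "quat_of_complex (x + y) = quat_of_complex x + quat_of_complex y"
  "quat_of_complex (x - y) = quat_of_complex x - quat_of_complex y"
  "quat_of_complex (- x) = - quat_of_complex x"
  "quat_of_complex (x * y) = quat_of_complex x * quat_of_complex y"
  "quat_of_complex 0 = 0" "quat_of_complex 1 = 1" "quat_of_complex (of_real r) = of_real r"
  "Qj (quat_of_complex x) = 0" "Qk (quat_of_complex x) = 0"
  by (simp_all add: quat_of_complex_def quat_eq_iff of_real_def)

lemma quat_of_complex_eq_0_iff [simp]: "quat_of_complex x = 0 \<longleftrightarrow> x = 0"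
  by (auto simp: quat_of_complex_def quat_eq_iff complex_eq_iff)

lemma quat_of_complex_commute: "quat_of_complex x * quat_of_complex y = quat_of_complex y * quat_of_complex x"
  by (metis mult.commute quat_of_complex_simps(4))

text \<open>The complex polynomial \<open>p\<close> in \<open>X\<close>, the complex numbers acting from the right.\<close>

definition poly_act :: "quat ^ 'n ^ 'n \<Rightarrow> complex poly \<Rightarrow> quat ^ 'n \<Rightarrow> quat ^ 'n" where
  "poly_act X p v = (\<Sum>i\<le>degree p. rscale (((*v) X ^^ i) v) (quat_of_complex (coeff p i)))"

lemma poly_act_ge:
  assumes "degree p \<le> n"
  shows "poly_act X p v = (\<Sum>i\<le>n. rscale (((*v) X ^^ i) v) (quat_of_complex (coeff p i)))"
  unfolding poly_act_def
  by (rule sum.mono_neutral_left) (use assms in \<open>auto simp: coeff_eq_0\<close>)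

lemma poly_act_commute: "poly_act X p (X *v v) = X *v poly_act X p v"
  by (simp add: poly_act_def linear_sum[OF linear_mat_vec] mat_vec_rscale flip: funpow_swap1)

text \<open>Right multiplication by a complex number commutes with \<open>X\<close> and with the
  other complex scalars, so factors can be split off although quaternions do not commute.\<close>

lemma poly_act_linear_factor:
  "poly_act X ([:- r, 1:] * p) v = X *v poly_act X p v - rscale (poly_act X p v) (quat_of_complex r)"
proof -
  let ?q = "quat_of_complex"
  let ?X = "\<lambda>i. ((*v) X ^^ i) v"
  have "degree ([:- r, 1:] * p) \<le> Suc (degree p)"
    using degree_mult_le[of "[:- r, 1:]" p] by simp
  then have "poly_act X ([:- r, 1:] * p) v =
      (\<Sum>i\<le>Suc (degree p). rscale (?X i) (?q (coeff (pCons 0 p) i))) -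
      (\<Sum>i\<le>Suc (degree p). rscale (?X i) (?q (r * coeff p i)))"
    by (subst poly_act_ge) (simp_all add: rscale_distribs sum_subtractf del: sum.atMost_Suc)
  also have "(\<Sum>i\<le>Suc (degree p). rscale (?X i) (?q (coeff (pCons 0 p) i))) = X *v poly_act X p v"
    unfolding poly_act_def
    by (subst sum.atMost_Suc_shift) (simp add: linear_sum[OF linear_mat_vec] mat_vec_rscale)
  also have "(\<Sum>i\<le>Suc (degree p). rscale (?X i) (?q (r * coeff p i))) = rscale (poly_act X p v) (?q r)"
    by (simp add: coeff_eq_0 poly_act_def rscale_sum quat_of_complex_commute)
  finally show ?thesis .
qed

text \<open>In real dimension \<open>D\<close>, the \<open>D + 1\<close> vectors
  \<open>v, X v, ..., X^D v\<close> satisfy a real linear relation.\<close>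

lemma exists_annihilating_poly:
  fixes X :: "quat ^ 'n ^ 'n"
  shows "\<exists>p. p \<noteq> 0 \<and> poly_act X p v = 0"
proof -
  let ?X = "\<lambda>i. ((*v) X ^^ i) v"
  let ?D = "DIM(quat ^ 'n)"
  have "\<exists>a :: nat \<Rightarrow> real. (\<exists>i\<le>?D. a i \<noteq> 0) \<and> (\<Sum>i\<le>?D. a i *\<^sub>R ?X i) = 0"
  \<comment> \<open>A repetition among the powers is treated apart, since \<open>dependent\<close>
    speaks of the set of vectors and forgets multiplicity; it gives the relation
    \<open>X^i v - X^j v = 0\<close>.\<close>
  proof (cases "inj_on ?X {..?D}")
    case True
    then have "dependent (?X ` {..?D})"
      by (intro dependent_biggerset) (auto simp: card_image)
    then obtain u where u: "\<exists>w\<in>?X ` {..?D}. u w \<noteq> 0" "(\<Sum>w\<in>?X ` {..?D}. u w *\<^sub>R w) = 0"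
      by (subst (asm) real_vector.dependent_finite) auto
    have "(\<Sum>i\<le>?D. u (?X i) *\<^sub>R ?X i) = 0"
      using u(2) by (simp only: sum.reindex[OF True] comp_def)
    then show ?thesis
      using u(1) by (intro exI[of _ "\<lambda>i. u (?X i)"]) auto
  next
    case False
    then obtain i j where ij: "i \<le> ?D" "j \<le> ?D" "i \<noteq> j" "?X i = ?X j"
      by (auto simp: inj_on_def)
    define a :: "nat \<Rightarrow> real" where "a l = of_bool (l = i) - of_bool (l = j)" for l
    have "(\<Sum>l\<le>?D. a l *\<^sub>R ?X l) = 0"
    proof -
      have "(\<Sum>l\<le>?D. a l *\<^sub>R ?X l) = (\<Sum>l\<le>?D. (if l = i then ?X i else 0) - (if l = j then ?X j else 0))"
        by (rule sum.cong) (auto simp: a_def)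
      also have "\<dots> = ?X i - ?X j"
        using ij(1,2) by (simp only: sum_subtractf sum.delta finite_atMost) simp
      finally show ?thesis
        using ij(4) by simp
    qed
    moreover have "a i \<noteq> 0"
      using ij by (simp add: a_def)
    ultimately show ?thesis
      using ij(1) by (intro exI[of _ a] conjI exI[of _ i])
  qed
  then obtain a where a: "\<exists>i\<le>?D. a i \<noteq> 0" "(\<Sum>i\<le>?D. a i *\<^sub>R ?X i) = 0"
    by blast
  define p :: "complex poly" where "p = (\<Sum>i\<le>?D. monom (of_real (a i)) i)"
  have coeff: "coeff p i = (if i \<le> ?D then of_real (a i) else 0)" for i
    by (simp add: p_def coeff_sum)
  have "degree p \<le> ?D"
    by (rule degree_le) (simp add: coeff)
  then have "poly_act X p v = 0"
    using a(2) by (simp add: poly_act_ge coeff rscale_of_real)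
  moreover have "p \<noteq> 0"
    using a(1) coeff by (metis coeff_0 of_real_eq_0_iff)
  ultimately show ?thesis by blast
qed

section \<open>From ad-nilpotent elements to nilpotent matrices\<close>

context quat_form
begin

text \<open>Roots of an annihilating polynomial are removed one at a time. For
  \<open>p = (x - r) p'\<close> the vector \<open>p'(X) v\<close> satisfies the eigenvector equation
  for \<open>r\<close>. If \<open>r \<noteq> 0\<close> it must vanish, so \<open>p'\<close>
  annihilates \<open>v\<close>; if \<open>r = 0\<close>, then \<open>p'\<close> annihilates
  \<open>X v\<close>, at the cost of one power of \<open>X\<close>.\<close>

lemma locally_nilpotent:
  assumes X: "nilpotent_elt (sp_alg h) X" and p: "p \<noteq> 0" "poly_act X p v = 0"
  shows "\<exists>k. ((*v) X ^^ k) v = 0"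
  using p
proof (induction "degree p" arbitrary: p v)
  case 0
  then obtain c where "p = [:c:]" "c \<noteq> 0"
    by (metis degree_eq_zeroE pCons_0_0)
  then show ?case
    using 0 by (intro exI[of _ 0]) (simp add: poly_act_def rscale_eq_0_iff)
next
  case (Suc n)
  then obtain r where "poly p r = 0"
    using fundamental_theorem_of_algebra constant_degree by (metis nat.distinct(1))
  then obtain p' where p': "p = [:- r, 1:] * p'"
    by (metis dvdE poly_eq_0_iff_dvd)
  have p'0: "p' \<noteq> 0"
    using Suc.prems p' by auto
  then have "degree p = Suc (degree p')"
    unfolding p' by (subst degree_mult_eq) auto
  then have deg: "n = degree p'"
    using Suc.hyps(2) by simp
  have ev: "X *v poly_act X p' v = rscale (poly_act X p' v) (quat_of_complex r)"
    using Suc.prems(2) unfolding p' poly_act_linear_factor by simp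
  show ?case
  proof (cases "r = 0")
    case True
    then have "poly_act X p' (X *v v) = 0"
      using ev by (simp add: poly_act_commute)
    then obtain k where "((*v) X ^^ k) (X *v v) = 0"
      using Suc.hyps(1)[OF deg p'0] by blast
    then show ?thesis
      by (intro exI[of _ "Suc k"]) (simp add: funpow_swap1)
  next
    case False
    then have "poly_act X p' v = 0"
      using ad_nilpotent_eigenvalue[OF X ev] by auto
    then show ?thesis
      using Suc.hyps(1)[OF deg p'0] by blast
  qed
qed

text \<open>The annihilating exponent depends on the vector; the sum of the exponents over a real
  basis serves all vectors.\<close>

lemma ad_nilpotent_imp_nilpotent:
  assumes X: "nilpotent_elt (sp_alg h) X"
  obtains N where "\<And>x. ((*v) X ^^ N) x = 0"
proof -
  obtain k where k: "\<And>v. ((*v) X ^^ k v) v = 0"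
  proof -
    have "\<forall>v. \<exists>k. ((*v) X ^^ k) v = 0"
      using locally_nilpotent[OF X] exists_annihilating_poly[of X] by blast
    then show thesis
      using that by (auto dest!: choice)
  qed
  define N where "N = (\<Sum>b\<in>Basis. k b)"
  have "((*v) X ^^ N) b = 0" if "b \<in> Basis" for b :: "quat ^ 'n"
  proof -
    have "k b \<le> N"
      unfolding N_def using that by (intro member_le_sum) auto
    then have "((*v) X ^^ N) b = ((*v) X ^^ (N - k b)) (((*v) X ^^ k b) b)"
      by (metis comp_apply funpow_add le_add_diff_inverse2)
    then show ?thesis by (simp add: k pow_0)
  qed
  moreover have "linear ((*v) X ^^ N)"
    by (rule linearI) (simp add: pow_add, metis pow_rscale rscale_of_real)
  ultimately have "((*v) X ^^ N) = (\<lambda>x. 0)"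
    by (intro linear_eq_stdbasis) (auto intro: module_hom_zero)
  then show thesis
    using that by metis
qed

section \<open>The isometry group and scalar multiples in a nilpotent orbit\<close>

lemma Sp_group_mult:
  assumes "g \<in> Sp_group h" "k \<in> Sp_group h"
  shows "g ** k \<in> Sp_group h"
  by (rule Sp_groupI) (use assms in \<open>simp add: Sp_group_def flip: matrix_vector_mul_assoc\<close>)

lemma Sp_group_inv:
  assumes "g \<in> Sp_group h"
  shows "g ** matrix_inv g = mat 1" "matrix_inv g ** g = mat 1" "matrix_inv g \<in> Sp_group h"
proof -
  show *: "g ** matrix_inv g = mat 1" "matrix_inv g ** g = mat 1"
    using assms by (auto simp: Sp_group_def matrix_inv_inverse)
  show "matrix_inv g \<in> Sp_group h"
  proof (rule Sp_groupI)
    fix x y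
    have "h (matrix_inv g *v x) (matrix_inv g *v y) =
        h (g *v (matrix_inv g *v x)) (g *v (matrix_inv g *v y))"
      using assms by (simp add: Sp_group_def)
    then show "h (matrix_inv g *v x) (matrix_inv g *v y) = h x y"
      by (simp add: matrix_vector_mul_assoc *(1))
  qed
qed

lemma matrix_inv_mult:
  assumes "g \<in> Sp_group h" "k \<in> Sp_group h"
  shows "matrix_inv (g ** k) = matrix_inv k ** matrix_inv g"
  by (rule matrix_inv_eqI; metis Sp_group_inv(1,2) assms matrix_mul_assoc matrix_mul_rid)

text \<open>If \<open>g X = c X g\<close>, then \<open>k g\<close> conjugates \<open>X\<close> to
  \<open>c\<close> times the conjugate of \<open>X\<close> by \<open>k\<close>, so the similitude at
  the base point serves every point of the orbit.\<close>

lemma nilpotent_orbit_scaleR: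
  assumes O: "nilpotent_orbit h \<O>" and c: "c \<noteq> 0" and Y: "Y \<in> \<O>"
  shows "c *\<^sub>R Y \<in> \<O>"
proof -
  obtain X where X: "nilpotent_elt (sp_alg h) X" and OX: "\<O> = adjoint_orbit h X"
    using O by (auto simp: nilpotent_orbit_def)
  obtain N where N: "\<And>x. ((*v) X ^^ N) x = 0"
    using ad_nilpotent_imp_nilpotent[OF X] by blast
  have "X \<in> sp_alg h" "1 / c \<noteq> 0"
    using X c by (auto simp: nilpotent_elt_def)
  then obtain g where g: "g \<in> Sp_group h" "g ** X = c *\<^sub>R (X ** g)"
    using exists_similitude[OF _ N c] by blast
  obtain k where k: "k \<in> Sp_group h" "Y = k ** X ** matrix_inv k"
    using Y OX by (auto simp: adjoint_orbit_def)
  have "(k ** g) ** X ** matrix_inv (k ** g) = k ** (g ** X) ** (matrix_inv g ** matrix_inv k)"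
    by (simp add: matrix_inv_mult[OF k(1) g(1)] matrix_mul_assoc)
  also have "\<dots> = c *\<^sub>R (k ** X ** (g ** matrix_inv g) ** matrix_inv k)"
    by (simp add: g(2) matrix_scalar_ac scalar_matrix_assoc matrix_mul_assoc del: matrix_mul_rid)
  finally have "c *\<^sub>R Y = (k ** g) ** X ** matrix_inv (k ** g)"
    by (simp add: k(2) Sp_group_inv[OF g(1)])
  then show ?thesis
    using Sp_group_mult[OF k(1) g(1)] by (auto simp: OX adjoint_orbit_def)
qed

end

section \<open>Traces and the Lie bracket\<close>

text \<open>\<open>trace_on\<close> uses an arbitrarily chosen basis \<open>B\<close>. Expanding the
  diagonal entries for \<open>B\<close> through \<open>C\<close>, and those for \<open>C\<close>
  through \<open>B\<close>, produces the same double sum.\<close>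

lemma trace_on_eq_basis:
  fixes V :: "'a::euclidean_space set"
  assumes C: "independent C" "span C = V" and f: "linear f" "f ` V \<subseteq> V"
  shows "trace_on V f = (\<Sum>c\<in>C. representation C (f c) c)"
proof -
  define B where "B = (SOME B. independent B \<and> span B = V)"
  have B: "independent B" "span B = V"
    using someI[of "\<lambda>B. independent B \<and> span B = V" C] C by (auto simp: B_def)
  have fin: "finite B" "finite C"
    using B(1) C(1) by (simp_all add: independent_imp_finite)
  have expand: "representation D (f v) d = (\<Sum>e\<in>D'. representation D (f e) d * representation D' v e)"
    if D: "independent D" "span D = V" and D': "independent D'" "span D' = V" "finite D'" and v: "v \<in> V"
    for D D' v d
  proof -
    have "v = (\<Sum>e\<in>D'. representation D' v e *\<^sub>R e)"
      using D' v by (intro real_vector.sum_representation_eq[symmetric]) auto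
    then have "f v = (\<Sum>e\<in>D'. representation D' v e *\<^sub>R f e)"
      using f(1) by (metis (no_types, lifting) linear_sum linear_scale sum.cong)
    also have "representation D \<dots> d = (\<Sum>e\<in>D'. representation D (representation D' v e *\<^sub>R f e) d)"
      using D D' f(2) by (subst real_vector.representation_sum) (auto intro: span_base span_scale)
    also have "\<dots> = (\<Sum>e\<in>D'. representation D (f e) d * representation D' v e)"
    proof (rule sum.cong)
      fix e assume "e \<in> D'"
      then have "f e \<in> span D"
        using D D' f(2) span_base by blast
      then show "representation D (representation D' v e *\<^sub>R f e) d = representation D (f e) d * representation D' v e"
        using D by (simp add: real_vector.representation_scale)
    qed simp
    finally show ?thesis .
  qed
  have expand_id: "representation D v d = (\<Sum>e\<in>D'. representation D e d * representation D' v e)"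
    if D: "independent D" "span D = V" and D': "independent D'" "span D' = V" "finite D'" and v: "v \<in> V"
    for D D' v d
  proof -
    have "representation D (\<Sum>e\<in>D'. representation D' v e *\<^sub>R e) d =
        (\<Sum>e\<in>D'. representation D (representation D' v e *\<^sub>R e) d)"
      using D D' by (subst real_vector.representation_sum) (auto intro: span_base span_scale)
    also have "\<dots> = (\<Sum>e\<in>D'. representation D e d * representation D' v e)"
    proof (rule sum.cong)
      fix e assume "e \<in> D'"
      then have "e \<in> span D"
        using D D' span_base by blast
      then show "representation D (representation D' v e *\<^sub>R e) d = representation D e d * representation D' v e"
        using D by (simp add: real_vector.representation_scale)
    qed simp
    finally show ?thesis
      using D' v by (subst (asm) real_vector.sum_representation_eq) auto
  qed
  have CV: "c \<in> V" if "c \<in> C" for c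
    using that C span_base by blast
  have BV: "b \<in> V" if "b \<in> B" for b
    using that B span_base by blast
  have "trace_on V f = (\<Sum>b\<in>B. representation B (f b) b)"
    by (simp add: trace_on_def Let_def flip: B_def)
  also have "\<dots> = (\<Sum>b\<in>B. \<Sum>c\<in>C. representation B c b * representation C (f b) c)"
    by (intro sum.cong refl expand_id B C fin) (use BV f(2) in auto)
  also have "\<dots> = (\<Sum>c\<in>C. \<Sum>b\<in>B. representation C (f b) c * representation B c b)"
    by (subst sum.swap) (simp add: mult.commute)
  also have "\<dots> = (\<Sum>c\<in>C. representation C (f c) c)"
    by (intro sum.cong refl expand[symmetric] B C fin CV)
  finally show ?thesis .
qed

lemma orthonormal_expansion:
  fixes v :: "'a::euclidean_space"
  assumes C: "pairwise orthogonal C" "\<And>c. c \<in> C \<Longrightarrow> norm c = 1" "independent C" and v: "v \<in> span C"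
  shows "v = (\<Sum>c\<in>C. inner v c *\<^sub>R c)"
proof -
  have fin: "finite C"
    using C(3) by (simp add: independent_imp_finite)
  have "v = (\<Sum>c\<in>C. representation C v c *\<^sub>R c)"
    using C(3) v fin by (intro real_vector.sum_representation_eq[symmetric]) auto
  moreover have "inner (\<Sum>c\<in>C. representation C v c *\<^sub>R c) d = representation C v d" if d: "d \<in> C" for d
  proof -
    have "inner (\<Sum>c\<in>C. representation C v c *\<^sub>R c) d = (\<Sum>c\<in>C. if c = d then representation C v c else 0)"
      unfolding inner_sum_left
      by (rule sum.cong) (use C(1,2) d in \<open>auto simp: pairwise_def orthogonal_def norm_eq_1\<close>)
    then show ?thesis using fin d by simp
  qed
  ultimately show ?thesis
    by (metis (no_types, lifting) sum.cong)
qed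

text \<open>The coordinates \<open>T\<close> need not be isometric: the inner product is pulled back along them.\<close>

lemma trace_on_eq_inner:
  fixes V :: "'a::euclidean_space set" and T :: "'a \<Rightarrow> 'b::euclidean_space"
  assumes T: "linear T" "linear S" "\<And>x. S (T x) = x" "\<And>x. T (S x) = x"
    and C: "pairwise orthogonal C" "\<And>c. c \<in> C \<Longrightarrow> norm c = 1" "independent C" "span C = T ` V"
    and f: "linear f" "f ` V \<subseteq> V"
  shows "trace_on V f = (\<Sum>c\<in>C. inner (T (f (S c))) c)"
proof -
  have fin: "finite C"
    using C(3) by (simp add: independent_imp_finite)
  have injS: "inj S"
    using T(4) by (metis injI)
  have ind: "independent (S ` C)"
    using linear_independent_injective_image[OF T(2) C(3)] injS by (meson inj_on_subset subset_UNIV)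
  have span: "span (S ` C) = V"
    using T C(4) by (simp add: linear_span_image image_image)
  have rep: "representation (S ` C) v b = (if b \<in> S ` C then inner (T v) (T b) else 0)" if v: "v \<in> V" for v b
  proof -
    have "representation (S ` C) v = (\<lambda>b. if b \<in> S ` C then inner (T v) (T b) else 0)"
    proof (rule real_vector.representation_eqI[OF ind])
      show "v \<in> span (S ` C)" using span v by simp
      show "finite {b. (if b \<in> S ` C then inner (T v) (T b) else 0) \<noteq> 0}"
        using fin by (auto intro: rev_finite_subset[of "S ` C"])
      have "T v \<in> span C" using C(4) v by auto
      have Tv: "T v = (\<Sum>c\<in>C. inner (T v) c *\<^sub>R c)"
        using C(1-3) \<open>T v \<in> span C\<close> by (intro orthonormal_expansion) auto
      have "(\<Sum>b | (if b \<in> S ` C then inner (T v) (T b) else 0) \<noteq> 0. (if b \<in> S ` C then inner (T v) (T b) else 0) *\<^sub>R b)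
          = (\<Sum>b\<in>S ` C. inner (T v) (T b) *\<^sub>R b)"
        using fin by (intro sum.mono_neutral_cong_left) auto
      also have "\<dots> = (\<Sum>c\<in>C. inner (T v) c *\<^sub>R S c)"
        using injS by (subst sum.reindex) (auto intro: inj_on_subset simp: T(4))
      also have "\<dots> = S (T v)"
        by (subst (2) Tv) (simp add: linear_sum[OF T(2)] linear_scale[OF T(2)])
      finally show "(\<Sum>b | (if b \<in> S ` C then inner (T v) (T b) else 0) \<noteq> 0. (if b \<in> S ` C then inner (T v) (T b) else 0) *\<^sub>R b) = v"
        by (simp add: T(3))
    qed (auto split: if_splits)
    then show ?thesis by simp
  qed
  have "trace_on V f = (\<Sum>b\<in>S ` C. representation (S ` C) (f b) b)"
    by (rule trace_on_eq_basis[OF ind span f])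
  also have "\<dots> = (\<Sum>c\<in>C. representation (S ` C) (f (S c)) (S c))"
    using injS by (subst sum.reindex) (auto intro: inj_on_subset)
  also have "\<dots> = (\<Sum>c\<in>C. inner (T (f (S c))) c)"
  proof (rule sum.cong)
    fix c assume c: "c \<in> C"
    then have "S c \<in> V" using span_base[of "S c" "S ` C"] by (simp add: span)
    then have "f (S c) \<in> V" using f(2) by blast
    then show "representation (S ` C) (f (S c)) (S c) = inner (T (f (S c))) c"
      using c by (simp add: rep T(4))
  qed simp
  finally show ?thesis .
qed

text \<open>In an orthonormal basis both sides are one double sum of products of matrix entries,
  summed in the two orders.\<close>

lemma trace_on_cyclic:
  fixes V :: "'a::euclidean_space set"
  assumes V: "subspace V" and f: "linear f" "f ` V \<subseteq> V" and g: "linear g" "g ` V \<subseteq> V"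
  shows "trace_on V (\<lambda>x. f (g x)) = trace_on V (\<lambda>x. g (f x))"
proof -
  obtain C where C: "pairwise orthogonal C" "\<And>c. c \<in> C \<Longrightarrow> norm c = 1" "independent C" "span C = V"
    using orthonormal_basis_subspace[OF V] by metis
  have fin: "finite C"
    using C(3) by (simp add: independent_imp_finite)
  have expand: "v = (\<Sum>d\<in>C. inner v d *\<^sub>R d)" if "v \<in> V" for v
    using C that by (intro orthonormal_expansion) auto
  have tr: "trace_on V (\<lambda>x. p (r x)) = (\<Sum>c\<in>C. \<Sum>d\<in>C. inner (r c) d * inner (p d) c)"
    if p: "linear p" "p ` V \<subseteq> V" and r: "linear r" "r ` V \<subseteq> V" for p r
  proof -
    have "trace_on V (\<lambda>x. p (r x)) = (\<Sum>c\<in>C. inner (p (r c)) c)"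
      using p r by (intro trace_on_eq_inner[where T = "\<lambda>x. x" and S = "\<lambda>x. x"] C)
        (auto simp: C linear_compose[unfolded comp_def] linear_ident image_subset_iff)
    also have "\<dots> = (\<Sum>c\<in>C. \<Sum>d\<in>C. inner (r c) d * inner (p d) c)"
    proof (rule sum.cong)
      fix c assume "c \<in> C"
      then have "c \<in> V" using C(4) span_base by blast
      then have "r c \<in> V" using r(2) by blast
      then have "p (r c) = (\<Sum>d\<in>C. inner (r c) d *\<^sub>R p d)"
        by (subst expand) (simp_all add: linear_sum[OF p(1)] linear_scale[OF p(1)])
      then show "inner (p (r c)) c = (\<Sum>d\<in>C. inner (r c) d * inner (p d) c)"
        by (simp add: inner_sum_left)
    qed simp
    finally show ?thesis .
  qed
  show ?thesis
    by (simp only: tr[OF f g] tr[OF g f]) (subst sum.swap, simp add: mult.commute)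
qed

section \<open>Conjugate transpose and the bracket of matrices\<close>

definition adj :: "quat ^ 'n ^ 'n \<Rightarrow> quat ^ 'n ^ 'n" where
  "adj A = (\<chi> i j. qcnj (A $ j $ i))"

lemma inner_matrix_mult_left: "inner (A ** B) C = inner B (adj A ** C)" for A B C :: "quat ^ 'n ^ 'n"
proof -
  have "inner (A ** B) C = (\<Sum>i\<in>UNIV. \<Sum>j\<in>UNIV. \<Sum>k\<in>UNIV. inner (A $ i $ k * B $ k $ j) (C $ i $ j))"
    by (simp add: inner_vec_def matrix_matrix_mult_def inner_sum_left)
  also have "\<dots> = (\<Sum>k\<in>UNIV. \<Sum>j\<in>UNIV. \<Sum>i\<in>UNIV. inner (A $ i $ k * B $ k $ j) (C $ i $ j))"
    by (subst sum.swap, subst (2) sum.swap, subst sum.swap) simp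
  also have "\<dots> = inner B (adj A ** C)"
    by (simp add: inner_vec_def matrix_matrix_mult_def inner_sum_right inner_quat_mult_left adj_def)
  finally show ?thesis .
qed

lemma inner_matrix_mult_right: "inner (B ** A) C = inner B (C ** adj A)" for A B C :: "quat ^ 'n ^ 'n"
proof -
  have "inner (B ** A) C = (\<Sum>i\<in>UNIV. \<Sum>j\<in>UNIV. \<Sum>k\<in>UNIV. inner (B $ i $ k * A $ k $ j) (C $ i $ j))"
    by (simp add: inner_vec_def matrix_matrix_mult_def inner_sum_left)
  also have "\<dots> = (\<Sum>i\<in>UNIV. \<Sum>k\<in>UNIV. \<Sum>j\<in>UNIV. inner (B $ i $ k * A $ k $ j) (C $ i $ j))"
    by (subst (2) sum.swap) simp
  also have "\<dots> = inner B (C ** adj A)"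
    by (simp add: inner_vec_def matrix_matrix_mult_def inner_sum_right inner_quat_mult_right adj_def)
  finally show ?thesis .
qed

text \<open>Conjugate transposition gives the adjoint of left and of right multiplication, so
  \<open>ad (adj X)\<close> is the adjoint of \<open>ad X\<close> for the real inner product. This
  turns a value of the Killing form into a sum of squares.\<close>

lemma inner_lie: "inner (lie (adj X) A) C = inner A (lie X C)"
proof -
  have "adj (adj X) = X"
    by (simp add: adj_def vec_eq_iff)
  then show ?thesis
    by (simp add: lie_def inner_diff_left inner_diff_right inner_matrix_mult_left[of "adj X" A] inner_matrix_mult_right[of A "adj X"])
qed

lemma matrix_mult_minus [simp]: "A ** (- B) = - (A ** B)" "(- A) ** B = - (A ** B)"
  for A B :: "quat ^ 'n ^ 'n"
  by (simp_all add: matrix_matrix_mult_def vec_eq_iff sum_negf)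

lemma matrix_mult_diff: "A ** (B - C) = A ** B - A ** C" "(B - C) ** A = B ** A - C ** A"
  for A B C :: "quat ^ 'n ^ 'n"
  by (simp_all add: matrix_matrix_mult_def vec_eq_iff sum_subtractf algebra_simps)

lemma matrix_mult_add: "A ** (B + C) = A ** B + A ** C" "(B + C) ** A = B ** A + C ** A"
  for A B C :: "quat ^ 'n ^ 'n"
  by (simp_all add: matrix_matrix_mult_def vec_eq_iff sum.distrib algebra_simps)

lemma matrix_mult_scaleR: "A ** (r *\<^sub>R B) = r *\<^sub>R (A ** B)" "(r *\<^sub>R A) ** B = r *\<^sub>R (A ** B)"
  for A B :: "quat ^ 'n ^ 'n"
  by (simp_all add: matrix_scalar_ac scalar_matrix_assoc)

lemma bounded_bilinear_matrix_mult:
  "bounded_bilinear ((**) :: quat ^ 'n ^ 'n \<Rightarrow> quat ^ 'n ^ 'n \<Rightarrow> quat ^ 'n ^ 'n)"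
  unfolding bilinear_conv_bounded_bilinear[symmetric] bilinear_def
  by (auto intro!: linearI simp: matrix_mult_add matrix_mult_scaleR)

lemma bounded_bilinear_lie: "bounded_bilinear (lie :: quat ^ 'n ^ 'n \<Rightarrow> _)"
  unfolding bilinear_conv_bounded_bilinear[symmetric] bilinear_def
  by (auto intro!: linearI simp: lie_def matrix_mult_add matrix_mult_scaleR algebra_simps)

lemmas lie_simps = bounded_bilinear.add_left[OF bounded_bilinear_lie] bounded_bilinear.add_right[OF bounded_bilinear_lie]
  bounded_bilinear.diff_left[OF bounded_bilinear_lie] bounded_bilinear.diff_right[OF bounded_bilinear_lie]
  bounded_bilinear.scaleR_left[OF bounded_bilinear_lie] bounded_bilinear.scaleR_right[OF bounded_bilinear_lie]
  bounded_bilinear.minus_left[OF bounded_bilinear_lie] bounded_bilinear.minus_right[OF bounded_bilinear_lie]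
  bounded_bilinear.zero_left[OF bounded_bilinear_lie] bounded_bilinear.zero_right[OF bounded_bilinear_lie]

lemma linear_lie: "linear (lie X)"
  by (auto intro!: linearI simp: lie_simps)

lemma lie_self [simp]: "lie X X = 0"
  by (simp add: lie_def)

lemma lie_anticommute: "lie X Y = - lie Y X"
  by (simp add: lie_def)

lemma jacobi: "lie (lie X Y) Z = lie X (lie Y Z) - lie Y (lie X Z)"
  by (simp add: lie_def matrix_mult_diff matrix_mul_assoc)

section \<open>The Killing form\<close>

context quat_form
begin

text \<open>The defect \<open>s x y\<close> is right-linear in \<open>y\<close> and satisfies
  \<open>s x y = qcnj (s y x)\<close>, so its values on the basis \<open>e\<close> determine
  it.\<close>

lemma sp_alg_iff_basis:
  "X \<in> sp_alg h \<longleftrightarrow> (\<forall>i j. h (X *v e i) (e j) + h (e i) (X *v e j) = 0)"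
proof
  assume *: "\<forall>i j. h (X *v e i) (e j) + h (e i) (X *v e j) = 0"
  define s where "s x y = h (X *v x) y + h x (X *v y)" for x y
  have s_sum: "s x (\<Sum>i\<in>UNIV. rscale (e i) (b i)) = (\<Sum>i\<in>UNIV. s x (e i) * b i)" for x and b :: "'n \<Rightarrow> quat"
    by (simp add: s_def linear_sum[OF linear_mat_vec] mat_vec_rscale h_sum h_rscale sum.distrib distrib_right)
  have s_cnj: "s x y = qcnj (s y x)" for x y
    by (simp add: s_def h_cnj add.commute)
  have "s (e i) x = 0" for i x
    by (subst vec_expansion[of x], subst s_sum) (use * in \<open>simp add: s_def\<close>)
  then have "s x (e i) = 0" for i x
    using s_cnj[of x "e i"] by simp
  then have "s x y = 0" for x y
    by (subst vec_expansion[of y], subst s_sum) simp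
  then show "X \<in> sp_alg h"
    by (simp add: s_def sp_alg_def)
qed (simp add: sp_alg_def)

lemma subspace_sp_alg: "subspace (sp_alg h)"
proof (rule subspaceI)
  show "0 \<in> sp_alg h"
    by (simp add: sp_alg_def)
  show "A + B \<in> sp_alg h" if "A \<in> sp_alg h" "B \<in> sp_alg h" for A B
    unfolding sp_alg_def mem_Collect_eq
  proof (intro allI)
    fix x y
    have "h ((A + B) *v x) y + h x ((A + B) *v y) =
        (h (A *v x) y + h x (A *v y)) + (h (B *v x) y + h x (B *v y))"
      by (simp add: matrix_vector_mult_add_rdistrib h_add ac_simps)
    then show "h ((A + B) *v x) y + h x ((A + B) *v y) = 0"
      using that by (simp add: sp_alg_def)
  qed
  show "c *\<^sub>R A \<in> sp_alg h" if "A \<in> sp_alg h" for A c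
    using that by (auto simp: sp_alg_def scaleR_mat_vec h_scaleR simp flip: scaleR_add_right)
qed

lemma lie_in_sp_alg:
  assumes "A \<in> sp_alg h" "B \<in> sp_alg h"
  shows "lie A B \<in> sp_alg h"
  unfolding sp_alg_def
  by (simp add: lie_def matrix_vector_mult_diff_rdistrib h_diff sp_algD[OF assms(1)] sp_algD[OF assms(2)]
      flip: matrix_vector_mul_assoc)

text \<open>Matrix of an endomorphism in the basis \<open>e\<close>, where the form is diagonal. In
  the standard basis \<open>h\<close> can be arbitrary, and conjugate transposition need not
  preserve \<open>sp_alg h\<close>.\<close>

definition to_coord :: "quat ^ 'n ^ 'n \<Rightarrow> quat ^ 'n ^ 'n" where
  "to_coord A = matrix_inv Pm ** A ** Pm"

definition of_coord :: "quat ^ 'n ^ 'n \<Rightarrow> quat ^ 'n ^ 'n" where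
  "of_coord A = Pm ** A ** matrix_inv Pm"

lemma Pm_inv: "Pm ** matrix_inv Pm = mat 1" "matrix_inv Pm ** Pm = mat 1"
  by (simp_all add: matrix_inv_inverse invertible_Pm)

lemma coord_inverse [simp]: "of_coord (to_coord A) = A" "to_coord (of_coord A) = A"
proof -
  have "of_coord (to_coord A) = (Pm ** matrix_inv Pm) ** A ** (Pm ** matrix_inv Pm)"
    by (simp only: to_coord_def of_coord_def matrix_mul_assoc)
  then show "of_coord (to_coord A) = A" by (simp add: Pm_inv)
  have "to_coord (of_coord A) = (matrix_inv Pm ** Pm) ** A ** (matrix_inv Pm ** Pm)"
    by (simp only: to_coord_def of_coord_def matrix_mul_assoc)
  then show "to_coord (of_coord A) = A" by (simp add: Pm_inv)
qed

lemma linear_coord: "linear to_coord" "linear of_coord"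
  by (auto intro!: linearI simp: to_coord_def of_coord_def matrix_mult_add matrix_mult_scaleR)

lemma to_coord_lie: "to_coord (lie A B) = lie (to_coord A) (to_coord B)"
proof -
  have "to_coord (A ** B) = to_coord A ** to_coord B" for A B
  proof -
    have "to_coord A ** to_coord B = matrix_inv Pm ** A ** (Pm ** matrix_inv Pm) ** B ** Pm"
      by (simp only: to_coord_def matrix_mul_assoc)
    then show ?thesis by (simp add: Pm_inv to_coord_def matrix_mul_assoc)
  qed
  then show ?thesis
    by (simp add: lie_def linear_diff[OF linear_coord(1)])
qed

lemma h_e_coord: "h (e i) (A *v e j) = h (e i) (e i) * to_coord A $ i $ j"
proof -
  have col: "(B *v axis j 1) $ i = B $ i $ j" for B :: "quat ^ 'n ^ 'n" and i j
    by (simp add: matrix_vector_mult_def axis_def if_distrib cong: if_cong)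
  have ej: "e j = Pm *v axis j 1"
    by (simp add: vec_eq_iff col) (simp add: Pm_def)
  have "A ** Pm = Pm ** to_coord A"
    by (simp add: to_coord_def matrix_mul_assoc Pm_inv)
  then have "A *v e j = Pm *v (to_coord A *v axis j 1)"
    by (simp add: ej matrix_vector_mul_assoc)
  then show ?thesis
    by (simp add: h_e_Pm col)
qed

lemma sp_alg_coord:
  "A \<in> sp_alg h \<longleftrightarrow>
    (\<forall>i j. qcnj (h (e j) (e j) * to_coord A $ j $ i) + h (e i) (e i) * to_coord A $ i $ j = 0)"
proof -
  have "h (A *v e i) (e j) = qcnj (h (e j) (e j) * to_coord A $ j $ i)" for i j
    by (simp add: h_cnj flip: h_e_coord)
  then show ?thesis
    by (simp add: sp_alg_iff_basis h_e_coord)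
qed

text \<open>Up to sign this is the Cartan involution of \<open>sp(p,q)\<close>. Because the Gram
  entries are 1 and -1, each defining equation for the conjugate transpose is the one for
  \<open>A\<close> multiplied by a sign.\<close>

lemma cartan_involution_in_sp_alg:
  assumes "A \<in> sp_alg h"
  shows "of_coord (adj (to_coord A)) \<in> sp_alg h"
  unfolding sp_alg_coord
proof (intro allI)
  fix i j
  have "qcnj (h (e j) (e j) * to_coord A $ j $ i) + h (e i) (e i) * to_coord A $ i $ j = 0"
    using assms by (simp add: sp_alg_coord)
  then show "qcnj (h (e j) (e j) * to_coord (of_coord (adj (to_coord A))) $ j $ i) +
      h (e i) (e i) * to_coord (of_coord (adj (to_coord A))) $ i $ j = 0"
    using unit[of i] unit[of j] by (auto simp: adj_def quat_eq_iff)
qed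

text \<open>Commuting with one rank-one element at a basis vector makes that vector an eigenvector
  of \<open>W\<close>, with eigenvalue \<open>c\<close>. Then \<open>c a + a qcnj c = 0\<close> for
  all imaginary \<open>a\<close>: the unit \<open>i\<close> kills every part of \<open>c\<close>
  except its \<open>i\<close> part, and \<open>j\<close> kills that one.\<close>

lemma sp_alg_center:
  assumes W: "W \<in> sp_alg h" and comm: "\<And>A. A \<in> sp_alg h \<Longrightarrow> lie W A = 0"
  shows "W = 0"
proof -
  have "W *v e i = 0" for i
  proof -
    have im: "rank1 (e i) a \<in> sp_alg h" if "qcnj a = - a" for a
      using that by (rule rank1_in_sp_alg)
    let ?i = "Quat 0 1 0 0"
    have i: "qcnj ?i = - ?i" "?i \<noteq> 0"
      by (simp_all add: quat_eq_iff)
    have "W ** rank1 (e i) ?i *v e i = rank1 (e i) ?i ** W *v e i"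
      using comm[OF im[OF i(1)]] by (simp add: lie_def)
    then have "rscale (W *v e i) (?i * h (e i) (e i)) = rscale (e i) (?i * h (e i) (W *v e i))"
      by (simp add: rank1_vec mat_vec_rscale flip: matrix_vector_mul_assoc)
    then have "rscale (rscale (W *v e i) (?i * h (e i) (e i))) (inverse (?i * h (e i) (e i))) =
        rscale (rscale (e i) (?i * h (e i) (W *v e i))) (inverse (?i * h (e i) (e i)))"
      by simp
    then obtain c where c: "W *v e i = rscale (e i) c"
      using i(2) unit_nonzero[of i] by (auto simp del: inverse_mult_distrib)
    have "c * a + a * qcnj c = 0" if "qcnj a = - a" for a
      using comm[OF im[OF that]] lie_rank1[OF W c] rank1_eq_0 e_nonzero by metis
    from this[of ?i] this[of "Quat 0 0 1 0"] have "c = 0"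
      by (simp add: quat_eq_iff)
    then show ?thesis by (simp add: c)
  qed
  then have "W *v x = 0" for x
    by (subst vec_expansion) (simp add: linear_sum[OF linear_mat_vec] mat_vec_rscale)
  then show ?thesis
    by (simp add: matrix_eq)
qed

lemma lie_image_sp_alg: "X \<in> sp_alg h \<Longrightarrow> lie X ` sp_alg h \<subseteq> sp_alg h"
  by (auto intro: lie_in_sp_alg)

lemma sp_alg_ops:
  "X \<in> sp_alg h \<Longrightarrow> Y \<in> sp_alg h \<Longrightarrow> X + Y \<in> sp_alg h"
  "X \<in> sp_alg h \<Longrightarrow> Y \<in> sp_alg h \<Longrightarrow> X - Y \<in> sp_alg h"
  "X \<in> sp_alg h \<Longrightarrow> r *\<^sub>R X \<in> sp_alg h" "X \<in> sp_alg h \<Longrightarrow> - X \<in> sp_alg h" "0 \<in> sp_alg h"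
  using subspace_sp_alg by (auto intro: subspace_add subspace_diff subspace_scale subspace_neg subspace_0)

text \<open>An orthonormal basis \<open>C\<close> of the coordinate image, the same for all
  \<open>X\<close> and \<open>Y\<close>, makes the Killing form an explicit finite sum. Bilinearity,
  positivity against the Cartan image and continuity along a chart are read off from it.\<close>

lemma killing_formula:
  obtains C where "span C = to_coord ` sp_alg h"
    "\<And>X Y. X \<in> sp_alg h \<Longrightarrow> Y \<in> sp_alg h \<Longrightarrow>
      killing (sp_alg h) X Y = (\<Sum>c\<in>C. inner (to_coord (lie X (lie Y (of_coord c)))) c)"
    "finite C"
proof -
  have "subspace (to_coord ` sp_alg h)"
    by (rule linear_subspace_image[OF linear_coord(1) subspace_sp_alg])
  then obtain C where C: "pairwise orthogonal C" "\<And>c. c \<in> C \<Longrightarrow> norm c = 1" "independent C"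
    "span C = to_coord ` sp_alg h"
    using orthonormal_basis_subspace by metis
  show thesis
  proof
    show "span C = to_coord ` sp_alg h" by fact
    show "finite C" using C(3) by (simp add: independent_imp_finite)
    show "killing (sp_alg h) X Y = (\<Sum>c\<in>C. inner (to_coord (lie X (lie Y (of_coord c)))) c)"
      if "X \<in> sp_alg h" "Y \<in> sp_alg h" for X Y
      unfolding killing_def
      by (rule trace_on_eq_inner[OF linear_coord _ _ C])
        (use that in \<open>auto intro: lie_in_sp_alg simp: linear_compose[OF linear_lie linear_lie, unfolded comp_def]\<close>)
  qed
qed

lemma killing_diff:
  assumes "X \<in> sp_alg h" "Y \<in> sp_alg h" "Z \<in> sp_alg h"
  shows "killing (sp_alg h) (X - Y) Z = killing (sp_alg h) X Z - killing (sp_alg h) Y Z"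
    "killing (sp_alg h) Z (X - Y) = killing (sp_alg h) Z X - killing (sp_alg h) Z Y"
  by (rule killing_formula, use assms in \<open>simp add: sp_alg_ops lie_simps linear_diff[OF linear_coord(1)]
      inner_diff_left sum_subtractf\<close>)+

lemma killing_scaleR:
  assumes "X \<in> sp_alg h" "Z \<in> sp_alg h"
  shows "killing (sp_alg h) (r *\<^sub>R X) Z = r * killing (sp_alg h) X Z"
    "killing (sp_alg h) Z (r *\<^sub>R X) = r * killing (sp_alg h) Z X"
  by (rule killing_formula, use assms in \<open>simp add: sp_alg_ops lie_simps linear_scale[OF linear_coord(1)]
      sum_distrib_left\<close>)+

lemma killing_commute:
  assumes "X \<in> sp_alg h" "Y \<in> sp_alg h"
  shows "killing (sp_alg h) X Y = killing (sp_alg h) Y X"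
  unfolding killing_def
  by (rule trace_on_cyclic[OF subspace_sp_alg linear_lie lie_image_sp_alg linear_lie lie_image_sp_alg]) fact+

lemma trace_on_diff:
  assumes f: "linear f" "f ` sp_alg h \<subseteq> sp_alg h" and g: "linear g" "g ` sp_alg h \<subseteq> sp_alg h"
  shows "trace_on (sp_alg h) (\<lambda>Z. f Z - g Z) = trace_on (sp_alg h) f - trace_on (sp_alg h) g"
proof -
  obtain C where C: "pairwise orthogonal C" "\<And>c. c \<in> C \<Longrightarrow> norm c = 1" "independent C" "span C = (\<lambda>x. x) ` sp_alg h"
    using orthonormal_basis_subspace[OF subspace_sp_alg] by (metis image_ident)
  have tr: "trace_on (sp_alg h) k = (\<Sum>c\<in>C. inner (k c) c)" if "linear k" "k ` sp_alg h \<subseteq> sp_alg h" for k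
    by (rule trace_on_eq_inner[OF linear_ident linear_ident _ _ C that]) simp_all
  have "linear (\<lambda>Z. f Z - g Z)"
    using f(1) g(1) by (rule linear_compose_sub)
  moreover have "(\<lambda>Z. f Z - g Z) ` sp_alg h \<subseteq> sp_alg h"
    using f(2) g(2) by (auto intro!: sp_alg_ops)
  ultimately show ?thesis
    by (simp add: tr f g inner_diff_left sum_subtractf)
qed

text \<open>Cyclicity of the trace gives
  \<open>tr ([ad X, ad Y] ad Z) = tr (ad X [ad Y, ad Z])\<close>, and both commutators are
  \<open>ad\<close> of a bracket by \<open>jacobi\<close>.\<close>

lemma killing_invariant:
  assumes X: "X \<in> sp_alg h" and Y: "Y \<in> sp_alg h" and Z: "Z \<in> sp_alg h"
  shows "killing (sp_alg h) (lie X Y) Z = killing (sp_alg h) X (lie Y Z)"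
proof -
  let ?tr = "trace_on (sp_alg h)"
  have lin: "linear (\<lambda>W. lie A (lie B W))" "linear (\<lambda>W. lie A (lie B (lie D W)))" for A B D :: "quat ^ 'n ^ 'n"
    by (simp_all add: linear_compose[OF linear_lie linear_lie, unfolded comp_def]
        linear_compose[OF linear_compose[OF linear_lie linear_lie] linear_lie, unfolded comp_def])
  have im: "(\<lambda>W. lie A (lie B (lie D W))) ` sp_alg h \<subseteq> sp_alg h" "(\<lambda>W. lie A (lie B W)) ` sp_alg h \<subseteq> sp_alg h"
    if "A \<in> sp_alg h" "B \<in> sp_alg h" "D \<in> sp_alg h" for A B D
    using that by (auto intro!: lie_in_sp_alg)
  have "killing (sp_alg h) (lie X Y) Z =
      ?tr (\<lambda>W. lie X (lie Y (lie Z W))) - ?tr (\<lambda>W. lie Y (lie X (lie Z W)))"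
    unfolding killing_def by (subst trace_on_diff[symmetric]) (use X Y Z in \<open>auto intro!: lie_in_sp_alg lin simp: jacobi\<close>)
  also have "?tr (\<lambda>W. lie Y (lie X (lie Z W))) = ?tr (\<lambda>W. lie X (lie Z (lie Y W)))"
    by (rule trace_on_cyclic[OF subspace_sp_alg linear_lie lie_image_sp_alg[OF Y] lin(1) im(2)[OF X Z X]])
  also have "?tr (\<lambda>W. lie X (lie Y (lie Z W))) - ?tr (\<lambda>W. lie X (lie Z (lie Y W))) =
      killing (sp_alg h) X (lie Y Z)"
    unfolding killing_def by (subst trace_on_diff[symmetric])
      (use X Y Z in \<open>auto intro!: lie_in_sp_alg lin simp: jacobi lie_simps\<close>)
  finally show ?thesis .
qed

text \<open>Testing \<open>W\<close> against its Cartan image gives the sum of the squared norms of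
  the brackets of \<open>W\<close> with the spanning family \<open>C\<close>, in coordinates. Its
  vanishing makes \<open>W\<close> central.\<close>

lemma killing_nondegenerate:
  assumes W: "W \<in> sp_alg h" and zero: "\<And>Y. Y \<in> sp_alg h \<Longrightarrow> killing (sp_alg h) Y W = 0"
  shows "W = 0"
proof (rule sp_alg_center[OF W])
  obtain C where span: "span C = to_coord ` sp_alg h"
    and kill: "\<And>X Y. X \<in> sp_alg h \<Longrightarrow> Y \<in> sp_alg h \<Longrightarrow>
      killing (sp_alg h) X Y = (\<Sum>c\<in>C. inner (to_coord (lie X (lie Y (of_coord c)))) c)"
    and fin: "finite C"
    using killing_formula by blast
  let ?W' = "of_coord (adj (to_coord W))"
  have W': "?W' \<in> sp_alg h"
    using W by (rule cartan_involution_in_sp_alg)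
  have "0 = killing (sp_alg h) ?W' W"
    using zero[OF W'] by simp
  also have "\<dots> = (\<Sum>c\<in>C. inner (lie (to_coord W) c) (lie (to_coord W) c))"
    by (simp add: kill[OF W' W] to_coord_lie inner_lie)
  finally have "(\<Sum>c\<in>C. inner (lie (to_coord W) c) (lie (to_coord W) c)) = 0"
    by simp
  then have C0: "\<forall>c\<in>C. lie (to_coord W) c = 0"
    using fin by (subst (asm) sum_nonneg_eq_0_iff) auto
  fix A assume "A \<in> sp_alg h"
  then have "to_coord A \<in> span C"
    using span by blast
  then have "lie (to_coord W) (to_coord A) = 0"
    using C0 linear_eq_0_on_span[OF linear_lie] by blast
  then have "of_coord (to_coord (lie W A)) = of_coord 0"
    by (simp add: to_coord_lie)
  then show "lie W A = 0"
    by (simp add: linear_0[OF linear_coord(2)])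
qed

section \<open>The symplectic form on the tangent spaces of an orbit\<close>

lemma orbit_omega_eq:
  assumes y: "y \<in> sp_alg h" and X: "X \<in> sp_alg h" and Y: "Y \<in> sp_alg h"
  shows "orbit_omega (sp_alg h) y (lie X y) (lie Y y) = killing (sp_alg h) y (lie X Y)"
proof -
  \<comment> \<open>By invariance the value is \<open>\<kappa>([y,X],Y)\<close>, which sees
    \<open>X\<close> only through its bracket with \<open>y\<close>; antisymmetry gives the same for
    \<open>Y\<close>, so \<open>THE\<close> picks a unique value.\<close>
  have left: "killing (sp_alg h) y (lie X Y) = killing (sp_alg h) y (lie X' Y)"
    if "X \<in> sp_alg h" "X' \<in> sp_alg h" "Y \<in> sp_alg h" "lie X y = lie X' y" for X X' Y
  proof -
    have "lie y X = lie y X'"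
      using that(4) lie_anticommute[of y] by simp
    then show ?thesis
      using killing_invariant[OF y that(1,3)] killing_invariant[OF y that(2,3)] by simp
  qed
  have anti: "killing (sp_alg h) y (lie X Y) = - killing (sp_alg h) y (lie Y X)"
    if "X \<in> sp_alg h" "Y \<in> sp_alg h" for X Y
    using killing_scaleR(2)[OF lie_in_sp_alg[OF that(2,1)] y, of "- 1"] lie_anticommute[of X Y] by simp
  have "c = killing (sp_alg h) y (lie X Y)"
    if c: "X' \<in> sp_alg h" "Y' \<in> sp_alg h" "lie X y = lie X' y" "lie Y y = lie Y' y"
      "c = killing (sp_alg h) y (lie X' Y')" for c X' Y'
  proof -
    have "killing (sp_alg h) y (lie X Y) = killing (sp_alg h) y (lie X' Y)"
      using left X Y c by blast
    also have "\<dots> = - killing (sp_alg h) y (lie Y X')"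
      using anti Y c by blast
    also have "\<dots> = - killing (sp_alg h) y (lie Y' X')"
      using left[of Y Y' X'] Y c by simp
    also have "\<dots> = c"
      using anti[of X' Y'] c by simp
    finally show ?thesis by simp
  qed
  then show ?thesis
    unfolding orbit_omega_def using X Y by (intro the_equality) blast+
qed

lemma subspace_orbit_tangent: "subspace (orbit_tangent (sp_alg h) y)"
proof -
  have "linear (\<lambda>X. lie X y)"
    by (auto intro!: linearI simp: lie_simps)
  then have "subspace ((\<lambda>X. lie X y) ` sp_alg h)"
    using subspace_sp_alg by (rule linear_subspace_image)
  moreover have "(\<lambda>X. lie X y) ` sp_alg h = orbit_tangent (sp_alg h) y"
    by (auto simp: orbit_tangent_def)
  ultimately show ?thesis by simp
qed

lemma orbit_omega_bilinear:
  assumes y: "y \<in> sp_alg h" and a: "a \<in> orbit_tangent (sp_alg h) y" and b: "b \<in> orbit_tangent (sp_alg h) y"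
    and c: "c \<in> orbit_tangent (sp_alg h) y"
  shows "orbit_omega (sp_alg h) y (a - b) c = orbit_omega (sp_alg h) y a c - orbit_omega (sp_alg h) y b c"
    and "orbit_omega (sp_alg h) y (r *\<^sub>R a) c = r * orbit_omega (sp_alg h) y a c"
    and "orbit_omega (sp_alg h) y a c = - orbit_omega (sp_alg h) y c a"
proof -
  obtain A B C where ABC: "A \<in> sp_alg h" "B \<in> sp_alg h" "C \<in> sp_alg h" "a = lie A y" "b = lie B y" "c = lie C y"
    using a b c by (auto simp: orbit_tangent_def)
  have "a - b = lie (A - B) y" "r *\<^sub>R a = lie (r *\<^sub>R A) y"
    using ABC by (simp_all add: lie_simps)
  then show "orbit_omega (sp_alg h) y (a - b) c = orbit_omega (sp_alg h) y a c - orbit_omega (sp_alg h) y b c"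
    "orbit_omega (sp_alg h) y (r *\<^sub>R a) c = r * orbit_omega (sp_alg h) y a c"
    using ABC y by (simp_all add: orbit_omega_eq sp_alg_ops lie_in_sp_alg)
      (simp_all add: lie_simps killing_diff killing_scaleR lie_in_sp_alg)
  show "orbit_omega (sp_alg h) y a c = - orbit_omega (sp_alg h) y c a"
    using ABC y killing_scaleR(2)[OF lie_in_sp_alg[OF ABC(3,1)] y, of "- 1"] lie_anticommute[of A C]
    by (simp add: orbit_omega_eq)
qed

text \<open>Since \<open>\<kappa>(y,[A,Y]) = \<kappa>([y,A],Y)\<close>, a radical vector
  \<open>[A,y]\<close> has \<open>[y,A]\<close> orthogonal to the whole algebra, hence 0.\<close>

lemma orbit_omega_nondegenerate:
  assumes y: "y \<in> sp_alg h" and a: "a \<in> orbit_tangent (sp_alg h) y"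
    and zero: "\<And>b. b \<in> orbit_tangent (sp_alg h) y \<Longrightarrow> orbit_omega (sp_alg h) y a b = 0"
  shows "a = 0"
proof -
  obtain A where A: "A \<in> sp_alg h" "a = lie A y"
    using a by (auto simp: orbit_tangent_def)
  have "lie y A = 0"
  proof (rule killing_nondegenerate)
    show "lie y A \<in> sp_alg h" using y A by (rule_tac lie_in_sp_alg)
    fix Y assume Y: "Y \<in> sp_alg h"
    then have "orbit_omega (sp_alg h) y a (lie Y y) = 0"
      by (intro zero) (auto simp: orbit_tangent_def)
    then show "killing (sp_alg h) Y (lie y A) = 0"
      using killing_invariant[OF y A(1) Y] killing_commute[OF Y lie_in_sp_alg[OF y A(1)]]
      by (simp add: A(2) orbit_omega_eq[OF y A(1) Y])
  qed
  then show ?thesis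
    using A(2) lie_anticommute[of A y] by simp
qed

end

section \<open>Symplectic bases and the Liouville form\<close>

text \<open>Gram matrix of a symplectic basis in the order in which \<open>wedge_power\<close> pairs
  its arguments: the hyperbolic planes occupy the positions \<open>2i\<close> and
  \<open>2i+1\<close>.\<close>

definition symp :: "nat \<Rightarrow> nat \<Rightarrow> real" where
  "symp i j = (if even i \<and> j = Suc i then 1 else if odd i \<and> i = Suc j then - 1 else 0)"

text \<open>The permutation that moves the pairs \<open>{2i, 2i+1}\<close> as blocks, following
  \<open>t\<close>.\<close>

definition doubling :: "(nat \<Rightarrow> nat) \<Rightarrow> nat \<Rightarrow> nat" where
  "doubling t j = 2 * t (j div 2) + j mod 2"

text \<open>Interchanging two pairs is a product of two transpositions, so a block permutation is
  even.\<close>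

lemma sign_doubling:
  assumes "t permutes {..<m}"
  shows "permutation (doubling t) \<and> sign (doubling t) = 1"
  using assms finite_lessThan
proof (induction t rule: permutes_induct)
  case id
  have "doubling id = id"
    by (simp add: doubling_def fun_eq_iff)
  then show ?case by (simp only: permutation_id sign_id simp_thms)
next
  case (swap a b p)
  let ?s = "Transposition.transpose (2 * a) (2 * b) \<circ> Transposition.transpose (Suc (2 * a)) (Suc (2 * b))"
  have "doubling (Transposition.transpose a b \<circ> p) j = (?s \<circ> doubling p) j" for j
  proof (cases "even j")
    case True
    then show ?thesis
      by (auto simp: doubling_def Transposition.transpose_def)
  next
    case False
    then have "j mod 2 = 1" by presburger
    then show ?thesis
      by (auto simp: doubling_def Transposition.transpose_def)
  qed
  then have eq: "doubling (Transposition.transpose a b \<circ> p) = ?s \<circ> doubling p"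
    by blast
  have "permutation ?s" "sign ?s = 1"
    using swap.hyps by (simp_all add: permutation_compose permutation_swap_id sign_compose sign_swap_id)
  then show ?case
    unfolding eq using swap.IH by (metis permutation_compose sign_compose mult_1)
qed

text \<open>Only permutations carrying each pair \<open>{2i, 2i+1}\<close> onto such a pair
  contribute, that is, block permutations combined with reversals of some pairs. A block permutation
  is even and all its factors are 1; each reversal changes both the sign of \<open>s\<close> and the
  sign of one factor. The induction is on the number of reversed pairs.\<close>

lemma sign_symp_prod_nonneg:
  assumes "s permutes {..<2 * m}"
  shows "0 \<le> of_int (sign s) * (\<Prod>i<m. symp (s (2 * i)) (s (2 * i + 1)))"
  using assms
proof (induction "card {i. i < m \<and> odd (s (2 * i))}" arbitrary: s)
  case 0
  then have ev: "even (s (2 * i))" if "i < m" for i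
    using that by auto
  show ?case
  proof (cases "(\<Prod>i<m. symp (s (2 * i)) (s (2 * i + 1))) = 0")
    case False
    \<comment> \<open>With \<open>s (2i)\<close> even, a nonzero factor leaves only this value for
      \<open>s (2i+1)\<close>, so \<open>s\<close> is a block permutation.\<close>
    then have nz: "s (2 * i + 1) = Suc (s (2 * i))" if "i < m" for i
      using that ev[OF that] by (auto simp: symp_def split: if_splits)
    have inj: "inj s"
      using 0(2) by (rule permutes_inj)
    define t where "t i = (if i < m then s (2 * i) div 2 else i)" for i
    have "t permutes {..<m}"
    proof (rule bij_imp_permutes)
      have "t ` {..<m} \<subseteq> {..<m}"
      proof
        fix y assume "y \<in> t ` {..<m}"
        then obtain i where i: "i < m" "y = s (2 * i) div 2"
          by (auto simp: t_def)
        then have "s (2 * i) < 2 * m"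
          using permutes_in_image[OF 0(2), of "2 * i"] by simp
        then show "y \<in> {..<m}"
          using i(2) by (simp add: less_mult_imp_div_less mult.commute)
      qed
      moreover have "inj_on t {..<m}"
      proof (rule inj_onI)
        fix x y assume xy: "x \<in> {..<m}" "y \<in> {..<m}" "t x = t y"
        then have "even (s (2 * x))" "even (s (2 * y))" "s (2 * x) div 2 = s (2 * y) div 2"
          using ev by (simp_all add: t_def)
        then have "s (2 * x) = s (2 * y)"
          by (metis dvd_mult_div_cancel)
        then show "x = y"
          using inj by (metis injD mult_cancel_left zero_neq_numeral)
      qed
      ultimately show "bij_betw t {..<m} {..<m}"
        by (simp add: bij_betw_def endo_inj_surj)
    qed (simp add: t_def)
    moreover have "doubling t j = s j" for j
    proof (cases "j < 2 * m")
      case True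
      then have j2: "j div 2 < m" by auto
      show ?thesis
      proof (cases "even j")
        case True
        then show ?thesis
          using j2 ev[OF j2] by (simp add: doubling_def t_def)
      next
        case False
        then have "s j = Suc (s (2 * (j div 2)))"
          using nz[OF j2] by simp
        moreover have "j mod 2 = 1"
          using False by presburger
        ultimately show ?thesis
          using j2 ev[OF j2] by (simp add: doubling_def t_def)
      qed
    next
      case False
      then show ?thesis
      proof -
        have "\<not> j div 2 < m" "s j = j"
          using False 0(2) by (auto simp: permutes_not_in)
        then show ?thesis
          by (simp add: doubling_def t_def)
      qed
    qed
    then have "doubling t = s"
      by blast
    ultimately have "sign s = 1"
      using sign_doubling by blast
    moreover have "symp (s (2 * i)) (s (2 * i + 1)) = 1" if "i < m" for i
      using nz[OF that] ev[OF that] by (simp add: symp_def)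
    ultimately show ?thesis by simp
  next
    case True
    then show ?thesis by (simp only: mult_zero_right order_refl)
  qed
next
  case (Suc k)
  then have "{i. i < m \<and> odd (s (2 * i))} \<noteq> {}"
    by (metis card.empty nat.distinct(1))
  then obtain a where a: "a < m" "odd (s (2 * a))"
    by blast
  show ?case
  proof (cases "symp (s (2 * a)) (s (2 * a + 1)) = 0")
    case True
    then have "(\<Prod>i<m. symp (s (2 * i)) (s (2 * i + 1))) = 0"
      using a(1) by (intro prod_zero) auto
    then show ?thesis by (simp only: mult_zero_right order_refl)
  next
    case False
    then have sa: "s (2 * a) = Suc (s (2 * a + 1))"
      using a(2) by (auto simp: symp_def split: if_splits)
    \<comment> \<open>Undoing the reversal of the pair at \<open>a\<close> lowers the number of
      reversed pairs by one.\<close>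
    define t where "t = Transposition.transpose (2 * a) (2 * a + 1)"
    define s' where "s' = s \<circ> t"
    have t_perm: "t permutes {..<2 * m}"
      using a(1) unfolding t_def by (intro permutes_swap_id) auto
    then have s'_perm: "s' permutes {..<2 * m}"
      unfolding s'_def using Suc.prems by (intro permutes_compose)
    have sign: "sign s' = - sign s"
      unfolding s'_def using Suc.prems t_perm
      by (subst sign_compose) (auto simp: permutation_permutes t_def sign_swap_id)
    have s'_a: "s' (2 * a) = s (2 * a + 1)" "s' (2 * a + 1) = s (2 * a)"
      by (simp_all add: s'_def t_def)
    have s'_other: "s' (2 * i) = s (2 * i)" "s' (2 * i + 1) = s (2 * i + 1)" if "i \<noteq> a" for i
    proof -
      have "2 * i \<noteq> 2 * a + 1" "2 * i + 1 \<noteq> 2 * a" by presburger+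
      with that show "s' (2 * i) = s (2 * i)" "s' (2 * i + 1) = s (2 * i + 1)"
        by (auto simp: s'_def t_def Transposition.transpose_def)
    qed
    have "{i. i < m \<and> odd (s (2 * i))} = insert a {i. i < m \<and> odd (s' (2 * i))}"
      using a sa s'_other s'_a by (auto, metis)
    moreover have "a \<notin> {i. i < m \<and> odd (s' (2 * i))}"
      using a(2) sa s'_a by auto
    ultimately have "card {i. i < m \<and> odd (s' (2 * i))} = k"
      using Suc.hyps(2) by simp
    then have IH: "0 \<le> of_int (sign s') * (\<Prod>i<m. symp (s' (2 * i)) (s' (2 * i + 1)))"
      using Suc.hyps(1) s'_perm by blast
    have "(\<Prod>i<m. symp (s' (2 * i)) (s' (2 * i + 1))) =
        symp (s' (2 * a)) (s' (2 * a + 1)) * (\<Prod>i\<in>{..<m} - {a}. symp (s' (2 * i)) (s' (2 * i + 1)))"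
      using a(1) by (intro prod.remove) auto
    also have "(\<Prod>i\<in>{..<m} - {a}. symp (s' (2 * i)) (s' (2 * i + 1))) =
        (\<Prod>i\<in>{..<m} - {a}. symp (s (2 * i)) (s (2 * i + 1)))"
      by (intro prod.cong refl arg_cong2[where f = symp] s'_other) auto
    also have "symp (s' (2 * a)) (s' (2 * a + 1)) = - symp (s (2 * a)) (s (2 * a + 1))"
      unfolding s'_a using a(2) sa by (simp add: symp_def)
    also have "- symp (s (2 * a)) (s (2 * a + 1)) * (\<Prod>i\<in>{..<m} - {a}. symp (s (2 * i)) (s (2 * i + 1))) =
        - (\<Prod>i<m. symp (s (2 * i)) (s (2 * i + 1)))"
      using a(1) by (subst prod.remove[of "{..<m}" a]) auto
    finally show ?thesis
      using IH sign by simp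
  qed
qed

text \<open>No summand is negative and the identity contributes 1, so nothing can cancel.\<close>

lemma wedge_power_symp_pos:
  assumes "\<And>i j. i < 2 * m \<Longrightarrow> j < 2 * m \<Longrightarrow> \<omega> (vs ! i) (vs ! j) = symp i j"
  shows "0 < wedge_power \<omega> m vs"
proof -
  let ?f = "\<lambda>s. of_int (sign s) * (\<Prod>i<m. \<omega> (vs ! s (2 * i)) (vs ! s (2 * i + 1)))"
  let ?P = "{s. s permutes {..<2 * m}}"
  have f: "?f s = of_int (sign s) * (\<Prod>i<m. symp (s (2 * i)) (s (2 * i + 1)))" if "s \<in> ?P" for s
  proof -
    have "s permutes {..<2 * m}" using that by simp
    then have "s j < 2 * m" if "j < 2 * m" for j
      using that permutes_in_image by (metis lessThan_iff)
    then show ?thesis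
      by (intro arg_cong2[where f = "(*)"] prod.cong refl assms) auto
  qed
  have "0 < sum ?f ?P"
  proof (rule sum_pos2)
    show "finite ?P" by (simp add: finite_permutations)
    show "id \<in> ?P" by (simp add: permutes_id)
    show "0 < ?f id"
      using f[of id] by (simp add: permutes_id symp_def)
    show "0 \<le> ?f s" if "s \<in> ?P" for s
      using f[OF that] sign_symp_prod_nonneg that by simp
  qed
  then show ?thesis
    by (simp add: wedge_power_def)
qed

text \<open>A symplectic family of maximal length exists, its length being bounded by
  \<open>dim V\<close>. If it did not span, a vector outside the span, made orthogonal to the
  family, would extend it together with a scaled partner. The hypotheses on \<open>\<omega>\<close>
  are restricted to \<open>V\<close>, since \<open>orbit_omega\<close> is meaningful on tangent
  vectors only.\<close>

lemma exists_symplectic_basis: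
  fixes V :: "'a::euclidean_space set" and \<omega> :: "'a \<Rightarrow> 'a \<Rightarrow> real"
  assumes V: "subspace V"
    and diff: "\<And>a b c. a \<in> V \<Longrightarrow> b \<in> V \<Longrightarrow> c \<in> V \<Longrightarrow> \<omega> (a - b) c = \<omega> a c - \<omega> b c"
    and scale: "\<And>r a c. a \<in> V \<Longrightarrow> c \<in> V \<Longrightarrow> \<omega> (r *\<^sub>R a) c = r * \<omega> a c"
    and anti: "\<And>a c. a \<in> V \<Longrightarrow> c \<in> V \<Longrightarrow> \<omega> a c = - \<omega> c a"
    and nondeg: "\<And>a. a \<in> V \<Longrightarrow> (\<And>b. b \<in> V \<Longrightarrow> \<omega> a b = 0) \<Longrightarrow> a = 0"
  obtains m and v :: "nat \<Rightarrow> 'a" where "\<And>i. i < 2 * m \<Longrightarrow> v i \<in> V"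
    "\<And>i j. i < 2 * m \<Longrightarrow> j < 2 * m \<Longrightarrow> \<omega> (v i) (v j) = symp i j"
    "inj_on v {..<2 * m}" "independent (v ` {..<2 * m})" "span (v ` {..<2 * m}) = V"
proof -
  define good where "good m v \<longleftrightarrow> (\<forall>i<2 * m. v i \<in> V) \<and> (\<forall>i<2 * m. \<forall>j<2 * m. \<omega> (v i) (v j) = symp i j)"
    for m and v :: "nat \<Rightarrow> 'a"
  \<comment> \<open>\<open>p\<close> exchanges \<open>2i\<close> and \<open>2i+1\<close>, so pairing
    with \<open>v (p k)\<close> isolates the coefficient of \<open>v k\<close> up to sign.\<close>
  define p :: "nat \<Rightarrow> nat" where "p i = (if even i then Suc i else i - 1)" for i
  have p_less: "p i < 2 * m" if "i < 2 * m" for i m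
    using that by (cases "even i") (auto simp: p_def elim!: evenE)
  have symp_p: "symp i (p k) = (if i = k then (if even k then 1 else - 1) else 0)" for i k
    by (cases "even i"; cases "even k") (auto simp: symp_def p_def elim!: oddE, presburger+)
  have \<omega>0: "\<omega> 0 c = 0" if "c \<in> V" for c
    using scale[of 0 c 0] that V by (simp add: subspace_0)
  have \<omega>_add: "\<omega> (a + b) c = \<omega> a c + \<omega> b c" if "a \<in> V" "b \<in> V" "c \<in> V" for a b c
    using diff[of a "(- 1) *\<^sub>R b" c] scale[of b c "- 1"] that V by (simp add: subspace_neg)
  have \<omega>_sum: "\<omega> (\<Sum>i<n. c i *\<^sub>R v i) b = (\<Sum>i<n. c i * \<omega> (v i) b)"
    if "\<And>i. i < n \<Longrightarrow> v i \<in> V" "b \<in> V" for n and c :: "nat \<Rightarrow> real" and v b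
    using that(1)
  proof (induction n)
    case (Suc n)
    then have "(\<Sum>i<n. c i *\<^sub>R v i) \<in> V"
      by (intro subspace_sum V subspace_scale) auto
    then show ?case
      using Suc that(2) by (simp add: \<omega>_add scale subspace_scale V)
  qed (simp add: \<omega>0 that(2))
  have coeffs: "c k = 0" if "good m v" "(\<Sum>i<2 * m. c i *\<^sub>R v i) = 0" "k < 2 * m" for m v c k
  proof -
    have "0 = \<omega> (\<Sum>i<2 * m. c i *\<^sub>R v i) (v (p k))"
      using that p_less \<omega>0 by (simp add: good_def)
    also have "\<dots> = (\<Sum>i<2 * m. c i * symp i (p k))"
      using that p_less by (subst \<omega>_sum) (auto simp: good_def intro!: sum.cong)
    also have "\<dots> = c k * (if even k then 1 else - 1)"
      using that(3) by (simp add: symp_p if_distrib cong: if_cong)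
    finally show ?thesis by (auto split: if_splits)
  qed
  have inj: "inj_on v {..<2 * m}" if "good m v" for m v
  proof (rule inj_onI)
    fix i j assume ij: "i \<in> {..<2 * m}" "j \<in> {..<2 * m}" "v i = v j"
    then have "symp i (p j) = symp j (p j)"
      using that p_less unfolding good_def by (metis lessThan_iff)
    then show "i = j"
      by (simp add: symp_p split: if_splits)
  qed
  have indep: "independent (v ` {..<2 * m})" if g: "good m v" for m v
  proof
    assume "dependent (v ` {..<2 * m})"
    then obtain u where u: "\<exists>w\<in>v ` {..<2 * m}. u w \<noteq> 0" "(\<Sum>w\<in>v ` {..<2 * m}. u w *\<^sub>R w) = 0"
      by (subst (asm) real_vector.dependent_finite) auto
    have "(\<Sum>i<2 * m. u (v i) *\<^sub>R v i) = 0"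
      using u(2) by (simp only: sum.reindex[OF inj[OF g]] comp_def)
    then have "u (v k) = 0" if "k < 2 * m" for k
      using coeffs[OF g _ that, of "\<lambda>i. u (v i)"] by simp
    with u(1) show False by auto
  qed
  have bound: "m \<le> dim V" if "good m v" for m v
  proof -
    have "card (v ` {..<2 * m}) \<le> dim V"
      using that by (intro independent_card_le_dim indep) (auto simp: good_def)
    then show ?thesis
      using inj[OF that] by (simp add: card_image)
  qed
  have "\<exists>m. (\<exists>v. good m v) \<and> (\<forall>k. (\<exists>v. good k v) \<longrightarrow> k \<le> m)"
    by (rule Nat.ex_has_greatest_nat[of _ 0 "dim V"]) (auto simp: good_def dest!: bound[unfolded good_def])
  then obtain m v where g: "good m v" and max: "\<And>k v. good k v \<Longrightarrow> k \<le> m"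
    by blast
  let ?S = "v ` {..<2 * m}"
  have vV: "v i \<in> V" if "i < 2 * m" for i
    using that g by (simp add: good_def)
  have SV: "span ?S \<subseteq> V"
    using vV by (intro span_minimal V) auto
  \<comment> \<open>Symplectic projection onto the span; the sign in front is the value
    \<open>symp j (p j)\<close>.\<close>
  define proj where "proj a = (\<Sum>j<2 * m. ((if even j then 1 else - 1) * \<omega> a (v (p j))) *\<^sub>R v j)" for a
  have proj_S: "proj a \<in> span ?S" for a
    unfolding proj_def by (intro span_sum span_scale span_base) auto
  have orth: "\<omega> (a - proj a) (v k) = 0" if a: "a \<in> V" and k: "k < 2 * m" for a k
  proof -
    have pp: "p (p k) = k"
      by (auto simp: p_def elim!: oddE)
    have "\<omega> (proj a) (v k) = (\<Sum>j<2 * m. ((if even j then 1 else - 1) * \<omega> a (v (p j))) * symp j (p (p k)))"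
      unfolding proj_def using g k by (subst \<omega>_sum) (auto simp: good_def pp intro!: sum.cong)
    also have "\<dots> = (\<Sum>j<2 * m. if j = p k then \<omega> a (v k) else 0)"
      unfolding symp_p by (rule sum.cong) (auto simp: pp)
    also have "\<dots> = \<omega> a (v k)"
      using p_less[OF k] by simp
    finally show ?thesis
      using a proj_S[of a] SV vV[OF k] by (simp add: diff subset_iff)
  qed
  have "V \<subseteq> span ?S"
  proof
    fix a assume a: "a \<in> V"
    define a' where "a' = a - proj a"
    have a'V: "a' \<in> V"
      unfolding a'_def using a proj_S SV by (intro subspace_diff V) auto
    have a'o: "\<omega> a' (v k) = 0" if "k < 2 * m" for k
      unfolding a'_def using orth[OF a that] .
    show "a \<in> span ?S"
    proof (rule ccontr)
      assume "a \<notin> span ?S"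
      then have "a' \<noteq> 0"
        using proj_S[of a] by (auto simp: a'_def)
      then obtain b where b: "b \<in> V" "\<omega> a' b \<noteq> 0"
        using nondeg[OF a'V] by blast
      define b1 where "b1 = (1 / \<omega> a' b) *\<^sub>R b"
      define b' where "b' = b1 - proj b1"
      have b1V: "b1 \<in> V"
        unfolding b1_def using b V by (intro subspace_scale)
      have b'V: "b' \<in> V"
        unfolding b'_def using b1V proj_S SV by (intro subspace_diff V) auto
      have b'o: "\<omega> b' (v k) = 0" if "k < 2 * m" for k
        unfolding b'_def using orth[OF b1V that] .
      \<comment> \<open>Making \<open>b1\<close> orthogonal to the family does not disturb its
        pairing with \<open>a'\<close>, which is itself orthogonal to the family.\<close>
      have "\<omega> (proj b1) a' = 0"
        unfolding proj_def using a'o vV a'V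
        by (subst \<omega>_sum) (auto simp: anti[of _ a'])
      then have ba: "\<omega> b' a' = - 1"
        using b1V a'V b proj_S[of b1] SV anti[of b a'] by (simp add: b'_def diff subset_iff) (simp add: b1_def scale)
      have self: "\<omega> c c = 0" if "c \<in> V" for c
        using anti[OF that that] by simp
      define w where "w = v(2 * m := a', Suc (2 * m) := b')"
      have w: "w i = (if i = 2 * m then a' else if i = Suc (2 * m) then b' else v i)" for i
        by (simp add: w_def)
      have "good (Suc m) w"
        unfolding good_def
      proof (intro conjI allI impI)
        fix i assume i: "i < 2 * Suc m"
        then have i': "i < 2 * m \<or> i = 2 * m \<or> i = Suc (2 * m)" by auto
        then show "w i \<in> V"
          using vV a'V b'V by (auto simp: w)
        fix j assume j: "j < 2 * Suc m"
        then have j': "j < 2 * m \<or> j = 2 * m \<or> j = Suc (2 * m)" by auto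
        have s: "symp (2 * m) k = 0" "symp k (2 * m) = 0" "symp (Suc (2 * m)) k = 0" "symp k (Suc (2 * m)) = 0"
          if "k < 2 * m" for k
          using that by (auto simp: symp_def) presburger+
        have t: "symp (2 * m) (2 * m) = 0" "symp (2 * m) (Suc (2 * m)) = 1"
          "symp (Suc (2 * m)) (2 * m) = - 1" "symp (Suc (2 * m)) (Suc (2 * m)) = 0"
          by (auto simp: symp_def)
        have ab: "\<omega> a' b' = 1"
          using anti[OF a'V b'V] ba by simp
        have va: "\<omega> (v k) a' = 0" "\<omega> (v k) b' = 0" if "k < 2 * m" for k
          using anti[OF vV[OF that] a'V] anti[OF vV[OF that] b'V] a'o b'o that by simp_all
        have old: "\<omega> (v i) (v j) = symp i j" if "i < 2 * m" "j < 2 * m" for i j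
          using g that by (simp add: good_def)
        show "\<omega> (w i) (w j) = symp i j"
          using i' j' by (elim disjE) (simp_all add: w s t ab ba va old a'o b'o self a'V b'V)
      qed
      then show False
        using max by fastforce
    qed
  qed
  with SV have "span ?S = V" by blast
  then show thesis
    using that[of m v] g inj[OF g] indep[OF g] by (auto simp: good_def)
qed

section \<open>Charts of adjoint orbits\<close>

context quat_form
begin

lemma Sp_groupD: "g \<in> Sp_group h \<Longrightarrow> h (g *v x) (g *v y) = h x y"
  by (simp add: Sp_group_def)

lemma conj_in_sp_alg:
  assumes g: "g \<in> Sp_group h" and A: "A \<in> sp_alg h"
  shows "g ** A ** matrix_inv g \<in> sp_alg h"
proof -
  let ?g' = "matrix_inv g"
  have gg: "g *v (?g' *v x) = x" for x
    by (simp add: matrix_vector_mul_assoc Sp_group_inv[OF g])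
  have "h (g *v (A *v (?g' *v x))) y + h x (g *v (A *v (?g' *v y))) = 0" for x y
    using Sp_groupD[OF g, of "A *v (?g' *v x)" "?g' *v y"] Sp_groupD[OF g, of "?g' *v x" "A *v (?g' *v y)"]
    by (simp add: gg sp_algD[OF A])
  then show ?thesis
    by (simp add: sp_alg_def flip: matrix_vector_mul_assoc)
qed

lemma adjoint_orbit_subset: "X \<in> sp_alg h \<Longrightarrow> adjoint_orbit h X \<subseteq> sp_alg h"
  by (auto simp: adjoint_orbit_def conj_in_sp_alg)

lemma lie_conj:
  assumes "g \<in> Sp_group h"
  shows "lie (g ** A ** matrix_inv g) (g ** B ** matrix_inv g) = g ** lie A B ** matrix_inv g"
proof -
  have "(g ** A ** matrix_inv g) ** (g ** B ** matrix_inv g) = g ** (A ** B) ** matrix_inv g" for A B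
  proof -
    have "(g ** A ** matrix_inv g) ** (g ** B ** matrix_inv g) = g ** A ** (matrix_inv g ** g) ** B ** matrix_inv g"
      by (simp only: matrix_mul_assoc)
    then show ?thesis
      by (simp add: Sp_group_inv[OF assms] matrix_mul_assoc)
  qed
  then show ?thesis
    by (simp add: lie_def matrix_mult_diff)
qed

text \<open>Conjugation by \<open>g\<close> is a linear isomorphism between the two tangent
  spaces.\<close>

lemma dim_orbit_tangent:
  assumes "Y \<in> adjoint_orbit h X"
  shows "dim (orbit_tangent (sp_alg h) Y) = dim (orbit_tangent (sp_alg h) X)"
proof -
  obtain g where g: "g \<in> Sp_group h" and Y: "Y = g ** X ** matrix_inv g"
    using assms by (auto simp: adjoint_orbit_def)
  let ?c = "\<lambda>A. g ** A ** matrix_inv g"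
  let ?d = "\<lambda>A. matrix_inv g ** A ** g"
  have dc: "?d (?c A) = A" and cd: "?c (?d A) = A" for A
  proof -
    have "?d (?c A) = (matrix_inv g ** g) ** A ** (matrix_inv g ** g)"
      by (simp only: matrix_mul_assoc)
    then show "?d (?c A) = A" by (simp add: Sp_group_inv[OF g])
    have "?c (?d A) = (g ** matrix_inv g) ** A ** (g ** matrix_inv g)"
      by (simp only: matrix_mul_assoc)
    then show "?c (?d A) = A" by (simp add: Sp_group_inv[OF g])
  qed
  have lin: "linear ?c"
    by (auto intro!: linearI simp: matrix_mult_add matrix_mult_scaleR)
  have d_in: "?d A \<in> sp_alg h" if "A \<in> sp_alg h" for A
  proof -
    have "matrix_inv (matrix_inv g) = g"
      by (rule matrix_inv_eqI) (simp_all add: Sp_group_inv[OF g])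
    then show ?thesis
      using conj_in_sp_alg[OF Sp_group_inv(3)[OF g] that] by simp
  qed
  have "orbit_tangent (sp_alg h) Y = ?c ` orbit_tangent (sp_alg h) X"
  proof
    show "?c ` orbit_tangent (sp_alg h) X \<subseteq> orbit_tangent (sp_alg h) Y"
      using conj_in_sp_alg[OF g] by (auto simp: orbit_tangent_def Y simp flip: lie_conj[OF g])
    show "orbit_tangent (sp_alg h) Y \<subseteq> ?c ` orbit_tangent (sp_alg h) X"
    proof
      fix a assume "a \<in> orbit_tangent (sp_alg h) Y"
      then obtain A where A: "A \<in> sp_alg h" "a = lie A Y"
        by (auto simp: orbit_tangent_def)
      then have "a = ?c (lie (?d A) X)"
        by (simp only: Y lie_conj[OF g, symmetric] cd)
      then show "a \<in> ?c ` orbit_tangent (sp_alg h) X"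
        using d_in[OF A(1)] by (auto simp: orbit_tangent_def)
    qed
  qed
  moreover have "inj_on ?c (span (orbit_tangent (sp_alg h) X))"
    by (rule inj_on_inverseI[of _ ?d]) (rule dc)
  ultimately show ?thesis
    using dim_image_eq[OF lin] by simp
qed

end

section \<open>Resolvent and Cayley transform\<close>

definition resolvent :: "quat ^ 'n ^ 'n \<Rightarrow> quat ^ 'n ^ 'n" where
  "resolvent A = matrix_inv (mat 1 - A)"

text \<open>If \<open>A x = x\<close>, then \<open>|x| \<le> K |A| |x|\<close>, which forces
  \<open>x = 0\<close> for small \<open>A\<close>; and \<open>R = 1 + A R\<close> gives
  \<open>|R| \<le> |1| + |R| / 2\<close>. The two entries of the minimum defining
  \<open>\<epsilon>\<close> serve these two estimates.\<close>

lemma resolvent_small: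
  obtains \<epsilon> M where "0 < \<epsilon>" "\<And>A :: quat ^ 'n ^ 'n. norm A < \<epsilon> \<Longrightarrow> resolvent A ** (mat 1 - A) = mat 1"
    "\<And>A :: quat ^ 'n ^ 'n. norm A < \<epsilon> \<Longrightarrow> (mat 1 - A) ** resolvent A = mat 1"
    "\<And>A :: quat ^ 'n ^ 'n. norm A < \<epsilon> \<Longrightarrow> norm (resolvent A) \<le> M"
proof -
  have "bounded_bilinear ((*v) :: quat ^ 'n ^ 'n \<Rightarrow> quat ^ 'n \<Rightarrow> quat ^ 'n)"
    unfolding bilinear_conv_bounded_bilinear[symmetric] bilinear_def
    using linear_mat_vec by (auto intro!: linearI simp: matrix_vector_mult_add_rdistrib scaleR_mat_vec)
  then obtain K where K: "0 < K" "\<And>A (x :: quat ^ 'n). norm (A *v x) \<le> norm (A :: quat ^ 'n ^ 'n) * norm x * K"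
    using bounded_bilinear.pos_bounded by blast
  obtain K' where K': "0 < K'" "\<And>(A :: quat ^ 'n ^ 'n) (B :: quat ^ 'n ^ 'n). norm (A ** B) \<le> norm A * norm B * K'"
    using bounded_bilinear.pos_bounded[OF bounded_bilinear_matrix_mult[where 'n = 'n]] by blast
  define \<epsilon> where "\<epsilon> = min (1 / K) (1 / (2 * K'))"
  have "invertible (mat 1 - A)" if "norm A < \<epsilon>" for A :: "quat ^ 'n ^ 'n"
  proof (rule invertible_quat_matrixI)
    fix x assume "(mat 1 - A) *v x = 0"
    then have "A *v x = x"
      by (simp add: matrix_vector_mult_diff_rdistrib)
    then have "norm x \<le> norm A * norm x * K"
      using K(2)[of A x] by simp
    then have "norm x * (norm A * K) \<ge> norm x * 1"
      by (simp add: ac_simps)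
    moreover have "norm A * K < 1"
      using that K(1) by (simp add: \<epsilon>_def pos_less_divide_eq)
    ultimately show "x = 0"
      by (metis linorder_not_le mult_le_cancel_left_pos zero_less_norm_iff)
  qed
  then have inv: "resolvent A ** (mat 1 - A) = mat 1" "(mat 1 - A) ** resolvent A = mat 1"
    if "norm A < \<epsilon>" for A :: "quat ^ 'n ^ 'n"
    using that by (simp_all add: resolvent_def matrix_inv_inverse)
  have "norm (resolvent A) \<le> 2 * norm (mat 1 :: quat ^ 'n ^ 'n)" if "norm A < \<epsilon>" for A :: "quat ^ 'n ^ 'n"
  proof -
    have "resolvent A = mat 1 + A ** resolvent A"
      using inv(2)[OF that] by (simp add: matrix_mult_diff algebra_simps)
    then have "norm (resolvent A) \<le> norm (mat 1 :: quat ^ 'n ^ 'n) + norm A * norm (resolvent A) * K'"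
      by (metis K'(2) add_left_mono norm_triangle_le)
    moreover have "norm A * norm (resolvent A) * K' \<le> norm (resolvent A) / 2"
    proof -
      have "norm A * K' \<le> 1 / 2"
        using that K'(1) by (simp add: \<epsilon>_def pos_less_divide_eq)
      then have "norm A * K' * norm (resolvent A) \<le> 1 / 2 * norm (resolvent A)"
        by (rule mult_right_mono) simp
      then show ?thesis by (simp add: ac_simps)
    qed
    ultimately show ?thesis by simp
  qed
  moreover have "0 < \<epsilon>"
    using K(1) K'(1) by (simp add: \<epsilon>_def)
  ultimately show thesis
    using that inv by blast
qed

text \<open>The resolvent identity \<open>R B - R A = R B (B - A) R A\<close>, used twice, leaves
  the remainder \<open>R B (B - A) R A (B - A) R A\<close>, which is quadratic in
  \<open>B - A\<close>.\<close>

lemma exists_resolvent_ball: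
  obtains \<epsilon> where "0 < \<epsilon>" "\<And>A :: quat ^ 'n ^ 'n. norm A < \<epsilon> \<Longrightarrow> resolvent A ** (mat 1 - A) = mat 1"
    "\<And>A :: quat ^ 'n ^ 'n. norm A < \<epsilon> \<Longrightarrow> (mat 1 - A) ** resolvent A = mat 1"
    "\<And>A :: quat ^ 'n ^ 'n. norm A < \<epsilon> \<Longrightarrow>
      (resolvent has_derivative (\<lambda>H. resolvent A ** H ** resolvent A)) (at A)"
proof -
  obtain \<epsilon> M where \<epsilon>: "0 < \<epsilon>" and inv: "\<And>A :: quat ^ 'n ^ 'n. norm A < \<epsilon> \<Longrightarrow> resolvent A ** (mat 1 - A) = mat 1"
    "\<And>A :: quat ^ 'n ^ 'n. norm A < \<epsilon> \<Longrightarrow> (mat 1 - A) ** resolvent A = mat 1"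
    and M: "\<And>A :: quat ^ 'n ^ 'n. norm A < \<epsilon> \<Longrightarrow> norm (resolvent A) \<le> M"
    using resolvent_small by blast
  obtain K where K: "0 < K" "\<And>(A :: quat ^ 'n ^ 'n) (B :: quat ^ 'n ^ 'n). norm (A ** B) \<le> norm A * norm B * K"
    using bounded_bilinear.pos_bounded[OF bounded_bilinear_matrix_mult[where 'n = 'n]] by blast
  have "(resolvent has_derivative (\<lambda>H. resolvent A ** H ** resolvent A)) (at A)"
    if A: "norm A < \<epsilon>" for A :: "quat ^ 'n ^ 'n"
  proof (rule has_derivativeI_sandwich[where e = "\<epsilon> - norm A" and H = "\<lambda>B. (M * M * M * K * K * K * K) * norm (B - A)"])
    let ?R = "resolvent :: quat ^ 'n ^ 'n \<Rightarrow> _"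
    show "0 < \<epsilon> - norm A" using A by simp
    show "bounded_linear (\<lambda>H. ?R A ** H ** ?R A)"
      unfolding linear_conv_bounded_linear[symmetric]
      by (auto intro!: linearI simp: matrix_mult_add matrix_mult_scaleR)
    show "((\<lambda>B. M * M * M * K * K * K * K * norm (B - A)) \<longlongrightarrow> 0) (at A)"
      by (intro tendsto_mult_right_zero tendsto_norm_zero) (simp add: LIM_zero_iff)
    fix B assume "B \<noteq> A" "dist B A < \<epsilon> - norm A"
    then have B: "norm B < \<epsilon>"
      using norm_triangle_ineq2[of B A] by (simp add: dist_norm)
    have M0: "0 \<le> M"
      using M[OF A] norm_ge_zero order_trans by blast
    have diff: "?R B - ?R A = ?R B ** (B - A) ** ?R A"
    proof -
      have "?R B ** (B - A) ** ?R A = ?R B ** ((mat 1 - A) - (mat 1 - B)) ** ?R A"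
        by simp
      also have "\<dots> = ?R B ** ((mat 1 - A) ** ?R A) - (?R B ** (mat 1 - B)) ** ?R A"
        by (simp only: matrix_mult_diff matrix_mul_assoc)
      finally show ?thesis
        by (simp add: inv A B)
    qed
    have e: "(?R B - ?R A) ** (B - A) ** ?R A = ?R B ** (B - A) ** ?R A - ?R A ** (B - A) ** ?R A"
      by (metis matrix_mult_diff(2))
    have "?R B - ?R A - ?R A ** (B - A) ** ?R A = ?R B ** (B - A) ** ?R A - ?R A ** (B - A) ** ?R A"
      by (simp only: diff)
    also have "\<dots> = (?R B - ?R A) ** (B - A) ** ?R A"
      by (rule e[symmetric])
    also have "\<dots> = ?R B ** (B - A) ** ?R A ** (B - A) ** ?R A"
      by (simp only: diff)
    also have "norm \<dots> \<le> norm (?R B ** (B - A) ** ?R A ** (B - A)) * norm (?R A) * K"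
      by (rule K)
    also have "\<dots> \<le> (norm (?R B ** (B - A) ** ?R A) * norm (B - A) * K) * norm (?R A) * K"
      using K by (intro mult_right_mono) auto
    also have "\<dots> \<le> ((norm (?R B ** (B - A)) * norm (?R A) * K) * norm (B - A) * K) * norm (?R A) * K"
      using K by (intro mult_right_mono) auto
    also have "\<dots> \<le> (((norm (?R B) * norm (B - A) * K) * norm (?R A) * K) * norm (B - A) * K) * norm (?R A) * K"
      using K by (intro mult_right_mono) auto
    also have "\<dots> \<le> (((M * norm (B - A) * K) * M * K) * norm (B - A) * K) * M * K"
      using K(1) M[OF A] M[OF B] M0 by (intro mult_mono mult_nonneg_nonneg) auto
    finally have "norm (?R B - ?R A - ?R A ** (B - A) ** ?R A) \<le> M * M * M * K * K * K * K * norm (B - A) * norm (B - A)"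
      by (simp add: ac_simps)
    then show "norm (?R B - ?R A - ?R A ** (B - A) ** ?R A) / norm (B - A) \<le>
        M * M * M * K * K * K * K * norm (B - A)"
      using \<open>B \<noteq> A\<close> by (simp add: pos_divide_le_eq)
  qed
  then show thesis
    using that \<epsilon> inv by blast
qed

context quat_form
begin

text \<open>The chart \<open>A \<mapsto> c(A) X c(- A)\<close> given by the Cayley transform \<open>c(A) = (1 + A) (1 - A)\<^sup>-\<^sup>1\<close>.\<close>

lemma exists_cayley_chart:
  assumes X: "X \<in> sp_alg h"
  obtains \<epsilon> \<Phi> \<Xi> where "0 < \<epsilon>" "\<Phi> 0 = X"
    "\<And>A. A \<in> sp_alg h \<Longrightarrow> norm A < \<epsilon> \<Longrightarrow> \<Phi> A \<in> adjoint_orbit h X"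
    "\<And>A. norm A < \<epsilon> \<Longrightarrow> (\<Phi> has_derivative (\<lambda>H. lie (\<Xi> A H) (\<Phi> A))) (at A)"
    "\<And>A H. A \<in> sp_alg h \<Longrightarrow> H \<in> sp_alg h \<Longrightarrow> norm A < \<epsilon> \<Longrightarrow> \<Xi> A H \<in> sp_alg h"
    "\<And>H. \<Xi> 0 H = 2 *\<^sub>R H" "\<And>H. continuous_on (ball 0 \<epsilon>) (\<lambda>A. \<Xi> A H)"
proof -
  obtain \<epsilon> where \<epsilon>: "0 < \<epsilon>" and inv: "\<And>A :: quat ^ 'n ^ 'n. norm A < \<epsilon> \<Longrightarrow> resolvent A ** (mat 1 - A) = mat 1"
    "\<And>A :: quat ^ 'n ^ 'n. norm A < \<epsilon> \<Longrightarrow> (mat 1 - A) ** resolvent A = mat 1"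
    and der: "\<And>A :: quat ^ 'n ^ 'n. norm A < \<epsilon> \<Longrightarrow>
      (resolvent has_derivative (\<lambda>H. resolvent A ** H ** resolvent A)) (at A)"
    using exists_resolvent_ball by blast
  let ?R = "resolvent :: quat ^ 'n ^ 'n \<Rightarrow> _"
  have R0: "?R 0 = mat 1"
    using inv(1)[of 0] \<epsilon> by simp
  have inv': "?R (- A) ** (mat 1 + A) = mat 1" "(mat 1 + A) ** ?R (- A) = mat 1" if "norm A < \<epsilon>" for A
    using inv[of "- A"] that by simp_all
  \<comment> \<open>Obtained by inserting \<open>2 = (1 - A) + (1 + A)\<close> between the two
    resolvents.\<close>
  have sum: "?R A + ?R (- A) = 2 *\<^sub>R (?R A ** ?R (- A))" "?R A + ?R (- A) = 2 *\<^sub>R (?R (- A) ** ?R A)"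
    if A: "norm A < \<epsilon>" for A
  proof -
    have "2 *\<^sub>R (?R A ** ?R (- A)) = ?R A ** ((mat 1 - A) + (mat 1 + A)) ** ?R (- A)"
      by (simp add: matrix_mult_add matrix_mult_diff matrix_mult_scaleR scaleR_2)
    also have "\<dots> = (?R A ** (mat 1 - A)) ** ?R (- A) + ?R A ** ((mat 1 + A) ** ?R (- A))"
      by (simp only: matrix_mult_add matrix_mul_assoc)
    finally show "?R A + ?R (- A) = 2 *\<^sub>R (?R A ** ?R (- A))"
      by (simp add: inv inv' A)
    have "2 *\<^sub>R (?R (- A) ** ?R A) = ?R (- A) ** ((mat 1 - A) + (mat 1 + A)) ** ?R A"
      by (simp add: matrix_mult_add matrix_mult_diff matrix_mult_scaleR scaleR_2)
    also have "\<dots> = ?R (- A) ** ((mat 1 - A) ** ?R A) + (?R (- A) ** (mat 1 + A)) ** ?R A"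
      by (simp only: matrix_mult_add matrix_mul_assoc)
    finally show "?R A + ?R (- A) = 2 *\<^sub>R (?R (- A) ** ?R A)"
      by (simp add: inv inv' A)
  qed
  \<comment> \<open>This is \<open>(1 + A)(1 - A)^(-1)\<close>, because
    \<open>1 + A = 2 - (1 - A)\<close>; the form affine in the resolvent is easy to
    differentiate.\<close>
  define cay where "cay A = 2 *\<^sub>R ?R A - mat 1" for A
  have cay_inv: "cay A ** cay (- A) = mat 1" "cay (- A) ** cay A = mat 1" if A: "norm A < \<epsilon>" for A
  proof -
    have "cay A ** cay (- A) = 2 *\<^sub>R (2 *\<^sub>R (?R A ** ?R (- A))) - 2 *\<^sub>R ?R A - 2 *\<^sub>R ?R (- A) + mat 1"
      by (simp add: cay_def matrix_mult_diff matrix_mult_scaleR algebra_simps)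
    then show "cay A ** cay (- A) = mat 1"
      by (simp only: sum(1)[OF A, symmetric]) (simp add: algebra_simps)
    have "cay (- A) ** cay A = 2 *\<^sub>R (2 *\<^sub>R (?R (- A) ** ?R A)) - 2 *\<^sub>R ?R A - 2 *\<^sub>R ?R (- A) + mat 1"
      by (simp add: cay_def matrix_mult_diff matrix_mult_scaleR algebra_simps)
    then show "cay (- A) ** cay A = mat 1"
      by (simp only: sum(2)[OF A, symmetric]) (simp add: algebra_simps)
  qed
  \<comment> \<open>\<open>A\<close> is skew for \<open>h\<close>, so the adjoint of
    \<open>1 - A\<close> is \<open>1 + A\<close>.\<close>
  have R_adj: "h (?R A *v x) y = h x (?R (- A) *v y)" if A: "norm A < \<epsilon>" and "A \<in> sp_alg h" for A x y
  proof -
    have "h ((mat 1 - A) *v u) w = h u ((mat 1 + A) *v w)" for u w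
      by (simp add: matrix_vector_mult_diff_rdistrib matrix_vector_mult_add_rdistrib h_diff h_add sp_algD[OF that(2)])
    from this[of "?R A *v x" "?R (- A) *v y"] show ?thesis
      by (simp add: matrix_vector_mul_assoc inv inv' A)
  qed
  have cay_adj: "h (cay A *v x) y = h x (cay (- A) *v y)" if "norm A < \<epsilon>" "A \<in> sp_alg h" for A x y
    by (simp add: cay_def matrix_vector_mult_diff_rdistrib scaleR_mat_vec h_diff h_scaleR R_adj that)
  have cay_Sp: "cay A \<in> Sp_group h" if "norm A < \<epsilon>" "A \<in> sp_alg h" for A
    by (rule Sp_groupI) (simp add: cay_adj that matrix_vector_mul_assoc cay_inv)
  define \<Phi> where "\<Phi> A = cay A ** X ** cay (- A)" for A
  \<comment> \<open>Logarithmic derivative of \<open>cay\<close>: its derivative in direction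
    \<open>H\<close> times \<open>cay (- A)\<close>, simplified by
    \<open>?R A ** cay (- A) = ?R (- A)\<close>. For \<open>A\<close> in the algebra
    \<open>?R (- A)\<close> is the adjoint of \<open>?R A\<close>, so \<open>\<Xi> A H\<close> is in
    the algebra along with \<open>H\<close>.\<close>
  define \<Xi> where "\<Xi> A H = 2 *\<^sub>R (?R A ** H ** ?R (- A))" for A H
  have der': "((\<lambda>A. ?R (- A)) has_derivative (\<lambda>H. ?R (- A) ** (- H) ** ?R (- A))) (at A)"
    if A: "norm A < \<epsilon>" for A
    using has_derivative_compose[of "\<lambda>A. - A" uminus A UNIV ?R "\<lambda>H. ?R (- A) ** H ** ?R (- A)"]
      der[of "- A"] A
    by (simp add: has_derivative_minus)
  show thesis
  proof (rule that[of \<epsilon> \<Phi> \<Xi>])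
    show "0 < \<epsilon>" by fact
    show "\<Phi> 0 = X"
      by (simp add: \<Phi>_def cay_def R0 scaleR_2)
    show "\<Phi> A \<in> adjoint_orbit h X" if "A \<in> sp_alg h" "norm A < \<epsilon>" for A
    proof -
      have "matrix_inv (cay A) = cay (- A)"
        using cay_inv[OF that(2)] by (intro matrix_inv_eqI)
      then show ?thesis
        using cay_Sp[OF that(2,1)] unfolding adjoint_orbit_def \<Phi>_def by force
    qed
    show "\<Xi> A H \<in> sp_alg h" if A: "A \<in> sp_alg h" "H \<in> sp_alg h" "norm A < \<epsilon>" for A H
    proof -
      have "- A \<in> sp_alg h" "norm (- A) < \<epsilon>"
        using A by (auto intro: sp_alg_ops)
      then have "h (?R (- A) *v x) y = h x (?R A *v y)" for x y
        using R_adj[of "- A"] by simp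
      then have "?R A ** H ** ?R (- A) \<in> sp_alg h"
        by (simp add: sp_alg_def R_adj[OF A(3,1)] sp_algD[OF A(2)] flip: matrix_vector_mul_assoc)
      then show ?thesis
        unfolding \<Xi>_def by (rule sp_alg_ops)
    qed
    show "\<Xi> 0 H = 2 *\<^sub>R H" for H
      by (simp add: \<Xi>_def R0)
    show "continuous_on (ball 0 \<epsilon>) (\<lambda>A. \<Xi> A H)" for H
    proof -
      have "continuous_on (ball 0 \<epsilon>) ?R" "continuous_on (ball 0 \<epsilon>) (\<lambda>A. ?R (- A))"
        using der der' by (auto intro!: continuous_at_imp_continuous_on has_derivative_continuous)
      then show ?thesis
        unfolding \<Xi>_def
        by (intro continuous_on_scaleR continuous_on_const bounded_bilinear.continuous_on[OF bounded_bilinear_matrix_mult])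
    qed
    show "(\<Phi> has_derivative (\<lambda>H. lie (\<Xi> A H) (\<Phi> A))) (at A)" if A: "norm A < \<epsilon>" for A
    proof -
      have c: "(cay has_derivative (\<lambda>H. 2 *\<^sub>R (?R A ** H ** ?R A))) (at A)"
        unfolding cay_def
        by (rule has_derivative_eq_rhs, (rule derivative_intros der[OF A])+) simp
      have c': "((\<lambda>A. cay (- A)) has_derivative (\<lambda>H. 2 *\<^sub>R (?R (- A) ** (- H) ** ?R (- A)))) (at A)"
        unfolding cay_def
        by (rule has_derivative_eq_rhs, (rule derivative_intros der'[OF A])+) simp
      have "(\<Phi> has_derivative (\<lambda>H. cay A ** X ** (2 *\<^sub>R (?R (- A) ** (- H) ** ?R (- A))) +
          (2 *\<^sub>R (?R A ** H ** ?R A)) ** X ** cay (- A))) (at A)"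
        unfolding \<Phi>_def
        by (rule has_derivative_eq_rhs,
            rule bounded_bilinear.FDERIV[OF bounded_bilinear_matrix_mult _ c'],
            rule bounded_bilinear.FDERIV[OF bounded_bilinear_matrix_mult c has_derivative_const]) simp
      moreover have "cay A ** X ** (2 *\<^sub>R (?R (- A) ** (- H) ** ?R (- A))) +
          (2 *\<^sub>R (?R A ** H ** ?R A)) ** X ** cay (- A) = lie (\<Xi> A H) (\<Phi> A)" for H
      proof -
        have 1: "?R (- A) ** cay A = ?R A" "cay (- A) ** ?R A = ?R (- A)"
          using sum(2)[OF A] by (simp_all add: cay_def matrix_mult_diff matrix_mult_scaleR algebra_simps flip: sum(2)[OF A])
        have "lie (\<Xi> A H) (\<Phi> A) = 2 *\<^sub>R (?R A ** H ** (?R (- A) ** cay A) ** X ** cay (- A)) -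
            2 *\<^sub>R (cay A ** X ** (cay (- A) ** ?R A) ** H ** ?R (- A))"
          by (simp only: lie_def \<Xi>_def \<Phi>_def matrix_mult_scaleR matrix_mul_assoc)
        then show ?thesis
          by (simp add: 1 matrix_mult_scaleR matrix_mul_assoc)
      qed
      ultimately show ?thesis by simp
    qed
  qed
qed

end

lemma wedge_power_cong:
  assumes "\<And>i j. i < 2 * m \<Longrightarrow> j < 2 * m \<Longrightarrow> \<omega> (vs ! i) (vs ! j) = \<omega>' (ws ! i) (ws ! j)"
  shows "wedge_power \<omega> m vs = wedge_power \<omega>' m ws"
proof -
  have "(\<Prod>i<m. \<omega> (vs ! s (2 * i)) (vs ! s (2 * i + 1))) = (\<Prod>i<m. \<omega>' (ws ! s (2 * i)) (ws ! s (2 * i + 1)))"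
    if "s permutes {..<2 * m}" for s
  proof -
    have "s j < 2 * m" if "j < 2 * m" for j
      using that permutes_in_image[OF \<open>s permutes {..<2 * m}\<close>] by (metis lessThan_iff)
    then show ?thesis
      by (intro prod.cong refl assms) auto
  qed
  then show ?thesis
    unfolding wedge_power_def by (intro arg_cong2[where f = "(/)"] sum.cong) auto
qed

lemma continuous_less_on_ball:
  fixes f :: "'a::real_normed_vector \<Rightarrow> real"
  assumes "continuous_on (ball 0 r) f" "0 < r" "f 0 < c"
  obtains r' where "0 < r'" "r' \<le> r" "\<And>x. norm x < r' \<Longrightarrow> f x < c"
proof -
  have "isCont f 0"
    using assms(1,2) by (simp add: continuous_on_eq_continuous_at)
  then have "eventually (\<lambda>x. f x < c) (at 0)"
    using assms(3) by (intro order_tendstoD(2)[of f "f 0"]) (simp_all add: isCont_def)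
  then obtain d where d: "0 < d" "\<And>x. x \<noteq> 0 \<Longrightarrow> norm x < d \<Longrightarrow> f x < c"
    by (auto simp: eventually_at)
  show thesis
    by (rule that[of "min d r"]) (use d assms in \<open>auto, metis\<close>)
qed

section \<open>A chart with positive Liouville density\<close>

context quat_form
begin

lemma orbit_tangent_symplectic_basis:
  assumes X: "X \<in> sp_alg h"
  obtains m v where "\<And>i. i < 2 * m \<Longrightarrow> v i \<in> orbit_tangent (sp_alg h) X"
    "\<And>i j. i < 2 * m \<Longrightarrow> j < 2 * m \<Longrightarrow> orbit_omega (sp_alg h) X (v i) (v j) = symp i j"
    "inj_on v {..<2 * m}" "independent (v ` {..<2 * m})" "dim (orbit_tangent (sp_alg h) X) = 2 * m"
proof (rule exists_symplectic_basis[OF subspace_orbit_tangent[of X], of "orbit_omega (sp_alg h) X"])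
  fix m and v :: "nat \<Rightarrow> quat ^ 'n ^ 'n"
  assume *: "\<And>i. i < 2 * m \<Longrightarrow> v i \<in> orbit_tangent (sp_alg h) X"
    "\<And>i j. i < 2 * m \<Longrightarrow> j < 2 * m \<Longrightarrow> orbit_omega (sp_alg h) X (v i) (v j) = symp i j"
    "inj_on v {..<2 * m}" "independent (v ` {..<2 * m})"
    "span (v ` {..<2 * m}) = orbit_tangent (sp_alg h) X"
  then have "dim (orbit_tangent (sp_alg h) X) = card (v ` {..<2 * m})"
    by (metis dim_span_eq_card_independent)
  then show thesis
    using that[of m v] * by (simp add: card_image)
qed (use orbit_omega_bilinear[OF X] orbit_omega_nondegenerate[OF X] in blast)+

text \<open>The Cayley chart is restricted to a linear slice on which its derivative at 0 carries
  coordinate vectors to a symplectic basis of the tangent space, so the density is positive at 0. A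
  small radius keeps it positive and keeps the derivative close to the one at 0, which gives
  injectivity.\<close>

lemma exists_patch:
  assumes X: "X \<in> sp_alg h"
  obtains bs U \<phi> \<phi>' r where "orbit_param (sp_alg h) (adjoint_orbit h X) bs U \<phi> \<phi>'"
    "0 < r" "U = span (set bs) \<inter> ball 0 r"
    "continuous_on U (\<lambda>u. liouville_form (sp_alg h) (\<phi> u) (map (\<phi>' u) bs))"
    "\<And>u. u \<in> U \<Longrightarrow> 0 < liouville_form (sp_alg h) (\<phi> u) (map (\<phi>' u) bs)"
proof -
  let ?L = "sp_alg h" and ?O = "adjoint_orbit h X"
  obtain \<epsilon> \<Phi> \<Xi> where \<epsilon>: "0 < \<epsilon>" and \<Phi>0: "\<Phi> 0 = X"
    and \<Phi>O: "\<And>A. A \<in> ?L \<Longrightarrow> norm A < \<epsilon> \<Longrightarrow> \<Phi> A \<in> ?O"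
    and \<Phi>_der: "\<And>A. norm A < \<epsilon> \<Longrightarrow> (\<Phi> has_derivative (\<lambda>H. lie (\<Xi> A H) (\<Phi> A))) (at A)"
    and \<Xi>L: "\<And>A H. A \<in> ?L \<Longrightarrow> H \<in> ?L \<Longrightarrow> norm A < \<epsilon> \<Longrightarrow> \<Xi> A H \<in> ?L"
    and \<Xi>0: "\<And>H. \<Xi> 0 H = 2 *\<^sub>R H" and \<Xi>_cont: "\<And>H. continuous_on (ball 0 \<epsilon>) (\<lambda>A. \<Xi> A H)"
    by (rule exists_cayley_chart[OF X], rule that)
  obtain m v where vT: "\<And>i. i < 2 * m \<Longrightarrow> v i \<in> orbit_tangent ?L X"
    and v_symp: "\<And>i j. i < 2 * m \<Longrightarrow> j < 2 * m \<Longrightarrow> orbit_omega ?L X (v i) (v j) = symp i j"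
    and v_inj: "inj_on v {..<2 * m}" and v_ind: "independent (v ` {..<2 * m})"
    and dimT: "dim (orbit_tangent ?L X) = 2 * m"
    using orbit_tangent_symplectic_basis[OF X] by blast
  define \<xi> where "\<xi> i = (SOME A. A \<in> ?L \<and> v i = lie A X)" for i
  have "\<xi> i \<in> ?L \<and> v i = lie (\<xi> i) X" if "i < 2 * m" for i
    unfolding \<xi>_def by (rule someI_ex) (use vT[OF that] in \<open>auto simp: orbit_tangent_def\<close>)
  then have \<xi>: "\<And>i. i < 2 * m \<Longrightarrow> \<xi> i \<in> ?L" "\<And>i. i < 2 * m \<Longrightarrow> v i = lie (\<xi> i) X"
    by auto
  \<comment> \<open>\<open>orbit_param\<close> takes its parameters in a coordinate subspace of the
    matrix space. The tangent space lies in the matrix space, so there are enough basis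
    vectors.\<close>
  have "card {..<2 * m} \<le> card (Basis :: (quat ^ 'n ^ 'n) set)"
    using dim_subset_UNIV[of "orbit_tangent ?L X"] by (simp only: dimT card_lessThan)
  then obtain b :: "nat \<Rightarrow> quat ^ 'n ^ 'n" where b: "b ` {..<2 * m} \<subseteq> Basis" "inj_on b {..<2 * m}"
    using card_le_inj[OF finite_lessThan finite_Basis] by blast
  define bs where "bs = map b [0..<2 * m]"
  have bs: "set bs = b ` {..<2 * m}" "distinct bs" "length bs = 2 * m"
    using b(2) by (auto simp: bs_def distinct_map atLeast0LessThan)
  have bs_ind: "independent (set bs)"
    using bs(1) b(1) independent_Basis independent_mono by metis
  have b_inner: "inner (b i) (b j) = (if i = j then 1 else 0)" if "i < 2 * m" "j < 2 * m" for i j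
  proof -
    have "b i \<in> Basis" "b j \<in> Basis" using b(1) that by auto
    moreover have "b i = b j \<longleftrightarrow> i = j" using b(2) that by (auto simp: inj_on_def)
    ultimately show ?thesis by (simp add: inner_Basis)
  qed
  let ?K = "span (set bs)"
  have dimK: "dim ?K = 2 * m"
    using dim_span_eq_card_independent[OF bs_ind] bs distinct_card by force
  \<comment> \<open>Orthogonal projection onto the parameter space: it stands for the identity there
    and lets derivatives be compared on a full ball of the matrix space.\<close>
  define \<pi> where "\<pi> u = (\<Sum>i<2 * m. inner u (b i) *\<^sub>R b i)" for u
  have \<pi>_lin: "linear \<pi>"
    by (auto intro!: linearI simp: \<pi>_def inner_add_left scaleR_add_left sum.distrib scaleR_sum_right)
  have \<pi>_id: "\<pi> u = u" if "u \<in> ?K" for u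
  proof -
    have "u = (\<Sum>c\<in>set bs. inner u c *\<^sub>R c)"
    proof (rule orthonormal_expansion[OF _ _ bs_ind that])
      show "pairwise orthogonal (set bs)"
        using b(1) unfolding bs(1) pairwise_def orthogonal_def by (metis inner_not_same_Basis subsetD)
      show "norm c = 1" if "c \<in> set bs" for c
        using that b(1) bs(1) by (auto intro: norm_Basis)
    qed
    also have "\<dots> = \<pi> u"
      by (simp add: bs(1) sum.reindex[OF b(2)] \<pi>_def)
    finally show ?thesis by simp
  qed
  \<comment> \<open>The factor 1/2 cancels the 2 in \<open>\<Xi> 0 H = 2 H\<close>, so that the
    derivative of the chart at 0 sends \<open>b i\<close> to \<open>v i\<close>.\<close>
  define \<l> where "\<l> u = (\<Sum>i<2 * m. (inner u (b i) / 2) *\<^sub>R \<xi> i)" for u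
  have \<l>_lin: "linear \<l>"
    by (auto intro!: linearI simp: \<l>_def inner_add_left scaleR_add_left add_divide_distrib sum.distrib scaleR_sum_right)
  have \<l>L: "\<l> u \<in> ?L" for u
    unfolding \<l>_def using \<xi>(1) by (intro subspace_sum subspace_sp_alg sp_alg_ops) auto
  have \<l>0: "\<l> 0 = 0"
    by (simp add: \<l>_def)
  obtain M where M: "0 < M" "\<And>u. norm (\<l> u) \<le> M * norm u"
    using linear_bounded_pos[OF \<l>_lin] by blast
  define r0 where "r0 = \<epsilon> / M"
  have r0: "0 < r0" using \<epsilon> M(1) by (simp add: r0_def)
  have \<l>_small: "norm (\<l> u) < \<epsilon>" if "norm u < r0" for u
    using M(2)[of u] that M(1) by (simp add: r0_def pos_less_divide_eq mult.commute)
  define \<phi> where "\<phi> u = \<Phi> (\<l> u)" for u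
  define \<phi>' where "\<phi>' u k = lie (\<Xi> (\<l> u) (\<l> k)) (\<phi> u)" for u k
  have der: "(\<phi> has_derivative \<phi>' u) (at u)" if "norm u < r0" for u
    unfolding \<phi>_def \<phi>'_def
    by (rule has_derivative_compose[OF linear_imp_has_derivative[OF \<l>_lin] \<Phi>_der[OF \<l>_small[OF that]]])
  have \<phi>O: "\<phi> u \<in> ?O" if "norm u < r0" for u
    unfolding \<phi>_def by (rule \<Phi>O[OF \<l>L \<l>_small[OF that]])
  have \<phi>L: "\<phi> u \<in> ?L" if "norm u < r0" for u
    using \<phi>O[OF that] adjoint_orbit_subset[OF X] by blast
  have \<Xi>L': "\<Xi> (\<l> u) (\<l> k) \<in> ?L" if "norm u < r0" for u k
    by (rule \<Xi>L[OF \<l>L \<l>L \<l>_small[OF that]])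
  have \<phi>_cont: "continuous_on (ball 0 r0) \<phi>"
    using der by (auto intro!: continuous_at_imp_continuous_on has_derivative_continuous)
  have \<Xi>_cont': "continuous_on (ball 0 r0) (\<lambda>u. \<Xi> (\<l> u) (\<l> k))" for k
    by (rule continuous_on_compose2[OF \<Xi>_cont linear_continuous_on[OF \<l>_lin[unfolded linear_conv_bounded_linear]]])
      (auto simp: \<l>_small)
  have \<phi>'_cont: "continuous_on (ball 0 r0) (\<lambda>u. \<phi>' u k)" for k
    unfolding \<phi>'_def
    by (rule bounded_bilinear.continuous_on[OF bounded_bilinear_lie \<Xi>_cont' \<phi>_cont])
  have \<phi>'_lin: "linear (\<phi>' u)" if "norm u < r0" for u
    using der[OF that] by (rule has_derivative_linear)
  have \<phi>'0: "\<phi>' 0 k = (\<Sum>i<2 * m. inner k (b i) *\<^sub>R v i)" for k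
  proof -
    have "\<phi>' 0 k = lie (2 *\<^sub>R \<l> k) X"
      by (simp add: \<phi>'_def \<phi>_def \<l>0 \<Phi>0 \<Xi>0)
    also have "2 *\<^sub>R \<l> k = (\<Sum>i<2 * m. inner k (b i) *\<^sub>R \<xi> i)"
      by (simp add: \<l>_def scaleR_sum_right)
    also have "lie \<dots> X = (\<Sum>i<2 * m. inner k (b i) *\<^sub>R v i)"
      by (simp add: bounded_bilinear.sum_left[OF bounded_bilinear_lie] lie_simps \<xi>(2))
    finally show ?thesis .
  qed
  have \<phi>'0b: "\<phi>' 0 (b i) = v i" if "i < 2 * m" for i
  proof -
    have "\<phi>' 0 (b i) = (\<Sum>j<2 * m. if j = i then v i else 0)"
      unfolding \<phi>'0 using that by (intro sum.cong) (auto simp: b_inner)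
    then show ?thesis using that by simp
  qed

  define dens where "dens u = liouville_form ?L (\<phi> u) (map (\<phi>' u) bs)" for u
  obtain C where kill: "\<And>X Y. X \<in> ?L \<Longrightarrow> Y \<in> ?L \<Longrightarrow>
      killing ?L X Y = (\<Sum>c\<in>C. inner (to_coord (lie X (lie Y (of_coord c)))) c)"
    by (rule killing_formula, rule that)
  \<comment> \<open>Values of the symplectic form on the coordinate fields, as a finite sum visibly
    continuous in \<open>u\<close>; the indices themselves stand in for the vectors in
    \<open>wedge_power\<close>.\<close>
  define G where "G u i j = (\<Sum>c\<in>C. inner (to_coord (lie (\<phi> u)
      (lie (lie (\<Xi> (\<l> u) (\<l> (b i))) (\<Xi> (\<l> u) (\<l> (b j)))) (of_coord c)))) c)" for u i j
  have dens: "dens u = wedge_power (G u) m [0..<2 * m]" if u: "norm u < r0" for u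
  proof -
    have "dens u = wedge_power (orbit_omega ?L (\<phi> u)) m (map (\<phi>' u) bs)"
      by (simp add: dens_def liouville_form_def dim_orbit_tangent[OF \<phi>O[OF u]] dimT)
    also have "\<dots> = wedge_power (G u) m [0..<2 * m]"
    proof (rule wedge_power_cong)
      fix i j assume "i < 2 * m" "j < 2 * m"
      then show "orbit_omega ?L (\<phi> u) (map (\<phi>' u) bs ! i) (map (\<phi>' u) bs ! j) =
          G u ([0..<2 * m] ! i) ([0..<2 * m] ! j)"
        by (simp add: bs_def \<phi>'_def orbit_omega_eq \<phi>L u \<Xi>L' kill lie_in_sp_alg G_def)
    qed
    finally show ?thesis .
  qed
  have "continuous_on (ball 0 r0) (\<lambda>u. G u i j)" for i j
    unfolding G_def
    by (intro continuous_on_sum continuous_on_inner continuous_on_const linear_continuous_on_compose[OF _ linear_coord(1)]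
        bounded_bilinear.continuous_on[OF bounded_bilinear_lie] \<phi>_cont \<Xi>_cont')
  then have "continuous_on (ball 0 r0) (\<lambda>u. wedge_power (G u) m [0..<2 * m])"
    unfolding wedge_power_def by (intro continuous_intros) auto
  then have dens_cont: "continuous_on (ball 0 r0) dens"
    by (rule continuous_on_eq) (simp add: dens)
  have dens0: "0 < dens 0"
  proof -
    have "\<phi> 0 = X" by (simp add: \<phi>_def \<l>0 \<Phi>0)
    then have "dens 0 = wedge_power (orbit_omega ?L X) m (map (\<phi>' 0) bs)"
      by (simp add: dens_def liouville_form_def dimT)
    also have "0 < \<dots>"
      by (rule wedge_power_symp_pos) (simp add: bs_def \<phi>'0b v_symp)
    finally show ?thesis .
  qed
  obtain r1 where r1: "0 < r1" "r1 \<le> r0" "\<And>u. norm u < r1 \<Longrightarrow> - dens u < 0"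
    using continuous_less_on_ball[of r0 "\<lambda>u. - dens u" 0] dens_cont dens0 r0 continuous_on_minus by auto

  \<comment> \<open>A left inverse of the derivative at 0 on the parameter space, extended linearly
    to all matrices: it takes \<open>v i\<close> back to \<open>b i\<close>.\<close>
  obtain \<rho> where \<rho>: "linear \<rho>" "\<And>w. w \<in> v ` {..<2 * m} \<Longrightarrow> \<rho> w = b (the_inv_into {..<2 * m} v w)"
    using linear_independent_extend[OF v_ind, of "\<lambda>w. b (the_inv_into {..<2 * m} v w)"] by blast
  have \<rho>v: "\<rho> (v i) = b i" if "i < 2 * m" for i
    using \<rho>(2)[of "v i"] that by (simp add: the_inv_into_f_f[OF v_inj])
  have \<rho>\<phi>': "\<rho> (\<phi>' 0 k) = \<pi> k" for k
    by (simp add: \<phi>'0 \<pi>_def linear_sum[OF \<rho>(1)] linear_scale[OF \<rho>(1)] \<rho>v)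
  \<comment> \<open>\<open>s u\<close> bounds the operator norm of
    \<open>\<rho> \<circ> \<phi>' u - \<pi>\<close> by values on the basis, so continuity of
    \<open>\<phi>'\<close> in each fixed direction makes it small.\<close>
  define s where "s u = (\<Sum>k\<in>Basis. norm (\<rho> (\<phi>' u k) - \<pi> k))" for u
  have "continuous_on (ball 0 r0) s"
    unfolding s_def
    by (intro continuous_on_sum continuous_on_norm continuous_on_diff continuous_on_const
        linear_continuous_on_compose[OF _ \<rho>(1)] \<phi>'_cont)
  moreover have "s 0 < 1 / 2"
    by (simp add: s_def \<rho>\<phi>')
  ultimately obtain r2 where r2: "0 < r2" "r2 \<le> r0" "\<And>u. norm u < r2 \<Longrightarrow> s u < 1 / 2"
    using continuous_less_on_ball[of r0 s "1 / 2"] r0 by auto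
  define r where "r = min r1 r2"
  have r: "0 < r" "\<And>u. norm u < r \<Longrightarrow> norm u < r0" "\<And>u. norm u < r \<Longrightarrow> 0 < dens u"
    "\<And>u. norm u < r \<Longrightarrow> s u < 1 / 2"
    using r1 r2 by (auto simp: r_def)
  have close: "norm (\<rho> (\<phi>' u k) - \<pi> k) \<le> 1 / 2 * norm k" if u: "norm u < r" for u k
  proof -
    have lin: "linear (\<lambda>k. \<rho> (\<phi>' u k) - \<pi> k)"
      using linear_compose[OF \<phi>'_lin[OF r(2)[OF u]] \<rho>(1)] \<pi>_lin
      by (intro linear_compose_sub) (simp_all add: comp_def)
    have "norm (\<rho> (\<phi>' u k) - \<pi> k) = norm (\<Sum>c\<in>Basis. inner k c *\<^sub>R (\<rho> (\<phi>' u c) - \<pi> c))"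
      using linear_sum[OF lin, of "\<lambda>c. inner k c *\<^sub>R c" Basis] linear_scale[OF lin]
      by (simp add: euclidean_representation)
    also have "\<dots> \<le> (\<Sum>c\<in>Basis. norm k * norm (\<rho> (\<phi>' u c) - \<pi> c))"
      by (rule sum_norm_le) (auto intro!: mult_right_mono Basis_le_norm)
    also have "\<dots> = s u * norm k"
      by (simp add: s_def sum_distrib_left mult.commute)
    also have "\<dots> \<le> 1 / 2 * norm k"
      using r(4)[OF u] by (intro mult_right_mono) auto
    finally show ?thesis .
  qed
  define U where "U = ?K \<inter> ball 0 r"
  have inj: "inj_on \<phi> U"
  proof (rule inj_onI)
    fix x y assume xy: "x \<in> U" "y \<in> U" "\<phi> x = \<phi> y"
    \<comment> \<open>With \<open>\<phi> x = \<phi> y\<close> the mean value estimate becomes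
      \<open>|x - y| \<le> |x - y| / 2\<close>.\<close>
    have "norm ((\<rho> (\<phi> x) - \<pi> x) - (\<rho> (\<phi> y) - \<pi> y)) \<le> 1 / 2 * norm (x - y)"
    proof (rule differentiable_bound[of "ball 0 r" "\<lambda>u. \<rho> (\<phi> u) - \<pi> u" "\<lambda>u k. \<rho> (\<phi>' u k) - \<pi> k"])
      fix u :: "quat ^ 'n ^ 'n" assume "u \<in> ball 0 r"
      then have u: "norm u < r" by simp
      show "((\<lambda>u. \<rho> (\<phi> u) - \<pi> u) has_derivative (\<lambda>k. \<rho> (\<phi>' u k) - \<pi> k)) (at u within ball 0 r)"
        by (rule has_derivative_at_withinI, rule has_derivative_diff,
            rule has_derivative_compose[OF der[OF r(2)[OF u]] linear_imp_has_derivative[OF \<rho>(1)]],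
            rule linear_imp_has_derivative[OF \<pi>_lin])
      show "onorm (\<lambda>k. \<rho> (\<phi>' u k) - \<pi> k) \<le> 1 / 2"
        by (rule onorm_bound) (use close[OF u] in auto)
    qed (use xy in \<open>auto simp: U_def\<close>)
    then have "norm (x - y) \<le> 1 / 2 * norm (x - y)"
      using xy \<pi>_id by (simp add: U_def norm_minus_commute)
    then show "x = y" by simp
  qed
  have bij: "bij_betw (\<phi>' u) ?K (orbit_tangent ?L (\<phi> u))" if "norm u < r" for u
  proof -
    have u: "norm u < r0" using r(2)[OF that] .
    have inj: "inj_on (\<phi>' u) ?K"
    proof (rule inj_onI)
      fix x y assume xy: "x \<in> ?K" "y \<in> ?K" "\<phi>' u x = \<phi>' u y"
      then have "x - y \<in> ?K" "\<phi>' u (x - y) = 0"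
        by (auto intro: span_diff simp: linear_diff[OF \<phi>'_lin[OF u]])
      then have "norm (x - y) \<le> 1 / 2 * norm (x - y)"
        using close[OF that, of "x - y"] by (simp add: linear_0[OF \<rho>(1)] \<pi>_id norm_minus_commute)
      then show "x = y" by simp
    qed
    have "\<phi>' u ` ?K \<subseteq> orbit_tangent ?L (\<phi> u)"
      unfolding orbit_tangent_def \<phi>'_def using \<Xi>L'[OF u] by blast
    moreover have "dim (\<phi>' u ` ?K) = 2 * m"
      using dim_image_eq[OF \<phi>'_lin[OF u], of ?K] inj dimK by (simp add: span_span)
    moreover have "subspace (\<phi>' u ` ?K)"
      by (intro linear_subspace_image \<phi>'_lin u subspace_span)
    ultimately have "\<phi>' u ` ?K = orbit_tangent ?L (\<phi> u)"
      using dim_orbit_tangent[OF \<phi>O[OF u]] dimT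
      by (intro subspace_dim_equal subspace_orbit_tangent) auto
    then show ?thesis
      using inj by (simp add: bij_betw_def)
  qed
  have "orbit_param ?L ?O bs U \<phi> \<phi>'"
    unfolding orbit_param_def
  proof (intro conjI ballI)
    show "distinct bs" by fact
    show "set bs \<subseteq> Basis" using b(1) bs(1) by simp
    show "openin (top_of_set ?K) U"
      unfolding U_def by (simp add: openin_open_Int)
    show "inj_on \<phi> U" by fact
    show "\<phi> ` U \<subseteq> ?O"
      using \<phi>O[OF r(2)] by (auto simp: U_def)
    show "(\<phi> has_derivative \<phi>' u) (at u within ?K)" "bij_betw (\<phi>' u) ?K (orbit_tangent ?L (\<phi> u))"
      if "u \<in> U" for u
      using that der[OF r(2)] bij by (auto simp: U_def intro: has_derivative_at_withinI)
    show "continuous_on U (\<lambda>u. \<phi>' u k)" for k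
      using \<phi>'_cont by (rule continuous_on_subset) (use r(2) in \<open>auto simp: U_def\<close>)
  qed
  moreover have "continuous_on U dens"
    using dens_cont by (rule continuous_on_subset) (use r(2) in \<open>auto simp: U_def\<close>)
  ultimately show thesis
    using that[of bs U \<phi> \<phi>' r] r by (auto simp: dens_def U_def)
qed

end

section \<open>The Liouville measure\<close>

text \<open>Scaling a simple function below \<open>f\<close> gives one below \<open>c f\<close>, for
  any \<open>f\<close>. The generality matters because the densities of arbitrary charts are not
  shown to be measurable.\<close>

lemma nn_integral_cmult_le: "c * (\<integral>\<^sup>+ x. f x \<partial>M) \<le> (\<integral>\<^sup>+ x. c * f x \<partial>M)"
  unfolding nn_integral_def SUP_mult_left_ennreal
proof (rule SUP_least)
  fix g assume g: "g \<in> {g. simple_function M g \<and> g \<le> f}"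
  then have "c * integral\<^sup>S M g = (\<integral>\<^sup>Sx. c * g x \<partial>M)"
    by simp
  also have "\<dots> \<le> (SUP g\<in>{g. simple_function M g \<and> g \<le> (\<lambda>x. c * f x)}. integral\<^sup>S M g)"
    using g by (intro SUP_upper) (auto simp: le_fun_def intro: mult_left_mono)
  finally show "c * integral\<^sup>S M g \<le> (SUP g\<in>{g. simple_function M g \<and> g \<le> (\<lambda>x. c * f x)}. integral\<^sup>S M g)" .
qed

text \<open>The reverse inequality is the previous one for the factor \<open>1 / c\<close> and the
  function \<open>c f\<close>.\<close>

lemma nn_integral_cmult_positive:
  assumes "0 < c"
  shows "(\<integral>\<^sup>+ x. ennreal c * f x \<partial>M) = ennreal c * (\<integral>\<^sup>+ x. f x \<partial>M)"
proof (rule antisym[OF _ nn_integral_cmult_le])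
  have inv: "ennreal c * (ennreal (inverse c) * a) = a" "ennreal (inverse c) * (ennreal c * a) = a" for a
    using assms by (simp_all add: ennreal_mult[symmetric] flip: mult.assoc)
  have "ennreal (inverse c) * (\<integral>\<^sup>+ x. ennreal c * f x \<partial>M) \<le> (\<integral>\<^sup>+ x. f x \<partial>M)"
    using nn_integral_cmult_le[of "ennreal (inverse c)" M "\<lambda>x. ennreal c * f x"] by (simp add: inv)
  then have "ennreal c * (ennreal (inverse c) * (\<integral>\<^sup>+ x. ennreal c * f x \<partial>M)) \<le> ennreal c * (\<integral>\<^sup>+ x. f x \<partial>M)"
    by (rule mult_left_mono) simp
  then show "(\<integral>\<^sup>+ x. ennreal c * f x \<partial>M) \<le> ennreal c * (\<integral>\<^sup>+ x. f x \<partial>M)"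
    by (simp add: inv)
qed

lemma measure_space_cmult:
  assumes "measure_space \<Omega> A \<mu>"
  shows "measure_space \<Omega> A (\<lambda>X. (c :: ennreal) * \<mu> X)"
  using assms by (auto simp: measure_space_def positive_def countably_additive_def)

text \<open>
  Without a measurability assumption on \<open>f\<close>, both sides are \<open>0\<close> when \<open>A \<mapsto> \<integral>\<^sub>A f\<close> is not a measure.
\<close>

lemma emeasure_density_cmult:
  assumes "0 < c"
  shows "emeasure (density M (\<lambda>x. ennreal c * f x)) A = ennreal c * emeasure (density M f) A"
proof -
  let ?\<nu> = "\<lambda>f A. \<integral>\<^sup>+ x. f x * indicator A x \<partial>M"
  have \<nu>1: "(\<integral>\<^sup>+ x. ennreal c * f x * indicator B x \<partial>M) = ennreal c * (\<integral>\<^sup>+ x. f x * indicator B x \<partial>M)" for B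
    by (simp add: mult.assoc nn_integral_cmult_positive[OF assms])
  then have \<nu>: "?\<nu> (\<lambda>x. ennreal c * f x) = (\<lambda>A. ennreal c * ?\<nu> f A)"
    by simp
  have "ennreal (inverse c) * (ennreal c * a) = a" for a
    using assms by (simp add: ennreal_mult[symmetric] flip: mult.assoc)
  then have "measure_space (space M) (sets M) (?\<nu> (\<lambda>x. ennreal c * f x)) \<longleftrightarrow> measure_space (space M) (sets M) (?\<nu> f)"
    using measure_space_cmult[of "space M" "sets M" "?\<nu> f" "ennreal c"]
      measure_space_cmult[of "space M" "sets M" "\<lambda>A. ennreal c * ?\<nu> f A" "ennreal (inverse c)"]
    unfolding \<nu> by auto
  then show ?thesis
    unfolding density_def emeasure_measure_of_conv by (simp add: sets.sigma_sets_eq \<nu>1)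
qed

text \<open>Equality at every point of the space, rather than almost everywhere, makes this valid
  for non-measurable densities.\<close>

lemma density_cong_space:
  assumes "\<And>x. x \<in> space M \<Longrightarrow> f x = g x"
  shows "density M f = density M g"
proof -
  have "(\<integral>\<^sup>+ x. f x * indicator A x \<partial>M) = (\<integral>\<^sup>+ x. g x * indicator A x \<partial>M)" for A
    by (rule nn_integral_cong) (simp add: assms)
  then show ?thesis by (simp add: density_def)
qed

lemma wedge_power_cmult:
  assumes "\<And>i j. i < 2 * m \<Longrightarrow> j < 2 * m \<Longrightarrow> \<omega> (vs ! i) (vs ! j) = c * \<omega>' (ws ! i) (ws ! j)"
  shows "wedge_power \<omega> m vs = c ^ m * wedge_power \<omega>' m ws"
proof -
  have "wedge_power \<omega> m vs = wedge_power (\<lambda>x y. c * \<omega>' x y) m ws"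
    using assms by (rule wedge_power_cong)
  also have "\<dots> = c ^ m * wedge_power \<omega>' m ws"
    by (simp add: wedge_power_def prod.distrib sum_distrib_left ac_simps)
  finally show ?thesis .
qed

lemma sets_lborel_coord [simp]: "sets (lborel_coord bs) = sets borel"
  by (simp add: lborel_coord_def)

lemma sets_patch_measure [simp]: "sets (patch_measure L bs U \<phi> \<phi>') = sets borel"
  by (simp add: patch_measure_def)

text \<open>A chart must exist: the supremum of the empty family is the bottom measure, whose
  sigma-algebra is not the Borel one.\<close>

lemma sets_liouville_measure:
  assumes "orbit_param L \<O> bs U \<phi> \<phi>'"
  shows "sets (liouville_measure L \<O>) = sets borel"
  unfolding liouville_measure_def by (rule sets_SUP) (use assms in auto)

lemma patch_measure_le_liouville_measure:
  assumes P: "orbit_param L \<O> bs U \<phi> \<phi>'"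
  shows "emeasure (patch_measure L bs U \<phi> \<phi>') A \<le> emeasure (liouville_measure L \<O>) A"
proof (rule le_measureD3)
  show "patch_measure L bs U \<phi> \<phi>' \<le> liouville_measure L \<O>"
    unfolding liouville_measure_def using P by (intro SUP_upper2[of "(bs, U, \<phi>, \<phi>')"]) auto
qed (simp add: sets_liouville_measure[OF P])

lemma lborel_coord_open_pos:
  fixes bs :: "'a::euclidean_space list"
  assumes bs: "set bs \<subseteq> Basis" and r: "0 < r"
  shows "0 < emeasure (lborel_coord bs) (span (set bs) \<inter> ball 0 r)"
proof -
  interpret product_sigma_finite "\<lambda>_ :: 'a. lborel :: real measure"
    by standard
  let ?P = "\<Pi>\<^sub>M b\<in>set bs. (lborel :: real measure)"
  let ?f = "\<lambda>x. \<Sum>b\<in>set bs. x b *\<^sub>R b :: 'a"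
  \<comment> \<open>The cube of half-side \<open>\<delta>\<close> maps into the ball, since the norm
    of the sum is at most \<open>card (set bs)\<close> times \<open>\<delta>\<close>; the
    \<open>+ 1\<close> makes this strictly less than \<open>r\<close> and covers the empty
    list.\<close>
  define \<delta> where "\<delta> = r / (real (card (set bs)) + 1)"
  have \<delta>: "0 < \<delta>" using r by (simp add: \<delta>_def)
  let ?B = "Pi\<^sub>E (set bs) (\<lambda>_. {- \<delta><..<\<delta>})"
  have meas: "?f \<in> ?P \<rightarrow>\<^sub>M borel"
    by measurable
  have borel: "span (set bs) \<inter> ball 0 r \<in> sets borel"
    by (intro sets.Int borel_closed borel_open closed_span) auto
  have "?B \<subseteq> ?f -` (span (set bs) \<inter> ball 0 r) \<inter> space ?P"
  proof
    fix x assume x: "x \<in> ?B"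
    then have xb: "\<bar>x b\<bar> \<le> \<delta>" if "b \<in> set bs" for b
      using that by (fastforce simp: PiE_iff abs_le_iff)
    have "norm (?f x) \<le> (\<Sum>b\<in>set bs. \<delta>)"
      by (rule sum_norm_le) (use xb bs in \<open>auto simp: subset_iff\<close>)
    also have "\<dots> < r"
      using r by (simp add: \<delta>_def field_simps)
    finally have "?f x \<in> ball 0 r" by simp
    moreover have "?f x \<in> span (set bs)"
      by (intro span_sum span_scale span_base)
    ultimately show "x \<in> ?f -` (span (set bs) \<inter> ball 0 r) \<inter> space ?P"
      using x by (auto simp: space_PiM PiE_iff)
  qed
  then have "emeasure ?P ?B \<le> emeasure (lborel_coord bs) (span (set bs) \<inter> ball 0 r)"
    unfolding lborel_coord_def emeasure_distr[OF meas borel]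
    by (rule emeasure_mono) (use measurable_sets[OF meas borel] in simp)
  moreover have "emeasure ?P ?B = (\<Prod>b\<in>set bs. ennreal (2 * \<delta>))"
    using \<delta> by (subst emeasure_PiM) auto
  moreover have "0 < (\<Prod>b\<in>set bs. ennreal (2 * \<delta>))"
    using \<delta> by (simp add: ennreal_zero_less_mult_iff power_eq_0_iff zero_less_iff_neq_zero)
  ultimately show ?thesis by simp
qed

section \<open>Behaviour of charts and of the Liouville measure under scaling\<close>

context quat_form
begin

lemma orbit_tangent_scaleR:
  assumes "c \<noteq> 0"
  shows "orbit_tangent (sp_alg h) (c *\<^sub>R y) = orbit_tangent (sp_alg h) y"
proof (intro subset_antisym subsetI)
  fix a assume "a \<in> orbit_tangent (sp_alg h) (c *\<^sub>R y)"
  then obtain A where "A \<in> sp_alg h" "a = lie (c *\<^sub>R A) y"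
    by (auto simp: orbit_tangent_def lie_simps)
  then show "a \<in> orbit_tangent (sp_alg h) y"
    using sp_alg_ops(3) by (auto simp: orbit_tangent_def)
next
  fix a assume "a \<in> orbit_tangent (sp_alg h) y"
  then obtain A where A: "A \<in> sp_alg h" "a = lie A y"
    by (auto simp: orbit_tangent_def)
  then have "a = lie ((1 / c) *\<^sub>R A) (c *\<^sub>R y)"
    using assms by (simp add: lie_simps)
  then show "a \<in> orbit_tangent (sp_alg h) (c *\<^sub>R y)"
    using sp_alg_ops(3)[OF A(1)] by (auto simp: orbit_tangent_def)
qed

text \<open>The vector \<open>c [A,y]\<close> at \<open>c y\<close> is \<open>[A, c y]\<close>,
  represented by the same \<open>A\<close>. In \<open>\<kappa>(y,[A,B])\<close> only the base point
  is scaled, so \<omega> gains a single factor \<open>c\<close>, not \<open>c^2\<close>.\<close>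

lemma liouville_form_scaleR:
  assumes y: "y \<in> sp_alg h" and c: "c \<noteq> 0" and vs: "set vs \<subseteq> orbit_tangent (sp_alg h) y"
    "length vs = dim (orbit_tangent (sp_alg h) y)"
  shows "liouville_form (sp_alg h) (c *\<^sub>R y) (map (\<lambda>v. c *\<^sub>R v) vs) =
    c ^ (dim (orbit_tangent (sp_alg h) y) div 2) * liouville_form (sp_alg h) y vs"
  unfolding liouville_form_def orbit_tangent_scaleR[OF c]
proof (rule wedge_power_cmult)
  let ?m = "dim (orbit_tangent (sp_alg h) y) div 2"
  fix i j assume "i < 2 * ?m" "j < 2 * ?m"
  then have ij: "i < length vs" "j < length vs"
    using vs(2) by auto
  then have "vs ! i \<in> orbit_tangent (sp_alg h) y" "vs ! j \<in> orbit_tangent (sp_alg h) y"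
    using vs(1) nth_mem by blast+
  then obtain A B where AB: "A \<in> sp_alg h" "B \<in> sp_alg h" "vs ! i = lie A y" "vs ! j = lie B y"
    by (auto simp: orbit_tangent_def)
  have "c *\<^sub>R lie A y = lie A (c *\<^sub>R y)" for A
    by (simp add: lie_simps)
  then show "orbit_omega (sp_alg h) (c *\<^sub>R y) (map (\<lambda>v. c *\<^sub>R v) vs ! i) (map (\<lambda>v. c *\<^sub>R v) vs ! j) =
      c * orbit_omega (sp_alg h) y (vs ! i) (vs ! j)"
    using ij AB y by (simp add: orbit_omega_eq sp_alg_ops killing_scaleR lie_in_sp_alg)
qed

lemma orbit_param_scaleR:
  assumes P: "orbit_param (sp_alg h) \<O> bs U \<phi> \<phi>'" and c: "c \<noteq> 0" and \<O>: "\<And>y. y \<in> \<O> \<Longrightarrow> c *\<^sub>R y \<in> \<O>"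
  shows "orbit_param (sp_alg h) \<O> bs U (\<lambda>u. c *\<^sub>R \<phi> u) (\<lambda>u k. c *\<^sub>R \<phi>' u k)"
  unfolding orbit_param_def
proof (intro conjI ballI)
  show "distinct bs" "set bs \<subseteq> Basis" "openin (top_of_set (span (set bs))) U"
    using P by (auto simp: orbit_param_def)
  show "inj_on (\<lambda>u. c *\<^sub>R \<phi> u) U" "(\<lambda>u. c *\<^sub>R \<phi> u) ` U \<subseteq> \<O>"
    using P c \<O> by (auto simp: orbit_param_def inj_on_def)
  show "continuous_on U (\<lambda>u. c *\<^sub>R \<phi>' u b)" if "b \<in> set bs" for b
    using P that by (auto simp: orbit_param_def intro!: continuous_on_scaleR)
  fix u assume u: "u \<in> U"
  have der: "(\<phi> has_derivative \<phi>' u) (at u within span (set bs))"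
    and bij: "bij_betw (\<phi>' u) (span (set bs)) (orbit_tangent (sp_alg h) (\<phi> u))"
    using P u by (auto simp: orbit_param_def)
  show "((\<lambda>u. c *\<^sub>R \<phi> u) has_derivative (\<lambda>k. c *\<^sub>R \<phi>' u k)) (at u within span (set bs))"
    using der by (rule has_derivative_scaleR_right)
  have "bij_betw (\<lambda>v. c *\<^sub>R v) (orbit_tangent (sp_alg h) (\<phi> u)) (orbit_tangent (sp_alg h) (\<phi> u))"
    by (rule bij_betw_byWitness[where f' = "\<lambda>v. (1 / c) *\<^sub>R v"])
      (use c subspace_orbit_tangent in \<open>auto intro: subspace_scale\<close>)
  then have "bij_betw (\<lambda>k. c *\<^sub>R \<phi>' u k) (span (set bs)) (orbit_tangent (sp_alg h) (\<phi> u))"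
    using bij_betw_trans[OF bij] by (simp add: comp_def)
  then show "bij_betw (\<lambda>k. c *\<^sub>R \<phi>' u k) (span (set bs)) (orbit_tangent (sp_alg h) (c *\<^sub>R \<phi> u))"
    by (simp add: orbit_tangent_scaleR[OF c])
qed

lemma orbit_param_continuous:
  assumes "orbit_param L \<O> bs U \<phi> \<phi>'"
  shows "continuous_on U \<phi>" "U \<in> sets borel"
proof -
  have U: "U \<subseteq> span (set bs)" "openin (top_of_set (span (set bs))) U"
    using assms by (auto simp: orbit_param_def dest: openin_imp_subset)
  show "continuous_on U \<phi>"
    unfolding continuous_on_eq_continuous_within
  proof
    fix u assume "u \<in> U"
    then have "(\<phi> has_derivative \<phi>' u) (at u within U)"
      using assms U(1) by (auto simp: orbit_param_def intro: has_derivative_subset)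
    then show "continuous (at u within U) \<phi>"
      by (rule has_derivative_continuous)
  qed
  obtain S where "open S" "U = span (set bs) \<inter> S"
    using U(2) by (auto simp: openin_open)
  then show "U \<in> sets borel"
    by (auto intro!: sets.Int borel_closed borel_open closed_span)
qed

lemma measurable_restrict_lborel_coord:
  fixes f :: "'b::euclidean_space \<Rightarrow> 'c::topological_space"
  assumes "continuous_on U f"
  shows "f \<in> borel_measurable (restrict_space (lborel_coord bs) U)"
  using borel_measurable_continuous_on_restrict[OF assms]
    measurable_cong_sets[OF sets_restrict_space_cong[OF sets_lborel_coord] refl] by blast

text \<open>Both patches use the same domain and Lebesgue measure; only the density changes, by the
  factor \<open>|c|^(d/2)\<close>. The length of \<open>bs\<close> equals \<open>d\<close> because
  the derivative is an isomorphism onto the tangent space.\<close>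

lemma emeasure_patch_scaleR:
  assumes P: "orbit_param (sp_alg h) \<O> bs U \<phi> \<phi>'" and c: "c \<noteq> 0" and \<O>: "\<O> \<subseteq> sp_alg h"
    and dim: "\<And>y. y \<in> \<O> \<Longrightarrow> dim (orbit_tangent (sp_alg h) y) = d" and A: "A \<in> sets borel"
  shows "emeasure (patch_measure (sp_alg h) bs U (\<lambda>u. c *\<^sub>R \<phi> u) (\<lambda>u k. c *\<^sub>R \<phi>' u k)) A =
    ennreal (\<bar>c\<bar> ^ (d div 2)) * emeasure (patch_measure (sp_alg h) bs U \<phi> \<phi>') ((\<lambda>y. c *\<^sub>R y) -` A)"
proof -
  let ?M = "restrict_space (lborel_coord bs) U"
  let ?f = "\<lambda>u. ennreal \<bar>liouville_form (sp_alg h) (\<phi> u) (map (\<phi>' u) bs)\<bar>"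
  let ?g = "\<lambda>u. ennreal \<bar>liouville_form (sp_alg h) (c *\<^sub>R \<phi> u) (map (\<lambda>k. c *\<^sub>R \<phi>' u k) bs)\<bar>"
  have spaceM: "space ?M = U"
    by (simp add: space_restrict_space lborel_coord_def)
  have g: "?g u = ennreal (\<bar>c\<bar> ^ (d div 2)) * ?f u" if u: "u \<in> U" for u
  proof -
    have \<phi>u: "\<phi> u \<in> \<O>" "\<phi> u \<in> sp_alg h"
      using P u \<O> by (auto simp: orbit_param_def)
    have der: "(\<phi> has_derivative \<phi>' u) (at u within span (set bs))"
      and bij: "bij_betw (\<phi>' u) (span (set bs)) (orbit_tangent (sp_alg h) (\<phi> u))"
      and bs: "distinct bs" "set bs \<subseteq> Basis"
      using P u by (auto simp: orbit_param_def)
    have set_bs: "set (map (\<phi>' u) bs) \<subseteq> orbit_tangent (sp_alg h) (\<phi> u)"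
      using bij span_base by (fastforce simp: bij_betw_def)
    have len_bs: "length (map (\<phi>' u) bs) = dim (orbit_tangent (sp_alg h) (\<phi> u))"
    proof -
      have ind: "independent (set bs)"
        using bs(2) independent_Basis independent_mono by blast
      have "dim (\<phi>' u ` span (set bs)) = dim (span (set bs))"
        using bij has_derivative_linear[OF der] by (intro dim_image_eq) (auto simp: bij_betw_def span_span)
      moreover have "\<phi>' u ` span (set bs) = orbit_tangent (sp_alg h) (\<phi> u)"
        using bij by (simp add: bij_betw_def)
      moreover have "dim (span (set bs)) = length bs"
        using dim_span_eq_card_independent[OF ind] bs(1) by (simp add: distinct_card)
      ultimately show ?thesis by simp
    qed
    have "liouville_form (sp_alg h) (c *\<^sub>R \<phi> u) (map (\<lambda>v. c *\<^sub>R v) (map (\<phi>' u) bs)) =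
        c ^ (d div 2) * liouville_form (sp_alg h) (\<phi> u) (map (\<phi>' u) bs)"
      using liouville_form_scaleR[OF \<phi>u(2) c set_bs len_bs] unfolding dim[OF \<phi>u(1)] .
    then show ?thesis
      by (simp add: comp_def abs_mult power_abs ennreal_mult)
  qed
  have dens: "density ?M ?g = density ?M (\<lambda>u. ennreal (\<bar>c\<bar> ^ (d div 2)) * ?f u)"
    by (rule density_cong_space) (simp add: spaceM g)
  have \<phi>_cont: "continuous_on U \<phi>"
    using orbit_param_continuous[OF P] by blast
  have m1: "\<phi> \<in> borel_measurable (density ?M ?f)"
    using measurable_restrict_lborel_coord[OF \<phi>_cont] by simp
  have m2: "(\<lambda>u. c *\<^sub>R \<phi> u) \<in> borel_measurable (density ?M ?g)"
    using measurable_restrict_lborel_coord[OF continuous_on_scaleR[OF continuous_on_const \<phi>_cont]] by simp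
  have A': "(\<lambda>y. c *\<^sub>R y) -` A \<in> sets borel"
    using measurable_sets[of "\<lambda>y. c *\<^sub>R y" borel borel A] A by simp
  show ?thesis
    unfolding patch_measure_def emeasure_distr[OF m1 A'] emeasure_distr[OF m2 A]
    unfolding dens using c by (simp add: emeasure_density_cmult spaceM vimage_def)
qed

text \<open>Every chart \<open>\<phi>\<close> is \<open>c\<close> times the chart
  \<open>\<phi> / c\<close>, whose patch measure lies below the Liouville measure. Hence each patch
  lies below the scaled image measure, and so does the supremum.\<close>

lemma liouville_measure_scaleR_le:
  assumes P: "orbit_param (sp_alg h) \<O> bs0 U0 \<phi>0 \<phi>0'" and c: "c \<noteq> 0" and \<O>: "\<O> \<subseteq> sp_alg h"
    and cone: "\<And>t y. t \<noteq> 0 \<Longrightarrow> y \<in> \<O> \<Longrightarrow> t *\<^sub>R y \<in> \<O>"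
    and dim: "\<And>y. y \<in> \<O> \<Longrightarrow> dim (orbit_tangent (sp_alg h) y) = d"
  shows "liouville_measure (sp_alg h) \<O> \<le>
    scale_measure (ennreal (\<bar>c\<bar> ^ (d div 2))) (distr (liouville_measure (sp_alg h) \<O>) borel (\<lambda>y. c *\<^sub>R y))"
proof -
  let ?I = "{(bs, U, \<phi>, \<phi>'). orbit_param (sp_alg h) \<O> bs U \<phi> \<phi>'}"
  let ?pm = "\<lambda>(bs, U, \<phi>, \<phi>'). patch_measure (sp_alg h) bs U \<phi> \<phi>'"
  let ?\<mu> = "liouville_measure (sp_alg h) \<O>"
  have \<mu>: "?\<mu> = (SUP i\<in>?I. ?pm i)"
    by (simp add: liouville_measure_def)
  have sets: "sets ?\<mu> = sets borel"
    by (rule sets_liouville_measure[OF P])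
  let ?\<nu> = "scale_measure (ennreal (\<bar>c\<bar> ^ (d div 2))) (distr ?\<mu> borel (\<lambda>y. c *\<^sub>R y))"
  have "?pm i \<le> ?\<nu>" if i_in: "i \<in> ?I" for i
  proof -
    obtain bs U \<phi> \<phi>' where i: "i = (bs, U, \<phi>, \<phi>')" "orbit_param (sp_alg h) \<O> bs U \<phi> \<phi>'"
      using i_in by (cases i) auto
    define \<psi> \<psi>' where "\<psi> u = (1 / c) *\<^sub>R \<phi> u" and "\<psi>' u k = (1 / c) *\<^sub>R \<phi>' u k" for u k
    have \<psi>: "orbit_param (sp_alg h) \<O> bs U \<psi> \<psi>'"
      unfolding \<psi>_def \<psi>'_def using c by (intro orbit_param_scaleR[OF i(2)] cone) auto
    have \<phi>: "(\<lambda>u. c *\<^sub>R \<psi> u) = \<phi>" "(\<lambda>u k. c *\<^sub>R \<psi>' u k) = \<phi>'"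
      using c by (simp_all add: \<psi>_def \<psi>'_def)
    have "emeasure (patch_measure (sp_alg h) bs U \<phi> \<phi>') A \<le> emeasure ?\<nu> A" if A: "A \<in> sets borel" for A
    proof -
      have "emeasure (patch_measure (sp_alg h) bs U \<phi> \<phi>') A =
          ennreal (\<bar>c\<bar> ^ (d div 2)) * emeasure (patch_measure (sp_alg h) bs U \<psi> \<psi>') ((\<lambda>y. c *\<^sub>R y) -` A)"
        using emeasure_patch_scaleR[OF \<psi> c \<O> dim A] by (simp add: \<phi>)
      also have "\<dots> \<le> ennreal (\<bar>c\<bar> ^ (d div 2)) * emeasure ?\<mu> ((\<lambda>y. c *\<^sub>R y) -` A)"
        by (intro mult_left_mono patch_measure_le_liouville_measure[OF \<psi>]) simp
      also have "\<dots> = emeasure ?\<nu> A"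
      proof -
        have "(\<lambda>y. c *\<^sub>R y) \<in> ?\<mu> \<rightarrow>\<^sub>M borel"
          by (subst measurable_cong_sets[OF sets refl]) simp
        moreover have "space ?\<mu> = UNIV"
          using sets_eq_imp_space_eq[OF sets] by simp
        ultimately show ?thesis
          using A by (simp add: emeasure_distr)
      qed
      finally show ?thesis .
    qed
    then show ?thesis
      by (simp add: i(1) le_measure)
  qed
  then show "?\<mu> \<le> ?\<nu>"
    unfolding \<mu> by (rule SUP_least)
qed

text \<open>A positive density on a ball of positive Lebesgue measure cannot integrate to 0;
  continuity supplies its measurability.\<close>

lemma patch_measure_pos:
  assumes P: "orbit_param (sp_alg h) \<O> bs U \<phi> \<phi>'" and r: "0 < r" "U = span (set bs) \<inter> ball 0 r"
    and cont: "continuous_on U (\<lambda>u. liouville_form (sp_alg h) (\<phi> u) (map (\<phi>' u) bs))"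
    and pos: "\<And>u. u \<in> U \<Longrightarrow> 0 < liouville_form (sp_alg h) (\<phi> u) (map (\<phi>' u) bs)"
  shows "0 < emeasure (patch_measure (sp_alg h) bs U \<phi> \<phi>') UNIV"
proof -
  let ?M = "restrict_space (lborel_coord bs) U"
  let ?f = "\<lambda>u. ennreal \<bar>liouville_form (sp_alg h) (\<phi> u) (map (\<phi>' u) bs)\<bar>"
  have spaceM: "space ?M = U"
    by (simp add: space_restrict_space lborel_coord_def)
  have f: "?f \<in> borel_measurable ?M"
    using measurable_restrict_lborel_coord[OF cont] by measurable
  have \<phi>: "\<phi> \<in> borel_measurable (density ?M ?f)"
    using measurable_restrict_lborel_coord[OF orbit_param_continuous(1)[OF P]] by simp
  have U: "U \<in> sets (lborel_coord bs)"
    using orbit_param_continuous(2)[OF P] by simp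
  have "emeasure (patch_measure (sp_alg h) bs U \<phi> \<phi>') UNIV = emeasure (density ?M ?f) (space ?M)"
    unfolding patch_measure_def by (subst emeasure_distr[OF \<phi>]) auto
  also have "\<dots> = (\<integral>\<^sup>+ u. ?f u * indicator (space ?M) u \<partial>?M)"
    using f by (rule emeasure_density) simp
  also have "\<dots> = (\<integral>\<^sup>+ u. ?f u \<partial>?M)"
    by (rule nn_integral_cong) simp
  also have "\<dots> \<noteq> 0"
  proof
    assume "(\<integral>\<^sup>+ u. ?f u \<partial>?M) = 0"
    then have "emeasure ?M {u \<in> space ?M. ?f u \<noteq> 0} = 0"
      using nn_integral_0_iff[OF f] by simp
    moreover have "{u \<in> space ?M. ?f u \<noteq> 0} = U"
      using pos by (force simp: spaceM)
    ultimately have "emeasure (lborel_coord bs) U = 0"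
      using U by (simp add: emeasure_restrict_space lborel_coord_def)
    moreover have "0 < emeasure (lborel_coord bs) U"
      unfolding r(2) using P r(1) by (intro lborel_coord_open_pos) (auto simp: orbit_param_def)
    ultimately show False by simp
  qed
  finally show ?thesis
    by (simp add: zero_less_iff_neq_zero)
qed

section \<open>Absence of Gibbs states on nonzero nilpotent orbits\<close>

lemma nilpotent_orbit_no_gibbs:
  assumes O: "nilpotent_orbit h \<O>" and nz: "\<O> \<noteq> {0}"
  shows "\<not> admits_gibbs_states (sp_alg h) \<O>"
proof
  assume "admits_gibbs_states (sp_alg h) \<O>"
  then obtain \<beta> where \<beta>: "linear \<beta>" and fin: "(\<integral>\<^sup>+ y. ennreal (exp (- \<beta> y)) \<partial>liouville_measure (sp_alg h) \<O>) < \<infinity>"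
    by (auto simp: admits_gibbs_states_def partition_function_def)
  let ?\<mu> = "liouville_measure (sp_alg h) \<O>"
  obtain X where X: "X \<in> sp_alg h" and OX: "\<O> = adjoint_orbit h X"
    using O by (auto simp: nilpotent_orbit_def nilpotent_elt_def)
  have sub: "\<O> \<subseteq> sp_alg h"
    unfolding OX using X by (rule adjoint_orbit_subset)
  have cone: "t *\<^sub>R y \<in> \<O>" if "t \<noteq> 0" "y \<in> \<O>" for t y
    using nilpotent_orbit_scaleR[OF O] that by blast
  obtain m where m: "dim (orbit_tangent (sp_alg h) X) = 2 * m"
    using orbit_tangent_symplectic_basis[OF X] by metis
  have dim: "dim (orbit_tangent (sp_alg h) y) = 2 * m" if "y \<in> \<O>" for y
    using that dim_orbit_tangent m unfolding OX by simp
  have "X \<noteq> 0"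
  proof
    assume "X = 0"
    moreover have "mat 1 \<in> Sp_group h"
      by (rule Sp_groupI) simp
    ultimately have "\<O> = {0}"
      by (auto simp: OX adjoint_orbit_def)
    with nz show False by simp
  qed
  \<comment> \<open>With a zero tangent space \<open>X\<close> would be central, hence 0; so the
    scaling exponent \<open>m\<close> is positive.\<close>
  have "m \<noteq> 0"
  proof
    assume "m = 0"
    then have "orbit_tangent (sp_alg h) X \<subseteq> {0}"
      using m by (simp add: dim_eq_0)
    then have "lie X A = 0" if "A \<in> sp_alg h" for A
      using that lie_anticommute[of X A] by (auto simp: orbit_tangent_def)
    then show False
      using sp_alg_center[OF X] \<open>X \<noteq> 0\<close> by blast
  qed
  obtain bs U \<phi> \<phi>' r where P: "orbit_param (sp_alg h) (adjoint_orbit h X) bs U \<phi> \<phi>'"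
    and r: "0 < r" "U = span (set bs) \<inter> ball 0 r"
    "continuous_on U (\<lambda>u. liouville_form (sp_alg h) (\<phi> u) (map (\<phi>' u) bs))"
    "\<And>u. u \<in> U \<Longrightarrow> 0 < liouville_form (sp_alg h) (\<phi> u) (map (\<phi>' u) bs)"
    by (rule exists_patch[OF X], rule that)
  note P = P[folded OX]
  note le = liouville_measure_scaleR_le[OF P _ sub cone dim]
  have sets: "sets ?\<mu> = sets borel"
    by (rule sets_liouville_measure[OF P])
  have space: "space ?\<mu> = UNIV"
    using sets_eq_imp_space_eq[OF sets] by simp
  have meas: "borel_measurable ?\<mu> = borel_measurable borel"
    by (rule measurable_cong_sets[OF sets refl])
  have scale: "(\<lambda>y. c *\<^sub>R y) \<in> ?\<mu> \<rightarrow>\<^sub>M borel" for c :: real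
    unfolding meas by simp
  have \<beta>_meas: "\<beta> \<in> borel_measurable borel"
    using \<beta> by (simp add: borel_measurable_continuous_onI linear_continuous_on linear_conv_bounded_linear)
  \<comment> \<open>The case \<open>c = -1\<close>, where the factor \<open>|c|^m\<close> is
    1.\<close>
  have "(\<integral>\<^sup>+ y. ennreal (exp (\<beta> y)) \<partial>?\<mu>) \<le> (\<integral>\<^sup>+ y. ennreal (exp (\<beta> y)) \<partial>distr ?\<mu> borel (\<lambda>y. (- 1) *\<^sub>R y))"
    using le[of "- 1"] sets by (intro nn_integral_mono_measure) simp_all
  also have "\<dots> = (\<integral>\<^sup>+ y. ennreal (exp (- \<beta> y)) \<partial>?\<mu>)"
    using \<beta>_meas by (subst nn_integral_distr[OF scale]) (simp_all add: linear_neg[OF \<beta>])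
  finally have fin': "(\<integral>\<^sup>+ y. ennreal (exp (\<beta> y)) \<partial>?\<mu>) < \<infinity>"
    using fin by (rule le_less_trans)
  have "emeasure ?\<mu> UNIV = (\<integral>\<^sup>+ y. 1 \<partial>?\<mu>)"
    using space by simp
  also have "\<dots> \<le> (\<integral>\<^sup>+ y. ennreal (exp (- \<beta> y)) + ennreal (exp (\<beta> y)) \<partial>?\<mu>)"
  proof (rule nn_integral_mono)
    fix y
    have "1 \<le> exp (- \<beta> y) + exp (\<beta> y)"
      by (cases "0 \<le> \<beta> y") (simp_all add: add_increasing add_increasing2)
    then show "1 \<le> ennreal (exp (- \<beta> y)) + ennreal (exp (\<beta> y))"
      by (simp flip: ennreal_plus ennreal_1)
  qed
  also have "\<dots> = (\<integral>\<^sup>+ y. ennreal (exp (- \<beta> y)) \<partial>?\<mu>) + (\<integral>\<^sup>+ y. ennreal (exp (\<beta> y)) \<partial>?\<mu>)"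
    by (rule nn_integral_add) (use \<beta>_meas in \<open>simp_all add: meas\<close>)
  also have "\<dots> < \<infinity>"
    using fin fin' by simp
  finally have finite: "emeasure ?\<mu> UNIV < \<infinity>" .
  \<comment> \<open>The case \<open>c = 1/2\<close>: an image measure has the same total mass, so
    only the factor \<open>2^(-m)\<close> remains, and a finite mass must then be 0.\<close>
  have "emeasure ?\<mu> UNIV \<le> emeasure (scale_measure (ennreal ((1 / 2) ^ m)) (distr ?\<mu> borel (\<lambda>y. (1 / 2 :: real) *\<^sub>R y))) UNIV"
    using le_measureD3[OF le[of "1 / 2"]] sets by simp
  also have "\<dots> = ennreal ((1 / 2) ^ m) * emeasure ?\<mu> UNIV"
    using space by (simp add: emeasure_distr[OF scale])
  also have "\<dots> \<le> ennreal (1 / 2) * emeasure ?\<mu> UNIV"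
  proof (intro mult_right_mono ennreal_leI)
    show "(1 / 2 :: real) ^ m \<le> 1 / 2"
      using \<open>m \<noteq> 0\<close> power_decreasing[of 1 m "1 / 2 :: real"] by simp
  qed simp
  finally have half: "emeasure ?\<mu> UNIV \<le> ennreal (1 / 2) * emeasure ?\<mu> UNIV" .
  obtain s where s: "0 \<le> s" "emeasure ?\<mu> UNIV = ennreal s"
    using finite by (cases "emeasure ?\<mu> UNIV") auto
  then have "ennreal s \<le> ennreal (1 / 2 * s)"
    using half by (subst ennreal_mult) simp_all
  then have "emeasure ?\<mu> UNIV = 0"
    using s by simp
  moreover have "0 < emeasure (patch_measure (sp_alg h) bs U \<phi> \<phi>') UNIV"
    by (rule patch_measure_pos[OF P r])
  moreover have "emeasure (patch_measure (sp_alg h) bs U \<phi> \<phi>') UNIV \<le> emeasure ?\<mu> UNIV"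
    by (rule patch_measure_le_liouville_measure[OF P])
  ultimately show False by simp
qed

end

theorem theorem4p3:
  fixes h :: "quat ^ 'n \<Rightarrow> quat ^ 'n \<Rightarrow> quat" and p q :: nat
    and \<O> :: "(quat ^ 'n ^ 'n) set"
  assumes "CARD('n) = p + q"
    and "hermitian_product h" and "has_signature h p q"
    and "nilpotent_orbit h \<O>"
  shows "uminus ` \<O> = \<O> \<and> (\<O> \<noteq> {0} \<longrightarrow> \<not> admits_gibbs_states (sp_alg h) \<O>)"
proof -
  obtain e :: "'n \<Rightarrow> quat ^ 'n" where "\<forall>i j. i \<noteq> j \<longrightarrow> h (e i) (e j) = 0" "\<forall>i. h (e i) (e i) = 1 \<or> h (e i) (e i) = - 1"
    using assms(3) unfolding has_signature_def by (elim exE conjE) (rule that)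
  then interpret quat_form h e
    using assms(2) by unfold_locales blast+
  have neg: "- Y \<in> \<O>" if "Y \<in> \<O>" for Y
    using nilpotent_orbit_scaleR[OF assms(4) _ that, of "- 1"] by simp
  then have "uminus ` \<O> = \<O>"
    by (force simp: image_iff)
  then show ?thesis
    using nilpotent_orbit_no_gibbs[OF assms(4)] by blast
qed

end
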